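(* Let $q\in\mathbb{C}\setminus\{0\}$, $\delta=q+q^{-1}$, and let $w$ be an infinite link state. (1) If $q$ is generic, then the $TL_\infty(\delta)$ representation $\mathcal{X}(w)$ is irreducible. (2) If $q$ is a root of unity (not generic), with $l$ the smallest positive integer such that $q^{2l}=1$, then: if $s(w)=\infty$, or $s(w)=kl-1$ for some integer $k\ge 1$, or $s(w)=0$ and $l=2$, then $\mathcal{X}(w)$ is irreducible; otherwise $\mathcal{X}(w)$ is indecomposable but not irreducible.
   Context: $q$ is called generic if it is not a root of unity or if $q=\pm1$. $TL_\infty(\delta)$ is the unital associative $\mathbb{C}$-algebra generated by $\mathbf{1}$ and $e_i$, $i\in\mathbb{N}=\{1,2,\dots\}$, with relations $e_i^2=\delta e_i$, $e_ie_{i\pm1}e_i=e_i$, $e_ie_j=e_je_i$ for $|i-j|>1$. An infinite link state is a configuration on the points $1,2,3,\dots$ in which each point is either joined to exactly one other point by a cup, or is the endpoint of a string (attached to that point only), with all cups and strings non-intersecting: no two cups cross, and no string point lies strictly between the two endpoints of a cup. $s(w)\in\mathbb{N}\cup\{0,\infty\}$ is the number of strings of $w$. On the $\mathbb{C}$-vector space with basis all infinite link states, $TL_\infty(\delta)$ acts by diagram concatenation: $e_iw=0$ if $i$ and $i+1$ are both strings of $w$; $e_iw=\delta w$ if $i,i+1$ are joined by a cup; if exactly one of $i,i+1$ is a string and the other is joined by a cup to $b$, then $e_iw$ is obtained from $w$ by joining $i,i+1$ by a cup and making $b$ a string; if $i$ is joined to $a\neq i+1$ and $i+1$ is joined to $b$,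 then $e_iw$ is obtained from $w$ by replacing these two cups by the cups $\{i,i+1\}$ and $\{a,b\}$. $\mathcal{X}(w)$ is the subrepresentation generated by $w$. *)

theory Defs
  imports
    Complex_Main
    "HOL-Algebra.QuotRing"
    "HOL-Library.Poly_Mapping"
    "HOL-Library.Extended_Nat"
begin

text \<open>
  Convention: the points \<open>1, 2, 3, \<dots>\<close> and the generators \<open>e\<^sub>1, e\<^sub>2, e\<^sub>3, \<dots>\<close> are numbered from
  \<open>0\<close>, so that the natural number \<open>i\<close> stands for the point \<open>i + 1\<close> and for the generator
  \<open>e\<^sub>i\<^sub>+\<^sub>1\<close>.
\<close>

section \<open>Complex vector spaces with a given basis\<close>

text \<open>
  \<open>'a \<Rightarrow>\<^sub>0 complex\<close> is the complex vector space with basis \<open>'a\<close>, the basis vector of \<open>x\<close>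
  being \<open>Poly_Mapping.single x 1\<close>.
\<close>

definition cscale :: "complex \<Rightarrow> ('a \<Rightarrow>\<^sub>0 complex) \<Rightarrow> ('a \<Rightarrow>\<^sub>0 complex)" where
  "cscale c v = Poly_Mapping.map ((*) c) v"

lemma lookup_cscale [simp]: "Poly_Mapping.lookup (cscale c v) x = c * Poly_Mapping.lookup v x"
  by (simp add: cscale_def Poly_Mapping.map.rep_eq when_def)

interpretation cvec: vector_space cscale
  by unfold_locales (auto intro!: poly_mapping_eqI simp: lookup_add algebra_simps)

definition lin_ext :: "('a \<Rightarrow> ('b \<Rightarrow>\<^sub>0 complex)) \<Rightarrow> ('a \<Rightarrow>\<^sub>0 complex) \<Rightarrow> ('b \<Rightarrow>\<^sub>0 complex)" where
  "lin_ext f v = (\<Sum>x \<in> Poly_Mapping.keys v. cscale (Poly_Mapping.lookup v x) (f x))"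

lemma lin_ext_superset:
  assumes "finite S" "Poly_Mapping.keys v \<subseteq> S"
  shows "lin_ext f v = (\<Sum>x \<in> S. cscale (Poly_Mapping.lookup v x) (f x))"
  unfolding lin_ext_def using assms
  by (intro sum.mono_neutral_left) (auto simp: in_keys_iff)

lemma lin_ext_add: "lin_ext f (u + v) = lin_ext f u + lin_ext f v"
proof -
  let ?S = "Poly_Mapping.keys u \<union> Poly_Mapping.keys v"
  have "Poly_Mapping.keys (u + v) \<subseteq> ?S"
    by (rule Poly_Mapping.keys_add)
  then show ?thesis
    by (simp add: lin_ext_superset [of ?S] lookup_add cvec.scale_left_distrib sum.distrib)
qed

lemma lin_ext_cscale: "lin_ext f (cscale c v) = cscale c (lin_ext f v)"
proof -
  have "Poly_Mapping.keys (cscale c v) \<subseteq> Poly_Mapping.keys v"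
    by (auto simp: in_keys_iff)
  then show ?thesis
    by (simp add: lin_ext_superset [of "Poly_Mapping.keys v"] cvec.scale_sum_right)
qed

lemma lin_ext_zero [simp]: "lin_ext f 0 = 0"
  by (simp add: lin_ext_def)

lemma lin_ext_uminus: "lin_ext f (- v) = - lin_ext f v"
  by (metis add.right_inverse add_eq_0_iff lin_ext_add lin_ext_zero)

lemma lin_ext_diff: "lin_ext f (u - v) = lin_ext f u - lin_ext f v"
  using lin_ext_add [of f u "- v"] by (simp add: lin_ext_uminus)

lemma lin_ext_single [simp]: "lin_ext f (Poly_Mapping.single x c) = cscale c (f x)"
  by (simp add: lin_ext_def)

lemma lin_ext_sum: "lin_ext f (\<Sum>x\<in>S. g x) = (\<Sum>x\<in>S. lin_ext f (g x))"
  by (induction S rule: infinite_finite_induct) (simp_all add: lin_ext_add)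

lemma cvec_expand: "v = (\<Sum>x \<in> Poly_Mapping.keys v. cscale (Poly_Mapping.lookup v x) (Poly_Mapping.single x 1))"
  by (rule poly_mapping_eqI)
    (auto simp: lookup_sum lookup_single when_def in_keys_iff if_distrib sum.delta cong: if_cong)

lemma lin_ext_linear: "Vector_Spaces.linear cscale cscale (lin_ext f)"
  by (intro Vector_Spaces.linear.intro module_hom.intro module_hom_axioms.intro
      cvec.vector_space_axioms cvec.module_axioms lin_ext_add lin_ext_cscale)

section \<open>The algebra \<open>TL\<^sub>\<infinity>(\<delta>)\<close>\<close>

text \<open>
  Words in the generators form a monoid, written additively only because the library's
  monoid algebra \<open>'a \<Rightarrow>\<^sub>0 complex\<close> (convolution product) expects an additive \<open>'a\<close>. So
  \<open>tl_word \<Rightarrow>\<^sub>0 complex\<close> is the free unital associative algebra on the generators; a scalar \<open>c\<close>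
  is its element \<open>Poly_Mapping.single 0 c\<close>.
\<close>

datatype tl_word = TL_Word (letters: "nat list")

instantiation tl_word :: monoid_add
begin

definition "0 = TL_Word []"

definition "u + v = TL_Word (letters u @ letters v)"

instance
  by standard (auto simp: zero_tl_word_def plus_tl_word_def)

end

type_synonym tl_free = "tl_word \<Rightarrow>\<^sub>0 complex"

definition free_alg :: "tl_free ring" where
  "free_alg = \<lparr>carrier = UNIV, mult = (*), one = 1, zero = 0, add = (+)\<rparr>"

definition gen :: "nat \<Rightarrow> tl_free" where
  "gen i = Poly_Mapping.single (TL_Word [i]) 1"

definition relators :: "complex \<Rightarrow> tl_free set" where
  "relators \<delta> =
     {gen i * gen i - Poly_Mapping.single 0 \<delta> * gen i | i. True}
   \<union> {gen i * gen j * gen i - gen i | i j. j = Suc i \<or> i = Suc j}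
   \<union> {gen i * gen j - gen j * gen i | i j. Suc i < j \<or> Suc j < i}"

definition TL :: "complex \<Rightarrow> tl_free set ring" where
  "TL \<delta> = free_alg Quot (Idl\<^bsub>free_alg\<^esub> (relators \<delta>))"

section \<open>Infinite link states\<close>

text \<open>
  A configuration is encoded by the map sending an endpoint of a cup to the other endpoint of
  that cup, and a string point to itself.
\<close>

definition is_link_state :: "(nat \<Rightarrow> nat) \<Rightarrow> bool" where
  "is_link_state p \<longleftrightarrow>
     (\<forall>a. p (p a) = a) \<and>
     (\<forall>a b. \<not> (a < b \<and> b < p a \<and> p a < p b)) \<and>
     (\<forall>a b. \<not> (a < b \<and> b < p a \<and> p b = b))"

typedef link_state = "{p. is_link_state p}"
  morphisms partner Abs_link_state
  by (rule exI [of _ id]) (simp add: is_link_state_def)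

definition string_points :: "link_state \<Rightarrow> nat set" where
  "string_points w = {a. partner w a = a}"

definition num_strings :: "link_state \<Rightarrow> enat" where
  "num_strings w = (if finite (string_points w) then enat (card (string_points w)) else \<infinity>)"

text \<open>
  The effect of a generator on a configuration, except in the two cases where \<open>i\<close> and \<open>i + 1\<close>
  are both strings or are joined to each other.
\<close>

definition reconnect :: "nat \<Rightarrow> (nat \<Rightarrow> nat) \<Rightarrow> (nat \<Rightarrow> nat)" where
  "reconnect i p =
     (if p i = i then p(i := Suc i, Suc i := i, p (Suc i) := p (Suc i))
      else if p (Suc i) = Suc i then p(i := Suc i, Suc i := i, p i := p i)
      else p(i := Suc i, Suc i := i, p i := p (Suc i), p (Suc i) := p i))"

definition e_basis :: "complex \<Rightarrow> nat \<Rightarrow> link_state \<Rightarrow> (link_state \<Rightarrow>\<^sub>0 complex)" where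
  "e_basis \<delta> i w =
     (let p = partner w in
      if p i = i \<and> p (Suc i) = Suc i then 0
      else if p i = Suc i then Poly_Mapping.single w \<delta>
      else Poly_Mapping.single (Abs_link_state (reconnect i p)) 1)"

definition e_op :: "complex \<Rightarrow> nat \<Rightarrow> (link_state \<Rightarrow>\<^sub>0 complex) \<Rightarrow> (link_state \<Rightarrow>\<^sub>0 complex)" where
  "e_op \<delta> i = lin_ext (e_basis \<delta> i)"

subsection \<open>The Temperley--Lieb relations\<close>

lemma reconnect_cases:
  assumes inv: "\<And>a. p (p a) = (a::nat)" and "\<not> (p i = i \<and> p (Suc i) = Suc i)" "p i \<noteq> Suc i"
  obtains (left) b where "p i = i" "p (Suc i) = b" "p b = Suc i" "b \<noteq> i" "b \<noteq> Suc i"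
      "reconnect i p = (\<lambda>x. if x = i then Suc i else if x = Suc i then i else if x = b then b else p x)"
  | (right) b where "p (Suc i) = Suc i" "p i = b" "p b = i" "b \<noteq> i" "b \<noteq> Suc i"
      "reconnect i p = (\<lambda>x. if x = i then Suc i else if x = Suc i then i else if x = b then b else p x)"
  | (both) a b where "p i = a" "p a = i" "p (Suc i) = b" "p b = Suc i" "a \<noteq> i" "a \<noteq> Suc i" "b \<noteq> i" "b \<noteq> Suc i" "a \<noteq> b"
      "reconnect i p = (\<lambda>x. if x = i then Suc i else if x = Suc i then i else if x = a then b else if x = b then a else p x)"
proof -
  consider (A) "p i = i" | (B) "p i \<noteq> i" "p (Suc i) = Suc i" | (C) "p i \<noteq> i" "p (Suc i) \<noteq> Suc i" by blast
  then show ?thesis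
  proof cases
    case A
    have *: "p (Suc i) \<noteq> Suc i" "p (Suc i) \<noteq> i" using A assms by (metis n_not_Suc_n)+
    show ?thesis by (rule left) (use A * inv in \<open>auto simp: reconnect_def fun_eq_iff\<close>)
  next
    case B
    show ?thesis by (rule right) (use B assms in \<open>auto simp: reconnect_def fun_eq_iff\<close>)
  next
    case C
    have *: "p (Suc i) \<noteq> i" "p i \<noteq> p (Suc i)" using assms by (metis n_not_Suc_n)+
    show ?thesis by (rule both [of "p i" "p (Suc i)"]) (use C * assms in \<open>auto simp: reconnect_def fun_eq_iff\<close>)
  qed
qed

lemma is_link_stateI:
  assumes "\<And>a. p (p a) = a" "\<And>a b. a < b \<Longrightarrow> b < p a \<Longrightarrow> p b < p a \<and> p b \<noteq> b"
  shows "is_link_state p"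
  unfolding is_link_state_def using assms by (metis order_less_asym)

lemma is_link_stateD:
  assumes "is_link_state p" "a < b" "b < p a"
  shows "a < p b" "p b < p a" "p b \<noteq> b"
proof -
  show "p b \<noteq> b" using assms by (auto simp: is_link_state_def)
  have 1: "p b \<le> p a" using assms by (auto simp: is_link_state_def not_less[symmetric])
  moreover have "p b \<noteq> p a" using assms by (metis is_link_state_def less_irrefl)
  ultimately show 2: "p b < p a" by simp
  show "a < p b"
  proof (rule ccontr)
    assume "\<not> a < p b"
    moreover have "p b \<noteq> a" using assms by (metis is_link_state_def less_irrefl)
    ultimately have "p b < a" by simp
    moreover have "\<not> (p b < a \<and> a < p (p b) \<and> p (p b) < p a)" "p (p b) = b"
      using assms(1) unfolding is_link_state_def by blast+
    ultimately show False using assms by simp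
  qed
qed


lemma is_link_state_reconnect:
  assumes p: "is_link_state p" and "\<not> (p i = i \<and> p (Suc i) = Suc i)" "p i \<noteq> Suc i"
  shows "is_link_state (reconnect i p)"
proof -
  have inv: "\<And>a. p (p a) = a" using p by (simp add: is_link_state_def)
  note N = is_link_stateD [OF p]
  have one: "is_link_state (\<lambda>x. if x = i then Suc i else if x = Suc i then i else if x = b then b else p x)"
    (is "is_link_state ?r")
    if b: "b \<noteq> i" "b \<noteq> Suc i" "p i = i \<and> p (Suc i) = b \<and> p b = Suc i \<or> p (Suc i) = Suc i \<and> p i = b \<and> p b = i" for b
  proof (rule is_link_stateI)
    fix x
    have "p x \<notin> {i, Suc i, b}" if "x \<notin> {i, Suc i, b}" using that b inv[of x] by auto
    then show "?r (?r x) = x"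
      using inv[of x] b(1,2) by simp
  next
    fix x y assume xy: "x < y" "y < ?r x"
    then have x: "x \<noteq> i" "x \<noteq> Suc i" "x \<noteq> b" and y: "y < p x" by (auto split: if_splits)
    have px: "p x \<noteq> i" "p x \<noteq> Suc i" "p x \<noteq> b" using b x inv[of x] by auto
    have no: "\<not> (x < i \<and> i < p x)" "\<not> (x < Suc i \<and> Suc i < p x)"
      using b(3) N(3)[of x i] N(3)[of x "Suc i"] x(1,2) px(1,2) by (auto simp: less_Suc_eq)
    have "\<not> (x < b \<and> b < p x)" using no N(1,2)[of x b] b(3) by metis
    with no xy y x px have "y \<noteq> i" "y \<noteq> Suc i" "y \<noteq> b" by auto
    then show "?r y < ?r x \<and> ?r y \<noteq> y"
      using x N[of x y] xy y by simp
  qed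
  from inv assms(2,3) show ?thesis
  proof (cases rule: reconnect_cases)
    case (left b)
    then show ?thesis using one[of b] by simp
  next
    case (right b)
    then show ?thesis using one[of b] by simp
  next
    case (both a b)
    let ?r = "\<lambda>x. if x = i then Suc i else if x = Suc i then i else if x = a then b else if x = b then a else p x"
    have "\<not> (a < b \<and> b < i)" using N(2)[of a b] both(2,4) by auto
    moreover have "\<not> (b < i \<and> i < a)" using N(2)[of b i] both(1,4) by auto
    moreover have "\<not> (i < a \<and> a < b)" using N(2)[of i "Suc i"] both(1,3,6) by auto
    ultimately have c: "a < i \<and> Suc i < b \<or> b < a \<and> a < i \<or> Suc i < b \<and> b < a"
      using both(5-9) by arith
    have "is_link_state ?r"
    proof (rule is_link_stateI)
      fix x
      have "p x \<notin> {i, Suc i, a, b}" if "x \<notin> {i, Suc i, a, b}" using that both(1-4) inv[of x] by auto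
      then show "?r (?r x) = x"
        using inv[of x] both(5-9) by simp
    next
      fix x y assume xy: "x < y" "y < ?r x"
      consider "x = a" | "x = b" | "x \<notin> {i, Suc i, a, b}" using xy by (auto split: if_splits)
      then show "?r y < ?r x \<and> ?r y \<noteq> y"
      proof cases
        case 1
        then have ab: "a < y" "y < b" using xy both(5-9) by auto
        show ?thesis
        proof (cases "y = i \<or> y = Suc i")
          case False
          then have "y < i \<or> Suc i < y" by auto
          then have "p y < b \<and> p y \<noteq> y"
            using c ab both(2,3) N(2,3)[of a y] N(2,3)[of "Suc i" y] by (elim disjE) auto
          then show ?thesis using ab both(5-9) False 1 by simp
        qed (use c ab both(5-9) 1 in auto)
      next
        case 2
        then have ab: "b < y" "y < a" using xy both(5-9) by auto
        show ?thesis
        proof (cases "y = i \<or> y = Suc i")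
          case False
          have inv': "p (p y) = y" by (rule inv)
          have ne: "p y \<noteq> a" "p y \<noteq> b" "p y \<noteq> i" "p y \<noteq> Suc i" using inv' ab both(1-4) False by auto
          have "p y < a \<and> p y \<noteq> y"
            using c ab both(1,2,4) ne(1,3) inv' N(2,3)[of b y] N(1)[of a "p y"] N(2,3)[of i y] by (elim disjE; cases "p y < a") auto
          then show ?thesis using ab both(5-9) False 2 by simp
        qed (use c ab both(5-9) 2 in auto)
      next
        case 3
        then have y: "y < p x" using xy by auto
        have ne: "p x \<noteq> i" "p x \<noteq> Suc i" "p x \<noteq> a" "p x \<noteq> b" using inv[of x] both(1-4) 3 by auto
        have "?r y < p x \<and> ?r y \<noteq> y" if yin: "y \<in> {i, Suc i, a, b}"
        proof -
          have "x < i \<and> i < p x \<or> x < Suc i \<and> Suc i < p x"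
            using yin xy(1) y N(1,2)[of x a] N(1,2)[of x b] both(2,4) by auto
          then have yi: "i < p x" "x < i" "Suc i < p x" "x < Suc i"
            using 3 ne by auto
          then have "a < p x" "b < p x"
            using N(2)[of x i] N(2)[of x "Suc i"] both(1,3) by auto
          then show ?thesis
            using yin yi both(5-9) by auto
        qed
        moreover have "p y < p x \<and> p y \<noteq> y" using N[of x y] xy(1) y by simp
        ultimately show ?thesis using 3 both(9) by (cases "y \<in> {i, Suc i, a, b}") simp_all
      qed
    qed
    then show ?thesis using both(10) by simp
  qed
qed
text \<open>A uniform version of \<open>reconnect\<close>, for two arbitrary points in place of \<open>i\<close>, \<open>i + 1\<close>.\<close>

definition rj :: "'a \<Rightarrow> 'a \<Rightarrow> ('a \<Rightarrow> 'a) \<Rightarrow> 'a \<Rightarrow> 'a" where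
  "rj a b p x = (if x = a then b else if x = b then a
     else if p x = a then (if p b = b then x else p b)
     else if p x = b then (if p a = a then x else p a) else p x)"

lemma rj_eq:
  assumes inv: "\<And>a. p (p a) = (a::nat)" and "\<not> (p i = i \<and> p (Suc i) = Suc i)" "p i \<noteq> Suc i"
  shows "reconnect i p = rj i (Suc i) p"
proof
  fix x
  have e: "p x = z \<longleftrightarrow> p z = x" for z using inv by metis
  show "reconnect i p x = rj i (Suc i) p x" unfolding rj_def
  using inv assms(2,3)
    by (cases rule: reconnect_cases) (simp_all add: e)
qed

lemma rj_1:
  assumes inv: "\<And>x. p (p x) = x" and ne: "distinct [a,b,c,d]"
    and i: "\<not> (p a = a \<and> p b = b)" "p a \<noteq> b" and j: "\<not> (p c = c \<and> p d = d)" "p c \<noteq> d"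
  shows "rj a b p c = c \<and> rj a b p d = d \<longleftrightarrow> rj c d p a = a \<and> rj c d p b = b"
  using i j ne inv[of a] inv[of b] inv[of c] inv[of d] unfolding rj_def
  by (smt (verit) distinct_length_2_or_more)
lemma rj_2:
  assumes inv: "\<And>x. p (p x) = x" and ne: "distinct [a,b,c,d]"
    and i: "\<not> (p a = a \<and> p b = b)" "p a \<noteq> b" and j: "\<not> (p c = c \<and> p d = d)" "p c \<noteq> d"
  shows "rj a b p c = d \<longleftrightarrow> rj c d p a = b"
  using i j ne inv[of a] inv[of b] inv[of c] inv[of d] unfolding rj_def
  by (smt (verit) distinct_length_2_or_more)
lemma rj_3:
  assumes inv: "\<And>x. p (p x) = x" and ne: "distinct [a,b,c,d]"
    and i: "\<not> (p a = a \<and> p b = b)" "p a \<noteq> b" and j: "\<not> (p c = c \<and> p d = d)" "p c \<noteq> d"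
    and "rj a b p c = d" 
  shows "rj a b p x = rj c d p x"
  using i j ne assms(7) inv[of a] inv[of b] inv[of c] inv[of d] inv[of x] unfolding rj_def
  by (smt (verit) distinct_length_2_or_more)
lemma rj_4:
  assumes inv: "\<And>x. p (p x) = x" and ne: "distinct [a,b,c,d]"
    and i: "\<not> (p a = a \<and> p b = b)" "p a \<noteq> b" and j: "\<not> (p c = c \<and> p d = d)" "p c \<noteq> d"
    and "rj a b p c \<noteq> d" "\<not> (rj a b p c = c \<and> rj a b p d = d)"
  shows "rj c d (rj a b p) x = rj a b (rj c d p) x"
  using i j ne assms(7,8) inv[of a] inv[of b] inv[of c] inv[of d] inv[of x] unfolding rj_def
  by (smt (verit) distinct_length_2_or_more)
lemma rj_back:
  assumes inv: "\<And>x. p (p x) = x" and ne: "distinct [a, b, c]" and ab: "p a = b"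
  shows "\<not> (rj b c p a = a \<and> rj b c p b = b)" "rj b c p a \<noteq> b" "rj a b (rj b c p) x = p x"
    "\<not> (rj c a p a = a \<and> rj c a p b = b)" "rj c a p a \<noteq> b" "rj a b (rj c a p) x = p x"
  using ne ab inv[of a] inv[of b] inv[of c] inv[of x] unfolding rj_def
  by (smt (verit) distinct_length_2_or_more)+

lemma rj_far:
  assumes inv: "\<And>x. p (p x) = x" and ne: "distinct [a, b, c, d]"
    and j: "\<not> (p c = c \<and> p d = d)" "p c \<noteq> d"
  shows "p a = a \<Longrightarrow> p b = b \<Longrightarrow> rj c d p a = a \<and> rj c d p b = b" "p a = b \<Longrightarrow> rj c d p a = b"
  using ne j inv[of a] inv[of b] inv[of c] inv[of d] unfolding rj_def
  by (smt (verit) distinct_length_2_or_more)+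

lemma partner_link_state: "is_link_state (partner w)"
  using partner [of w] by simp

lemma partner_partner [simp]: "partner w (partner w a) = a"
  using partner_link_state [of w] by (simp add: is_link_state_def)

definition both_strings :: "nat \<Rightarrow> link_state \<Rightarrow> bool" where
  "both_strings i w \<longleftrightarrow> partner w i = i \<and> partner w (Suc i) = Suc i"

definition rejoin :: "nat \<Rightarrow> link_state \<Rightarrow> link_state" where
  "rejoin i w = Abs_link_state (reconnect i (partner w))"

lemma e_basis_both_strings: "both_strings i w \<Longrightarrow> e_basis \<delta> i w = 0"
  by (simp add: e_basis_def both_strings_def)

lemma e_basis_cup: "partner w i = Suc i \<Longrightarrow> e_basis \<delta> i w = Poly_Mapping.single w \<delta>"
  by (simp add: e_basis_def)

lemma e_basis_rejoin:
  "\<not> both_strings i w \<Longrightarrow> partner w i \<noteq> Suc i \<Longrightarrow>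
    e_basis \<delta> i w = Poly_Mapping.single (rejoin i w) 1"
  by (auto simp: e_basis_def both_strings_def rejoin_def Let_def)

lemma partner_rejoin:
  assumes "\<not> both_strings i w" "partner w i \<noteq> Suc i"
  shows "partner (rejoin i w) = rj i (Suc i) (partner w)"
proof -
  have "is_link_state (reconnect i (partner w))"
    using assms partner_link_state by (intro is_link_state_reconnect) (auto simp: both_strings_def)
  then have "partner (rejoin i w) = reconnect i (partner w)"
    by (simp add: rejoin_def Abs_link_state_inverse)
  also have "\<dots> = rj i (Suc i) (partner w)"
    using assms by (intro rj_eq) (auto simp: both_strings_def)
  finally show ?thesis .
qed

lemma link_state_eqI: "(\<And>x. partner v x = partner w x) \<Longrightarrow> v = w"
  by (metis ext partner_inject)

lemma partner_rejoin_self: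
  assumes "\<not> both_strings i w" "partner w i \<noteq> Suc i"
  shows "partner (rejoin i w) i = Suc i"
  using assms by (simp add: partner_rejoin rj_def)

lemma e_op_single [simp]: "e_op \<delta> i (Poly_Mapping.single w c) = cscale c (e_basis \<delta> i w)"
  by (simp add: e_op_def)

lemma e_op_zero [simp]: "e_op \<delta> i 0 = 0"
  by (simp add: e_op_def)

lemma e_op_add: "e_op \<delta> i (u + v) = e_op \<delta> i u + e_op \<delta> i v"
  by (simp add: e_op_def lin_ext_add)

lemma e_op_cscale: "e_op \<delta> i (cscale c v) = cscale c (e_op \<delta> i v)"
  by (simp add: e_op_def lin_ext_cscale)

lemma e_op_sum: "e_op \<delta> i (\<Sum>x\<in>S. g x) = (\<Sum>x\<in>S. e_op \<delta> i (g x))"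
  by (simp add: e_op_def lin_ext_sum)

lemma cscale_single [simp]: "cscale c (Poly_Mapping.single x d) = Poly_Mapping.single x (c * d)"
  by (rule poly_mapping_eqI) (simp add: lookup_single when_def)

lemma e_op_square_basis: "e_op \<delta> i (e_basis \<delta> i w) = cscale \<delta> (e_basis \<delta> i w)"
proof -
  consider "both_strings i w" | "partner w i = Suc i" | "\<not> both_strings i w" "partner w i \<noteq> Suc i" by blast
  then show ?thesis
    by cases (simp_all add: e_basis_both_strings e_basis_cup e_basis_rejoin partner_rejoin_self)
qed

lemma e_op_back_basis:
  assumes w: "partner w i = Suc i" and j: "j = Suc i \<or> i = Suc j"
  shows "e_op \<delta> i (e_basis \<delta> j w) = Poly_Mapping.single w 1"
proof -
  have w': "partner w (Suc i) = i" using partner_partner [of w i] w by simp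
  have jw: "\<not> both_strings j w" "partner w j \<noteq> Suc j"
    using w w' j by (auto simp: both_strings_def) (metis Suc_n_not_le_n le_SucI order_refl partner_partner)
  let ?v = "rejoin j w"
  have "\<not> both_strings i ?v \<and> partner ?v i \<noteq> Suc i \<and> (\<forall>x. rj i (Suc i) (partner ?v) x = partner w x)"
    using j
  proof
    assume j: "j = Suc i"
    show ?thesis
      using rj_back(1-3) [of "partner w" i "Suc i" "Suc (Suc i)"] w
      by (simp add: both_strings_def partner_rejoin [OF jw, unfolded j] j)
  next
    assume j: "i = Suc j"
    then have "i \<noteq> j" "Suc i \<noteq> j" by auto
    then show ?thesis
      using rj_back(4-6) [of "partner w" i "Suc i" j] w
      by (simp add: both_strings_def partner_rejoin [OF jw] flip: j)
  qed
  then show ?thesis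
    using jw by (auto simp: e_basis_rejoin partner_rejoin intro!: link_state_eqI arg_cong [where f = "\<lambda>w. Poly_Mapping.single w 1"])
qed

lemma e_op_braid_basis:
  assumes j: "j = Suc i \<or> i = Suc j"
  shows "e_op \<delta> i (e_op \<delta> j (e_basis \<delta> i w)) = e_basis \<delta> i w"
proof -
  consider "both_strings i w" | "partner w i = Suc i" | "\<not> both_strings i w" "partner w i \<noteq> Suc i" by blast
  then show ?thesis
    by cases (simp_all add: e_basis_both_strings e_basis_cup e_basis_rejoin partner_rejoin_self
        e_op_cscale e_op_back_basis [OF _ j])
qed

lemma e_op_commute_basis:
  assumes ij: "Suc i < j \<or> Suc j < i"
  shows "e_op \<delta> i (e_basis \<delta> j w) = e_op \<delta> j (e_basis \<delta> i w)"
proof -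
  let ?p = "partner w"
  have d: "distinct [i, Suc i, j, Suc j]" "distinct [j, Suc j, i, Suc i]" using ij by auto
  note inv = partner_partner [of w]
  have far: "both_strings a (rejoin b w)" if "both_strings a w" "\<not> both_strings b w" "?p b \<noteq> Suc b"
      "distinct [a, Suc a, b, Suc b]" for a b
    using rj_far(1) [OF inv that(4)] that by (simp add: both_strings_def partner_rejoin)
  have far': "partner (rejoin b w) a = Suc a" if "partner w a = Suc a" "\<not> both_strings b w" "?p b \<noteq> Suc b"
      "distinct [a, Suc a, b, Suc b]" for a b
    using rj_far(2) [OF inv that(4)] that by (simp add: both_strings_def partner_rejoin)
  have main: ?thesis if i: "\<not> both_strings i w" "?p i \<noteq> Suc i" and j: "\<not> both_strings j w" "?p j \<noteq> Suc j"
  proof -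
    note pi = partner_rejoin [OF i] and pj = partner_rejoin [OF j]
    note i' = i [unfolded both_strings_def] and j' = j [unfolded both_strings_def]
    have 1: "both_strings j (rejoin i w) \<longleftrightarrow> both_strings i (rejoin j w)"
      using rj_1 [OF inv d(1) i' j'] by (simp add: both_strings_def pi pj)
    have 2: "partner (rejoin i w) j = Suc j \<longleftrightarrow> partner (rejoin j w) i = Suc i"
      using rj_2 [OF inv d(1) i' j'] by (simp add: pi pj)
    have 3: "rejoin i w = rejoin j w" if "partner (rejoin i w) j = Suc j"
      using rj_3 [OF inv d(1) i' j'] that by (auto simp: pi pj intro: link_state_eqI)
    have 4: "rejoin j (rejoin i w) = rejoin i (rejoin j w)"
      if "\<not> both_strings j (rejoin i w)" "partner (rejoin i w) j \<noteq> Suc j"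
    proof (rule link_state_eqI)
      fix x
      have "\<not> both_strings i (rejoin j w)" "partner (rejoin j w) i \<noteq> Suc i"
        using that 1 2 by auto
      then show "partner (rejoin j (rejoin i w)) x = partner (rejoin i (rejoin j w)) x"
        using rj_4 [OF inv d(1) i' j', of x] that
        by (simp add: partner_rejoin [OF that] partner_rejoin [of i "rejoin j w"])
           (simp add: both_strings_def pi pj)
    qed
    consider "both_strings j (rejoin i w)" | "partner (rejoin i w) j = Suc j"
      | "\<not> both_strings j (rejoin i w)" "partner (rejoin i w) j \<noteq> Suc j" by blast
    then show ?thesis
    proof cases
      case 1
      then show ?thesis using \<open>both_strings j _ \<longleftrightarrow> _\<close> i j by (simp add: e_basis_rejoin e_basis_both_strings)
    next
      case 2
      then show ?thesis using 3 \<open>partner (rejoin i w) j = Suc j \<longleftrightarrow> _\<close> i j by (simp add: e_basis_rejoin e_basis_cup)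
    next
      case 3
      then have "\<not> both_strings i (rejoin j w)" "partner (rejoin j w) i \<noteq> Suc i"
        using 1 2 by auto
      then show ?thesis using 3 4 i j by (simp add: e_basis_rejoin)
    qed
  qed
  consider (zi) "both_strings i w" | (ci) "?p i = Suc i" | (gi) "\<not> both_strings i w" "?p i \<noteq> Suc i" by blast
  then show ?thesis
  proof cases
    case zi
    consider (zj) "both_strings j w" | (cj) "?p j = Suc j" | (gj) "\<not> both_strings j w" "?p j \<noteq> Suc j" by blast
    then show ?thesis
      by cases (use zi far [OF zi _ _ d(1)] in \<open>simp_all add: e_basis_both_strings e_basis_cup e_basis_rejoin\<close>)
  next
    case ci
    consider (zj) "both_strings j w" | (cj) "?p j = Suc j" | (gj) "\<not> both_strings j w" "?p j \<noteq> Suc j" by blast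
    then show ?thesis
      by cases (use ci far' [OF ci _ _ d(1)] in \<open>simp_all add: e_basis_both_strings e_basis_cup e_basis_rejoin\<close>)
  next
    case gi
    consider (zj) "both_strings j w" | (cj) "?p j = Suc j" | (gj) "\<not> both_strings j w" "?p j \<noteq> Suc j" by blast
    then show ?thesis
    proof cases
      case zj
      then show ?thesis
        using gi far [OF zj gi d(2)] by (simp add: e_basis_both_strings e_basis_rejoin)
    next
      case cj
      then show ?thesis
        using gi far' [OF cj gi d(2)] by (simp add: e_basis_cup e_basis_rejoin)
    next
      case gj
      then show ?thesis using main gi by blast
    qed
  qed
qed

lemma e_op_square: "e_op \<delta> i (e_op \<delta> i v) = cscale \<delta> (e_op \<delta> i v)"
  by (subst (1 2) cvec_expand [of v])
    (simp add: e_op_sum e_op_cscale e_op_square_basis cvec.scale_sum_right mult.commute)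

lemma e_op_braid: "j = Suc i \<or> i = Suc j \<Longrightarrow> e_op \<delta> i (e_op \<delta> j (e_op \<delta> i v)) = e_op \<delta> i v"
  by (subst (1 2) cvec_expand [of v]) (simp add: e_op_sum e_op_cscale e_op_braid_basis)

lemma e_op_commute: "Suc i < j \<or> Suc j < i \<Longrightarrow> e_op \<delta> i (e_op \<delta> j v) = e_op \<delta> j (e_op \<delta> i v)"
  by (subst (1 2) cvec_expand [of v]) (simp add: e_op_sum e_op_cscale e_op_commute_basis [of i j])

section \<open>The representation on link states and its subrepresentations\<close>

definition word_act :: "complex \<Rightarrow> tl_word \<Rightarrow> (link_state \<Rightarrow>\<^sub>0 complex) \<Rightarrow> (link_state \<Rightarrow>\<^sub>0 complex)" where
  "word_act \<delta> u v = foldr (e_op \<delta>) (letters u) v"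

definition free_act :: "complex \<Rightarrow> tl_free \<Rightarrow> (link_state \<Rightarrow>\<^sub>0 complex) \<Rightarrow> (link_state \<Rightarrow>\<^sub>0 complex)" where
  "free_act \<delta> a v = lin_ext (\<lambda>u. word_act \<delta> u v) a"

text \<open>
  The elements of \<open>TL \<delta>\<close> are cosets in the free algebra. Any representative may be used for the
  action, see \<open>tl_act_eq\<close> below.
\<close>

definition tl_act :: "complex \<Rightarrow> tl_free set \<Rightarrow> (link_state \<Rightarrow>\<^sub>0 complex) \<Rightarrow> (link_state \<Rightarrow>\<^sub>0 complex)" where
  "tl_act \<delta> A v = free_act \<delta> (SOME a. a \<in> A) v"

definition subrep :: "complex \<Rightarrow> (link_state \<Rightarrow>\<^sub>0 complex) set \<Rightarrow> bool" where
  "subrep \<delta> U \<longleftrightarrow> cvec.subspace U \<and> (\<forall>A \<in> carrier (TL \<delta>). \<forall>v \<in> U. tl_act \<delta> A v \<in> U)"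

definition irreducible_rep :: "complex \<Rightarrow> (link_state \<Rightarrow>\<^sub>0 complex) set \<Rightarrow> bool" where
  "irreducible_rep \<delta> W \<longleftrightarrow>
     subrep \<delta> W \<and> W \<noteq> {0} \<and> (\<forall>U. subrep \<delta> U \<and> U \<subseteq> W \<longrightarrow> U = {0} \<or> U = W)"

definition indecomposable_rep :: "complex \<Rightarrow> (link_state \<Rightarrow>\<^sub>0 complex) set \<Rightarrow> bool" where
  "indecomposable_rep \<delta> W \<longleftrightarrow>
     subrep \<delta> W \<and> W \<noteq> {0} \<and>
     \<not> (\<exists>U V. subrep \<delta> U \<and> subrep \<delta> V \<and> U \<noteq> {0} \<and> V \<noteq> {0} \<and>
           U \<inter> V = {0} \<and> W = {u + v | u v. u \<in> U \<and> v \<in> V})"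

definition generated_rep :: "complex \<Rightarrow> link_state \<Rightarrow> (link_state \<Rightarrow>\<^sub>0 complex) set" where
  "generated_rep \<delta> w = \<Inter> {U. subrep \<delta> U \<and> Poly_Mapping.single w 1 \<in> U}"

definition root_of_unity :: "complex \<Rightarrow> bool" where
  "root_of_unity q \<longleftrightarrow> (\<exists>n::nat. n > 0 \<and> q ^ n = 1)"

definition generic :: "complex \<Rightarrow> bool" where
  "generic q \<longleftrightarrow> \<not> root_of_unity q \<or> q = 1 \<or> q = -1"

subsection \<open>The action is well defined\<close>

lemma word_act_zero [simp]: "word_act \<delta> 0 v = v"
  by (simp add: word_act_def zero_tl_word_def)

lemma word_act_plus: "word_act \<delta> (u + u') v = word_act \<delta> u (word_act \<delta> u' v)"
  by (simp add: word_act_def plus_tl_word_def)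

lemma word_act_add: "word_act \<delta> u (v + v') = word_act \<delta> u v + word_act \<delta> u v'"
proof -
  have "foldr (e_op \<delta>) us (v + v') = foldr (e_op \<delta>) us v + foldr (e_op \<delta>) us v'" for us
    by (induction us) (simp_all add: e_op_add)
  then show ?thesis by (simp add: word_act_def)
qed

lemma word_act_cscale: "word_act \<delta> u (cscale c v) = cscale c (word_act \<delta> u v)"
proof -
  have "foldr (e_op \<delta>) us (cscale c v) = cscale c (foldr (e_op \<delta>) us v)" for us
    by (induction us) (simp_all add: e_op_cscale)
  then show ?thesis by (simp add: word_act_def)
qed

lemma free_act_add_left: "free_act \<delta> (a + b) v = free_act \<delta> a v + free_act \<delta> b v"
  by (simp add: free_act_def lin_ext_add)

lemma free_act_diff_left: "free_act \<delta> (a - b) v = free_act \<delta> a v - free_act \<delta> b v"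
  by (simp add: free_act_def lin_ext_diff)

lemma free_act_zero_left [simp]: "free_act \<delta> 0 v = 0"
  by (simp add: free_act_def)

lemma free_act_single: "free_act \<delta> (Poly_Mapping.single u c) v = cscale c (word_act \<delta> u v)"
  by (simp add: free_act_def)

lemma free_act_one [simp]: "free_act \<delta> 1 v = v"
  by (simp add: free_act_single flip: single_one)

lemma free_act_gen [simp]: "free_act \<delta> (gen i) v = e_op \<delta> i v"
  by (simp add: gen_def free_act_single word_act_def)

lemma free_act_add: "free_act \<delta> a (v + v') = free_act \<delta> a v + free_act \<delta> a v'"
  by (simp add: free_act_def lin_ext_def word_act_add cvec.scale_right_distrib sum.distrib)

lemma free_act_cscale: "free_act \<delta> a (cscale c v) = cscale c (free_act \<delta> a v)"
  by (simp add: free_act_def lin_ext_def word_act_cscale cvec.scale_sum_right mult.commute)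

lemma free_act_zero [simp]: "free_act \<delta> a 0 = 0"
  using free_act_add [of \<delta> a 0 0] by simp

lemma poly_mapping_add_induct:
  fixes a :: "'a \<Rightarrow>\<^sub>0 complex"
  assumes "P 0" "\<And>x c. P (Poly_Mapping.single x c)" "\<And>a b. P a \<Longrightarrow> P b \<Longrightarrow> P (a + b)"
  shows "P a"
proof -
  have "P (\<Sum>x\<in>S. cscale (f x) (Poly_Mapping.single x 1))" for S and f :: "'a \<Rightarrow> complex"
    by (induction S rule: infinite_finite_induct) (simp_all add: assms)
  then show ?thesis
    by (subst cvec_expand)
qed

lemma free_act_mult: "free_act \<delta> (a * b) v = free_act \<delta> a (free_act \<delta> b v)"
proof (induction a rule: poly_mapping_add_induct)
  case (2 x c)
  show ?case
    by (induction b rule: poly_mapping_add_induct)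
      (simp_all add: distrib_left free_act_add_left free_act_add free_act_single mult_single
        word_act_plus word_act_cscale)
qed (simp_all add: distrib_right free_act_add_left)

lemma free_act_relators: "r \<in> relators \<delta> \<Longrightarrow> free_act \<delta> r v = 0"
  by (auto simp: relators_def free_act_diff_left free_act_mult free_act_single
      e_op_square e_op_braid intro: e_op_commute)

lemma ring_free_alg: "ring free_alg"
proof
  show "carrier (add_monoid free_alg) \<subseteq> Units (add_monoid free_alg)"
    by (auto simp: free_alg_def Units_def) (metis add.right_inverse add.left_inverse)
qed (auto simp: free_alg_def algebra_simps)

lemma ideal_annihilator: "ideal {a. \<forall>v. free_act \<delta> a v = 0} free_alg"
proof -
  interpret ring free_alg by (rule ring_free_alg)
  have inv: "\<ominus>\<^bsub>free_alg\<^esub> a = - a" for a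
    by (rule minus_equality) (simp_all add: free_alg_def)
  show ?thesis
  proof (rule idealI [OF ring_free_alg])
    show "subgroup {a. \<forall>v. free_act \<delta> a v = 0} (add_monoid free_alg)"
      by (rule subgroup.intro)
        (use inv in \<open>auto simp: free_alg_def a_inv_def free_act_add_left
          free_act_diff_left [of \<delta> 0, simplified]\<close>)
  qed (auto simp: free_alg_def free_act_mult)
qed

lemma free_act_ideal:
  assumes "a \<in> Idl\<^bsub>free_alg\<^esub> (relators \<delta>)"
  shows "free_act \<delta> a v = 0"
proof -
  have "Idl\<^bsub>free_alg\<^esub> (relators \<delta>) \<subseteq> {a. \<forall>v. free_act \<delta> a v = 0}"
    by (intro ring.genideal_minimal ring_free_alg ideal_annihilator)
      (auto simp: free_act_relators)
  then show ?thesis using assms by blast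
qed

lemma ideal_relators: "ideal (Idl\<^bsub>free_alg\<^esub> (relators \<delta>)) free_alg"
  by (intro ring.genideal_ideal ring_free_alg) (simp add: free_alg_def)

lemma ring_TL: "ring (TL \<delta>)"
  unfolding TL_def by (rule ideal.quotient_is_ring [OF ideal_relators])

definition TL_class :: "complex \<Rightarrow> tl_free \<Rightarrow> tl_free set" where
  "TL_class \<delta> a = Idl\<^bsub>free_alg\<^esub> (relators \<delta>) +>\<^bsub>free_alg\<^esub> a"

lemma TL_class_hom: "TL_class \<delta> \<in> ring_hom free_alg (TL \<delta>)"
  unfolding TL_def TL_class_def [abs_def] by (rule ideal.rcos_ring_hom [OF ideal_relators])

lemma carrier_TL: "carrier (TL \<delta>) = range (TL_class \<delta>)"
  by (auto simp: TL_def TL_class_def FactRing_def A_RCOSETS_def' free_alg_def)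

lemma tl_act_class [simp]: "tl_act \<delta> (TL_class \<delta> a) v = free_act \<delta> a v"
  and tl_act_class_mem: "b \<in> TL_class \<delta> a \<Longrightarrow> free_act \<delta> b v = free_act \<delta> a v"
proof -
  have mem: "b \<in> TL_class \<delta> a \<longleftrightarrow> (\<exists>h \<in> Idl\<^bsub>free_alg\<^esub> (relators \<delta>). b = h + a)" for b
    by (auto simp: TL_class_def a_r_coset_def' free_alg_def)
  show *: "free_act \<delta> b v = free_act \<delta> a v" if "b \<in> TL_class \<delta> a" for b
    using that by (auto simp: mem free_act_add_left free_act_ideal)
  have "\<zero>\<^bsub>free_alg\<^esub> \<in> Idl\<^bsub>free_alg\<^esub> (relators \<delta>)"
    using ideal_relators by (simp add: ideal.axioms additive_subgroup.zero_closed)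
  then have "a \<in> TL_class \<delta> a"
    unfolding mem by (intro bexI [of _ 0]) (simp_all add: free_alg_def)
  then show "tl_act \<delta> (TL_class \<delta> a) v = free_act \<delta> a v"
    unfolding tl_act_def by (intro * someI)
qed

lemma tl_act_eq: "A \<in> carrier (TL \<delta>) \<Longrightarrow> a \<in> A \<Longrightarrow> tl_act \<delta> A v = free_act \<delta> a v"
  by (auto simp: carrier_TL tl_act_class_mem)

lemma tl_act_linear: "A \<in> carrier (TL \<delta>) \<Longrightarrow> Vector_Spaces.linear cscale cscale (tl_act \<delta> A)"
  by (auto simp: carrier_TL free_act_add free_act_cscale intro!: Vector_Spaces.linear.intro
      module_hom.intro module_hom_axioms.intro cvec.vector_space_axioms cvec.module_axioms)

lemma tl_act_hom:
  assumes "A \<in> carrier (TL \<delta>)" "B \<in> carrier (TL \<delta>)"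
  shows "tl_act \<delta> (A \<otimes>\<^bsub>TL \<delta>\<^esub> B) v = tl_act \<delta> A (tl_act \<delta> B v)"
    and "tl_act \<delta> (A \<oplus>\<^bsub>TL \<delta>\<^esub> B) v = tl_act \<delta> A v + tl_act \<delta> B v"
    and "tl_act \<delta> \<one>\<^bsub>TL \<delta>\<^esub> v = v"
    and "tl_act \<delta> (TL_class \<delta> (Poly_Mapping.single 0 c)) v = cscale c v"
proof -
  obtain a b where "A = TL_class \<delta> a" "B = TL_class \<delta> b"
    using assms by (auto simp: carrier_TL)
  moreover have "TL_class \<delta> a \<otimes>\<^bsub>TL \<delta>\<^esub> TL_class \<delta> b = TL_class \<delta> (a * b)"
    "TL_class \<delta> a \<oplus>\<^bsub>TL \<delta>\<^esub> TL_class \<delta> b = TL_class \<delta> (a + b)"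
    "\<one>\<^bsub>TL \<delta>\<^esub> = TL_class \<delta> 1"
    using ring_hom_mult [OF TL_class_hom, of a b] ring_hom_add [OF TL_class_hom, of a b]
      ring_hom_one [OF TL_class_hom] by (simp_all add: free_alg_def)
  ultimately show "tl_act \<delta> (A \<otimes>\<^bsub>TL \<delta>\<^esub> B) v = tl_act \<delta> A (tl_act \<delta> B v)"
    "tl_act \<delta> (A \<oplus>\<^bsub>TL \<delta>\<^esub> B) v = tl_act \<delta> A v + tl_act \<delta> B v"
    "tl_act \<delta> \<one>\<^bsub>TL \<delta>\<^esub> v = v"
    by (simp_all add: free_act_mult free_act_add_left)
  show "tl_act \<delta> (TL_class \<delta> (Poly_Mapping.single 0 c)) v = cscale c v"
    by (simp add: free_act_single)
qed

lemma subrep_iff: "subrep \<delta> U \<longleftrightarrow> cvec.subspace U \<and> (\<forall>i. \<forall>v \<in> U. e_op \<delta> i v \<in> U)"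
proof -
  have "free_act \<delta> a v \<in> U"
    if U: "cvec.subspace U" "\<And>i v. v \<in> U \<Longrightarrow> e_op \<delta> i v \<in> U" and v: "v \<in> U" for a v
  proof -
    have "foldr (e_op \<delta>) us v \<in> U" for us
      using U(2) v by (induction us) auto
    then show ?thesis
      unfolding free_act_def lin_ext_def word_act_def
      by (intro cvec.subspace_sum cvec.subspace_scale U(1))
  qed
  moreover have "e_op \<delta> i v \<in> U" if "\<forall>a. \<forall>v\<in>U. free_act \<delta> a v \<in> U" "v \<in> U" for i v
    using that by (metis free_act_gen)
  ultimately show ?thesis
    by (auto simp: subrep_def carrier_TL)
qed

lemma subrep_generated_rep: "subrep \<delta> (generated_rep \<delta> w)"
  by (auto simp: subrep_def generated_rep_def intro!: cvec.subspace_Inter)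

end

theory Submission
  imports Defs "HOL-Computational_Algebra.Polynomial" "HOL-Library.Infinite_Set"
begin

text \<open>
  Call \<open>N\<close> a cut of \<open>w\<close> if no cup joins a point below \<open>N\<close> to a point that is not. A vector of
  \<open>\<X>(w)\<close> involves finitely many link states, all of which agree with \<open>w\<close> beyond every sufficiently
  large cut. So \<open>\<X>(w)\<close> is the increasing union, over the cuts \<open>N\<close>, of the spans of the sets
  \<open>states w N 0\<close>. Each of these spans is a standard module of a finite Temperley--Lieb algebra on
  \<open>N\<close> points, with \<open>\<sigma>\<close> strings, where \<open>\<sigma>\<close> is the number of strings of \<open>w\<close> below \<open>N\<close>. The theorem
  follows from facts about these finite windows.

  Irreducibility. Let \<open>x \<noteq> 0\<close> be a vector of a window. If \<open>e\<^sub>i x \<noteq> 0\<close> for some generator of the window,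
  then all states in \<open>e\<^sub>i x\<close> share the cup \<open>(i, i + 1)\<close>; it can be moved to the left end of the window
  without loss (\<open>move_cup_left\<close>), and the rest is a vector in a shorter window. If this never stops
  early, one arrives at a single link state, from which every other one of the window can be
  reached. What has to be excluded are singular vectors, that is, vectors annihilated by all generators of
  a window (\<open>no_singular_vector\<close>). For this, expand a link state in a spin chain: a string is an up
  spin, a cup is \<open>(up, down) + q (down, up)\<close>. This is an injective intertwiner, and it forces the
  expansion of a singular vector to be proportional to \<open>\<Sum>D. (-q)\<^bsup>\<Sum>D\<^esup> D\<close>, the sum over all sets \<open>D\<close> of
  down spins. The same weights define linear functionals that vanish on every link state,
  since it has a cup joining neighbours. Evaluating such a functional on a singular vector with \<open>j\<close>
  cups gives the factor \<open>e\<^sub>m(1, x, \<dots>, x\<^bsup>\<sigma>+j+m-1\<^esup>)\<close> with \<open>x = q\<^sup>2\<close>, for any \<open>1 \<le> m \<le> j\<close>; up to a power of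
  \<open>x\<close> it is a Gaussian binomial coefficient. For generic \<open>q\<close> the factor with \<open>m = 1\<close> is nonzero. If \<open>l\<close> divides
  \<open>\<sigma> + 1\<close>, then \<open>m = 1\<close> or \<open>m = l\<close> works; the same is true for \<open>\<sigma> = 0\<close> and \<open>l = 2\<close>, except for
  \<open>j = 1\<close>, when only one link state is left anyway. For infinitely many strings there are arbitrarily
  large cuts for which \<open>l\<close> divides \<open>\<sigma> + 1\<close>.

  Indecomposability. Some element of the algebra, \<open>fold_std\<close>, maps a whole window into the line
  spanned by one link state \<open>s\<close>, fixes \<open>s\<close>, and \<open>s\<close> generates \<open>\<X>(w)\<close>. If \<open>\<X>(w) = U \<oplus> V\<close>, then
  applying this element to the decomposition of \<open>s\<close> shows that \<open>s\<close> lies in \<open>U\<close> or in \<open>V\<close>.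

  Reducibility. Let \<open>w\<close> have finitely many strings, \<open>\<sigma>\<close> say, where \<open>l\<close> does not divide \<open>\<sigma> + 1\<close> and not
  both \<open>\<sigma> = 0\<close> and \<open>l = 2\<close>. Let \<open>n\<close> be determined by \<open>0 < n < l\<close> and \<open>l\<close> dividing \<open>\<sigma> + n + 1\<close>. Then there
  is a singular vector with \<open>\<sigma>\<close> strings and \<open>n\<close> cups (\<open>singular_vector_exists\<close>): the vector
  \<open>\<Sum>D. (-q)\<^bsup>\<Sum>D\<^esup> D\<close> of the spin chain, summed over the sets with \<open>n\<close> elements, is annihilated by the
  raising operator of quantum \<open>sl\<^sub>2\<close>, and for \<open>n < l\<close> the vectors with \<open>n\<close> down spins in the kernel of
  that operator are expansions of combinations of link states. Grafting this vector onto the strings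
  of link states with \<open>\<sigma> + 2 n\<close> strings is an intertwiner into \<open>\<X>(w)\<close> (\<open>graft_map_e_op\<close>). Its image is
  proper, as \<open>fold_std\<close> closes so many cups that it annihilates all states with the larger number of
  strings.
\<close>

section \<open>Windows of a link state\<close>

definition span_on :: "'a set \<Rightarrow> ('a \<Rightarrow>\<^sub>0 complex) set" where
  "span_on V = {x. Poly_Mapping.keys x \<subseteq> V}"

lemma subspace_span_on: "cvec.subspace (span_on V)"
proof (rule cvec.subspaceI)
  fix x y :: "'a \<Rightarrow>\<^sub>0 complex" and c assume "x \<in> span_on V" "y \<in> span_on V"
  then show "x + y \<in> span_on V" "cscale c x \<in> span_on V"
    using Poly_Mapping.keys_add[of x y] by (auto simp: span_on_def in_keys_iff)
qed (simp add: span_on_def)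

lemma span_on_single: "v \<in> V \<Longrightarrow> Poly_Mapping.single v c \<in> span_on V"
  by (simp add: span_on_def)

lemma span_on_mono: "V \<subseteq> V' \<Longrightarrow> span_on V \<subseteq> span_on V'"
  by (auto simp: span_on_def)

lemma span_on_empty: "span_on {} = {0}"
  by (auto simp: span_on_def)

lemma span_on_singleton:
  assumes "x \<in> span_on {v}"
  shows "x = Poly_Mapping.single v (Poly_Mapping.lookup x v)"
  using assms by (intro poly_mapping_eqI) (auto simp: span_on_def lookup_single when_def in_keys_iff)

lemma lin_ext_in_subspace:
  assumes "cvec.subspace U" "x \<in> span_on V" "\<And>v. v \<in> V \<Longrightarrow> f v \<in> U"
  shows "lin_ext f x \<in> U"
  unfolding lin_ext_def using assms
  by (intro cvec.subspace_sum cvec.subspace_scale) (auto simp: span_on_def)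

lemma lin_ext_cong:
  assumes "x \<in> span_on V" "\<And>v. v \<in> V \<Longrightarrow> f v = g v"
  shows "lin_ext f x = lin_ext g x"
  unfolding lin_ext_def using assms by (intro sum.cong) (auto simp: span_on_def)

lemma lin_ext_id: "lin_ext (\<lambda>v. Poly_Mapping.single v 1) x = x"
  unfolding lin_ext_def by (rule cvec_expand[symmetric])

lemma lin_ext_lin_ext: "lin_ext f (lin_ext g x) = lin_ext (\<lambda>v. lin_ext f (g v)) x"
  by (simp add: lin_ext_def[of _ x] lin_ext_def[of g x] lin_ext_sum lin_ext_cscale)

lemma subrep_subspace: "subrep \<delta> U \<Longrightarrow> cvec.subspace U"
  and subrep_e_op: "subrep \<delta> U \<Longrightarrow> v \<in> U \<Longrightarrow> e_op \<delta> i v \<in> U"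
  by (auto simp: subrep_iff)

definition is_cut :: "nat \<Rightarrow> link_state \<Rightarrow> bool" where
  "is_cut N w \<longleftrightarrow> (\<forall>a<N. partner w a < N)"

definition strings_below :: "nat \<Rightarrow> link_state \<Rightarrow> nat" where
  "strings_below N w = card {a. a < N \<and> partner w a = a}"

text \<open>
  The states of a window: they agree with \<open>r\<close> from \<open>N\<close> on, have as many strings below \<open>N\<close> as \<open>r\<close>, and
  their first \<open>2 * k\<close> points carry the adjacent cups \<open>(0, 1), (2, 3), \<dots>\<close>. So \<open>k\<close> counts the cups that
  have been split off, and \<open>{2 * k..<N}\<close> is the part of the window that is still free.
\<close>

definition states :: "link_state \<Rightarrow> nat \<Rightarrow> nat \<Rightarrow> link_state set" where
  "states r N k = {v. is_cut N v \<and> (\<forall>a\<ge>N. partner v a = partner r a) \<and>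
     strings_below N v = strings_below N r \<and> (\<forall>j<k. partner v (2 * j) = Suc (2 * j))}"

lemma cut_ge: "is_cut N w \<Longrightarrow> N \<le> a \<Longrightarrow> N \<le> partner w a"
  by (metis is_cut_def not_le partner_partner)

lemma states_mono: "k \<le> k' \<Longrightarrow> states r N k' \<subseteq> states r N k"
  by (auto simp: states_def)

lemma states_self: "is_cut N r \<Longrightarrow> r \<in> states r N 0"
  by (simp add: states_def)

lemma strings_below_rejoin:
  assumes c: "is_cut N v" and i: "Suc i < N"
    and n: "\<not> both_strings i v" "partner v i \<noteq> Suc i"
  shows "strings_below N (rejoin i v) = strings_below N v"
proof -
  let ?p = "partner v"
  let ?S = "{a. a < N \<and> ?p a = a}"
  let ?S' = "{a. a < N \<and> rj i (Suc i) ?p a = a}"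
  have e: "?p x = z \<longleftrightarrow> ?p z = x" for x z using partner_partner by metis
  have lt: "a < N \<Longrightarrow> ?p a < N" for a using c by (simp add: is_cut_def)
  have fin: "finite ?S" by simp
  have one: "card (insert b (?S - {j})) = card ?S" if "j \<in> ?S" "b \<notin> ?S" for j b
  proof -
    have "card (insert b (?S - {j})) = Suc (card (?S - {j}))"
      using that(2) fin by (intro card_insert_disjoint) auto
    also have "\<dots> = card ?S" using that(1) fin by (intro card_Suc_Diff1) auto
    finally show ?thesis .
  qed
  consider "?p i = i" | "?p i \<noteq> i" "?p (Suc i) = Suc i" | "?p i \<noteq> i" "?p (Suc i) \<noteq> Suc i" by blast
  then have "card ?S' = card ?S"
  proof cases
    case 1
    have ps: "?p (Suc i) \<noteq> Suc i" "?p (Suc i) \<noteq> i" using 1 n e[of "Suc i" i] by (auto simp: both_strings_def)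
    have "?S' = insert (?p (Suc i)) (?S - {i})"
    proof (rule Set.set_eqI)
      fix a show "a \<in> ?S' \<longleftrightarrow> a \<in> insert (?p (Suc i)) (?S - {i})"
        using 1 ps lt[of "Suc i"] i e[of a i] e[of a "Suc i"] by (auto simp: rj_def)
    qed
    then show ?thesis using one[of i "?p (Suc i)"] 1 ps i by simp
  next
    case 2
    have ps: "?p i \<noteq> Suc i" using n by simp
    have "?S' = insert (?p i) (?S - {Suc i})"
    proof (rule Set.set_eqI)
      fix a show "a \<in> ?S' \<longleftrightarrow> a \<in> insert (?p i) (?S - {Suc i})"
        using 2 ps lt[of i] i e[of a i] e[of a "Suc i"] by (auto simp: rj_def)
    qed
    then show ?thesis using one[of "Suc i" "?p i"] 2 ps i by simp
  next
    case 3
    have "?S' = ?S"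
    proof (rule Set.set_eqI)
      fix a
      have "?p i \<noteq> ?p (Suc i)" by (metis n_not_Suc_n partner_partner)
      then show "a \<in> ?S' \<longleftrightarrow> a \<in> ?S"
        using 3 n(2) e[of a i] e[of a "Suc i"] by (auto simp: rj_def)
    qed
    then show ?thesis by simp
  qed
  then show ?thesis by (simp add: strings_below_def partner_rejoin[OF n])
qed

lemma rejoin_states:
  assumes v: "v \<in> states r N k" and i: "2 * k \<le> i" "Suc i < N"
    and n: "\<not> both_strings i v" "partner v i \<noteq> Suc i"
  shows "rejoin i v \<in> states r N k"
proof -
  let ?p = "partner v"
  note pr = partner_rejoin[OF n]
  have c: "is_cut N v" and t: "\<And>a. N \<le> a \<Longrightarrow> ?p a = partner r a"
    and s: "strings_below N v = strings_below N r"
    and k: "\<And>j. j < k \<Longrightarrow> ?p (2 * j) = Suc (2 * j)"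
    using v by (auto simp: states_def)
  have lt: "a < N \<Longrightarrow> ?p a < N" for a using c by (simp add: is_cut_def)
  have "is_cut N (rejoin i v)"
    using i lt by (auto simp: is_cut_def pr rj_def)
  moreover have "partner (rejoin i v) a = partner r a" if "N \<le> a" for a
    using that i t[OF that] cut_ge[OF c that] by (auto simp: pr rj_def)
  moreover have "partner (rejoin i v) (2 * j) = Suc (2 * j)" if "j < k" for j
    using k[OF that] i that by (auto simp: pr rj_def)
  ultimately show ?thesis
    using strings_below_rejoin[OF c i(2) n] s by (simp add: states_def)
qed

lemma e_basis_states:
  assumes v: "v \<in> states r N k" and i: "2 * k \<le> i" "Suc i < N"
  shows "e_basis \<delta> i v \<in> span_on {u \<in> states r N k. partner u i = Suc i}"
proof -
  consider "both_strings i v" | "partner v i = Suc i" | "\<not> both_strings i v" "partner v i \<noteq> Suc i"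
    by blast
  then show ?thesis
    by cases (use v rejoin_states[OF v i] in \<open>simp_all add: e_basis_both_strings e_basis_cup
      e_basis_rejoin partner_rejoin_self span_on_def\<close>)
qed

text \<open>
  The generators inside the free part of a window act on the span of its states, and every state in
  the result contains the cup that the generator draws.
\<close>

lemma e_op_states:
  assumes x: "x \<in> span_on (states r N k)" and i: "2 * k \<le> i" "Suc i < N"
  shows "e_op \<delta> i x \<in> span_on {u \<in> states r N k. partner u i = Suc i}"
  unfolding e_op_def
  by (rule lin_ext_in_subspace[OF subspace_span_on x e_basis_states[OF _ i]])

lemma e_op_states':
  assumes x: "x \<in> span_on (states r N k)" and i: "2 * k \<le> i" "Suc i < N"
  shows "e_op \<delta> i x \<in> span_on (states r N k)"
  using e_op_states[OF assms] span_on_mono[of "{u \<in> states r N k. partner u i = Suc i}"] by blast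

section \<open>Moving a cup to the left\<close>

text \<open>
  The relation \<open>e\<^sub>i e\<^sub>j e\<^sub>i = e\<^sub>i\<close> for neighbours \<open>i\<close>, \<open>j\<close>: on states that already contain the cup
  \<open>(i, i + 1)\<close>, the operator \<open>e\<^sub>j\<close> only shifts that cup, and \<open>e\<^sub>i\<close> shifts it back.
\<close>

lemma e_op_back:
  assumes x: "x \<in> span_on {v. partner v i = Suc i}" and j: "j = Suc i \<or> i = Suc j"
  shows "e_op \<delta> i (e_op \<delta> j x) = x"
proof -
  have "e_op \<delta> i (e_op \<delta> j x) = lin_ext (\<lambda>v. e_op \<delta> i (e_basis \<delta> j v)) x"
    by (simp add: e_op_def lin_ext_lin_ext)
  also have "\<dots> = lin_ext (\<lambda>v. Poly_Mapping.single v 1) x"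
    by (rule lin_ext_cong[OF x]) (use e_op_back_basis j in auto)
  finally show ?thesis by (simp add: lin_ext_id)
qed

text \<open>
  Invariance under the generators of one window only. The moves below stay inside the window, and
  the proof of indecomposability needs them for subspaces that are not subrepresentations.
\<close>

definition stable :: "complex \<Rightarrow> nat \<Rightarrow> (link_state \<Rightarrow>\<^sub>0 complex) set \<Rightarrow> bool" where
  "stable \<delta> N U \<longleftrightarrow> cvec.subspace U \<and> (\<forall>i x. Suc i < N \<longrightarrow> x \<in> U \<longrightarrow> e_op \<delta> i x \<in> U)"

lemma subrep_stable: "subrep \<delta> U \<Longrightarrow> stable \<delta> N U"
  by (simp add: stable_def subrep_iff)

lemma states_Suc: "{v \<in> states r N k. partner v (2 * k) = Suc (2 * k)} = states r N (Suc k)"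
  by (auto simp: states_def less_Suc_eq)

text \<open>
  Repeated use of \<open>e_op_back\<close>: the vector with the cup at \<open>i\<close> and the one with the cup at \<open>2 * k\<close> generate
  each other. A basis vector stays a basis vector, because the moves never meet a loop or two strings.
\<close>

lemma move_cup_left:
  assumes "x \<in> span_on {v \<in> states r N k. partner v i = Suc i}" "2 * k \<le> i" "Suc i < N"
  shows "\<exists>y \<in> span_on (states r N (Suc k)). (\<forall>U. stable \<delta> N U \<longrightarrow> x \<in> U \<longleftrightarrow> y \<in> U) \<and>
    (\<forall>v. x = Poly_Mapping.single v 1 \<longrightarrow> (\<exists>v'. y = Poly_Mapping.single v' 1))"
  using assms(2,1,3)
proof (induction i arbitrary: x rule: dec_induct)
  case base
  then show ?case unfolding states_Suc by blast
next
  case (step i)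
  let ?y = "e_op \<delta> i x"
  have x': "x \<in> span_on (states r N k)" "x \<in> span_on {v. partner v (Suc i) = Suc (Suc i)}"
    using step.prems(1) by (auto simp: span_on_def)
  have y: "?y \<in> span_on {v \<in> states r N k. partner v i = Suc i}"
    using step.prems step.hyps by (intro e_op_states x') auto
  have ret: "e_op \<delta> (Suc i) ?y = x" using e_op_back[OF x'(2), of i] by simp
  have "x \<in> U \<longleftrightarrow> ?y \<in> U" if U: "stable \<delta> N U" for U
  proof -
    have "e_op \<delta> i z \<in> U" "e_op \<delta> (Suc i) z \<in> U" if "z \<in> U" for z
      using U that step.prems(2) by (auto simp: stable_def)
    from this(1)[of x] this(2)[of ?y] show ?thesis unfolding ret by blast
  qed
  moreover have "\<exists>v'. ?y = Poly_Mapping.single v' 1" if v: "x = Poly_Mapping.single v 1" for v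
  proof -
    have "partner v (Suc i) = Suc (Suc i)" using x'(2) v by (simp add: span_on_def)
    moreover have "partner v i \<noteq> Suc i"
    proof
      assume "partner v i = Suc i"
      then have "partner v (Suc i) = i" by (metis partner_partner)
      then show False using \<open>partner v (Suc i) = Suc (Suc i)\<close> by simp
    qed
    ultimately have "\<not> both_strings i v" "partner v i \<noteq> Suc i"
      by (simp_all add: both_strings_def)
    then show ?thesis using v by (auto simp: e_basis_rejoin)
  qed
  moreover obtain z where "z \<in> span_on (states r N (Suc k))"
    "\<forall>U. stable \<delta> N U \<longrightarrow> ?y \<in> U \<longleftrightarrow> z \<in> U"
    "\<forall>v. ?y = Poly_Mapping.single v 1 \<longrightarrow> (\<exists>v'. z = Poly_Mapping.single v' 1)"
    using step.IH[OF y] step.prems by auto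
  ultimately show ?case by (intro bexI[of _ z]) auto
qed

lemma stable_zero: "stable \<delta> N {0}"
  by (auto simp: stable_def)

section \<open>Spin amplitudes\<close>

definition lin_val :: "('a \<Rightarrow> complex) \<Rightarrow> ('a \<Rightarrow>\<^sub>0 complex) \<Rightarrow> complex" where
  "lin_val g x = (\<Sum>v \<in> Poly_Mapping.keys x. Poly_Mapping.lookup x v * g v)"

lemma lin_val_superset:
  assumes "finite S" "Poly_Mapping.keys x \<subseteq> S"
  shows "lin_val g x = (\<Sum>v \<in> S. Poly_Mapping.lookup x v * g v)"
  unfolding lin_val_def using assms
  by (intro sum.mono_neutral_left) (auto simp: in_keys_iff)

lemma lin_val_add: "lin_val g (x + y) = lin_val g x + lin_val g y"
proof -
  let ?S = "Poly_Mapping.keys x \<union> Poly_Mapping.keys y"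
  have "Poly_Mapping.keys (x + y) \<subseteq> ?S"
    by (rule Poly_Mapping.keys_add)
  then show ?thesis
    by (simp add: lin_val_superset [of ?S] lookup_add distrib_right sum.distrib)
qed

lemma lin_val_cscale: "lin_val g (cscale c x) = c * lin_val g x"
proof -
  have "Poly_Mapping.keys (cscale c x) \<subseteq> Poly_Mapping.keys x"
    by (auto simp: in_keys_iff)
  then show ?thesis
    by (simp add: lin_val_superset [of "Poly_Mapping.keys x"] sum_distrib_left mult.assoc)
qed

lemma lin_val_zero [simp]: "lin_val g 0 = 0"
  by (simp add: lin_val_def)

lemma lin_val_single [simp]: "lin_val g (Poly_Mapping.single v c) = c * g v"
  by (simp add: lin_val_def)

lemma lin_val_lin_ext: "lin_val g (lin_ext f x) = lin_val (\<lambda>v. lin_val g (f v)) x"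
proof -
  have "lin_val g (\<Sum>v\<in>S. h v) = (\<Sum>v\<in>S. lin_val g (h v))" for S :: "'b set" and h
    by (induction S rule: infinite_finite_induct) (simp_all add: lin_val_add)
  then show ?thesis
    by (simp add: lin_ext_def lin_val_def[of _ x] lin_val_cscale)
qed

lemma lin_val_cong:
  assumes "x \<in> span_on V" "\<And>v. v \<in> V \<Longrightarrow> f v = g v"
  shows "lin_val f x = lin_val g x"
  unfolding lin_val_def using assms by (intro sum.cong) (auto simp: span_on_def)

lemma lin_val_fun_lin: "lin_val (\<lambda>v. c * f v + g v) x = c * lin_val f x + lin_val g x"
  by (simp add: lin_val_def sum_distrib_left sum.distrib algebra_simps)

lemma lin_val_fun_sum: "lin_val (\<lambda>v. \<Sum>i\<in>I. c i * f i v) x = (\<Sum>i\<in>I. c i * lin_val (f i) x)"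
proof -
  have "lin_val (\<lambda>v. \<Sum>i\<in>I. c i * f i v) x
      = (\<Sum>v \<in> Poly_Mapping.keys x. \<Sum>i\<in>I. c i * (Poly_Mapping.lookup x v * f i v))"
    by (simp add: lin_val_def sum_distrib_left mult.left_commute)
  also have "\<dots> = (\<Sum>i\<in>I. c i * lin_val (f i) x)"
    by (subst sum.swap) (simp add: lin_val_def sum_distrib_left)
  finally show ?thesis .
qed

text \<open>
  The factor at the point \<open>a\<close> of the coefficient of a spin configuration, \<open>D\<close> being the set of down spins.
  A string is up, a cup has exactly one down end, and it contributes \<open>q\<close> if that is its left end.
\<close>

definition amp_at :: "complex \<Rightarrow> link_state \<Rightarrow> nat set \<Rightarrow> nat \<Rightarrow> complex" where
  "amp_at q w D a =
     (if partner w a = a then (if a \<in> D then 0 else 1)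
      else if a \<in> D \<longleftrightarrow> partner w a \<in> D then 0
      else if a \<in> D \<and> a < partner w a then q else 1)"

definition amp :: "complex \<Rightarrow> nat \<Rightarrow> nat \<Rightarrow> nat set \<Rightarrow> link_state \<Rightarrow> complex" where
  "amp q A N D w = (\<Prod>a = A..<N. amp_at q w D a)"

lemma partner_window: "is_cut A w \<Longrightarrow> is_cut N w \<Longrightarrow> a \<in> {A..<N} \<Longrightarrow> partner w a \<in> {A..<N}"
  using cut_ge[of A w a] by (auto simp: is_cut_def)

lemma amp_split:
  assumes "T \<subseteq> {A..<N}" "finite T"
  shows "amp q A N D w = prod (amp_at q w D) T * prod (amp_at q w D) ({A..<N} - T)"
  unfolding amp_def using prod.subset_diff[OF assms(1), of "amp_at q w D"] by (simp add: mult.commute)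

lemma amp_zeroI: "a \<in> {A..<N} \<Longrightarrow> amp_at q w D a = 0 \<Longrightarrow> amp q A N D w = 0"
  unfolding amp_def by (rule prod_zero) auto

lemma amp_at_rejoin:
  assumes n: "\<not> both_strings i w" "partner w i \<noteq> Suc i"
    and a: "a \<notin> {i, Suc i, partner w i, partner w (Suc i)}"
  shows "amp_at q (rejoin i w) D a = amp_at q w D a"
proof -
  have "partner w a \<noteq> i" "partner w a \<noteq> Suc i" using a by (metis insertCI partner_partner)+
  then have "partner (rejoin i w) a = partner w a" using a by (simp add: partner_rejoin[OF n] rj_def)
  then show ?thesis by (simp add: amp_at_def)
qed

lemma amp_at_insert:
  assumes "a \<notin> {b, partner w b}"
  shows "amp_at q w (insert b D) a = amp_at q w D a"
proof -
  have "a \<noteq> b" "partner w a \<noteq> b" using assms by auto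
  then show ?thesis by (simp add: amp_at_def)
qed

text \<open>
  The contribution of the four points at which a state and its image under \<open>e\<^sub>i\<close> differ. The three cases
  are a string at \<open>i\<close>, a string at \<open>i + 1\<close>, and two cups; noncrossingness decides which ends are left ends.
\<close>

lemma amp_cap_local:
  assumes n: "\<not> both_strings i w" "partner w i \<noteq> Suc i" and D: "i \<notin> D" "Suc i \<notin> D" and q: "q \<noteq> 0"
    and T: "T = {i, Suc i, partner w i, partner w (Suc i)}"
  shows "prod (amp_at q (rejoin i w) (insert (Suc i) D)) T
    = inverse q * prod (amp_at q w (insert (Suc i) D)) T + prod (amp_at q w (insert i D)) T"
proof (cases rule: reconnect_cases[OF partner_partner n(1)[unfolded both_strings_def] n(2)])
  case (1 b)
  have "\<not> (b < i \<and> i < partner w b)" using is_link_stateD(3)[OF partner_link_state[of w], of b i] 1 by auto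
  then have b: "Suc i < b" using 1 by auto
  have "T = {i, Suc i, b}" using 1 T by auto
  moreover have "prod f {i, Suc i, b} = f i * f (Suc i) * f b" for f :: "nat \<Rightarrow> complex"
    using b by simp
  ultimately show ?thesis
    using 1(1-5) b D q by (cases "b \<in> D") (simp_all add: amp_at_def partner_rejoin[OF n] rj_def)
next
  case (2 b)
  have "\<not> (i < Suc i \<and> Suc i < partner w i)"
    using is_link_stateD(3)[OF partner_link_state[of w], of i "Suc i"] 2 by auto
  then have b: "b < i" using 2 by auto
  have "T = {i, Suc i, b}" using 2 T by auto
  moreover have "prod f {i, Suc i, b} = f i * f (Suc i) * f b" for f :: "nat \<Rightarrow> complex"
    using b by simp
  ultimately show ?thesis
    using 2(1-5) b D q by (cases "b \<in> D") (simp_all add: amp_at_def partner_rejoin[OF n] rj_def)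
next
  case (3 a b)
  note N = is_link_stateD(2)[OF partner_link_state[of w]]
  have "\<not> (a < b \<and> b < i)" using N[of a b] 3(2,4) by auto
  moreover have "\<not> (b < i \<and> i < a)" using N[of b i] 3(1,4) by auto
  moreover have "\<not> (i < a \<and> a < b)" using N[of i "Suc i"] 3(1,3,6) by auto
  ultimately have o: "a < i \<and> Suc i < b \<or> b < a \<and> a < i \<or> Suc i < b \<and> b < a"
    using 3(5-9) by arith
  have "T = {i, Suc i, a, b}" using 3 T by auto
  moreover have "prod f {i, Suc i, a, b} = f i * f (Suc i) * f a * f b" for f :: "nat \<Rightarrow> complex"
    using 3(5-9) by simp
  moreover have "partner (rejoin i w) i = Suc i" "partner (rejoin i w) (Suc i) = i"
    "partner (rejoin i w) a = b" "partner (rejoin i w) b = a"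
    using 3(1-9) by (simp_all add: partner_rejoin[OF n] rj_def)
  moreover have "a \<noteq> i" "a \<noteq> Suc i" "b \<noteq> i" "b \<noteq> Suc i" "a \<noteq> b" using 3(5-9) by simp_all
  ultimately show ?thesis
    using o 3(1-4) D q by (elim disjE conjE; simp add: amp_at_def)
qed

text \<open>
  The expansion is an intertwiner: in the spin chain, \<open>e\<^sub>i\<close> contracts the spins at \<open>i\<close> and \<open>i + 1\<close> with
  weights \<open>1\<close> for (down, up) and \<open>1 / q\<close> for (up, down), and then inserts a cup. It is enough to read off
  the coefficients in which the new cup has its right end down.
\<close>

lemma amp_cap_basis:
  assumes c: "is_cut A w" "is_cut N w" and i: "A \<le> i" "Suc i < N" and D: "i \<notin> D" "Suc i \<notin> D"
    and q: "q \<noteq> 0" "\<delta> = q + inverse q"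
  shows "lin_val (amp q A N (insert (Suc i) D)) (e_basis \<delta> i w)
    = inverse q * amp q A N (insert (Suc i) D) w + amp q A N (insert i D) w"
proof -
  have iw: "i \<in> {A..<N}" "Suc i \<in> {A..<N}" using i by auto
  define T where "T = {i, Suc i, partner w i, partner w (Suc i)}"
  have T: "T \<subseteq> {A..<N}" "finite T" using iw partner_window[OF c] unfolding T_def by blast+
  note A = amp_split[OF T, of q]
  define R where "R = prod (amp_at q w D) ({A..<N} - T)"
  have R: "prod (amp_at q w (insert i D)) ({A..<N} - T) = R"
    "prod (amp_at q w (insert (Suc i) D)) ({A..<N} - T) = R"
    unfolding R_def T_def by (intro prod.cong refl amp_at_insert; blast)+
  show ?thesis
  proof (cases "both_strings i w")
    case True
    then have "amp_at q w (insert (Suc i) D) (Suc i) = 0" "amp_at q w (insert i D) i = 0"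
      by (simp_all add: amp_at_def both_strings_def)
    then have "amp q A N (insert (Suc i) D) w = 0" "amp q A N (insert i D) w = 0"
      using amp_zeroI iw by blast+
    then show ?thesis by (simp only: e_basis_both_strings[OF True] lin_val_zero mult_zero_right add_0)
  next
    case nb: False
    show ?thesis
    proof (cases "partner w i = Suc i")
      case True
      then have p: "partner w (Suc i) = i" by (metis partner_partner)
      have T2: "T = {i, Suc i}" using True p T_def by auto
      have P: "prod f {i, Suc i} = f i * f (Suc i)" for f :: "nat \<Rightarrow> complex" by simp
      have "amp_at q w (insert (Suc i) D) i = 1" "amp_at q w (insert (Suc i) D) (Suc i) = 1"
        "amp_at q w (insert i D) i = q" "amp_at q w (insert i D) (Suc i) = 1"
        using True p D by (simp_all add: amp_at_def)
      then have "prod (amp_at q w (insert (Suc i) D)) T = 1" "prod (amp_at q w (insert i D)) T = q"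
        by (simp_all only: T2 P mult_1 mult_1_right)
      then show ?thesis
        by (simp only: e_basis_cup[OF True] lin_val_single A R q(2) distrib_right mult_1 add.commute)
    next
      case False
      have "prod (amp_at q (rejoin i w) (insert (Suc i) D)) ({A..<N} - T)
          = prod (amp_at q w (insert (Suc i) D)) ({A..<N} - T)"
        unfolding T_def by (intro prod.cong refl amp_at_rejoin nb False) blast
      then show ?thesis
        using amp_cap_local[OF nb False D q(1) T_def]
        by (simp only: e_basis_rejoin[OF nb False] lin_val_single A R mult_1 distrib_right mult.assoc)
    qed
  qed
qed

section \<open>Amplitudes determine a vector\<close>

definition closers :: "link_state \<Rightarrow> nat set" where
  "closers w = {a. partner w a < a}"

text \<open>
  A closing point is joined to the nearest point on its left that is still free. If \<open>v\<close> chose a point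
  further left than \<open>w\<close> does, the point chosen by \<open>w\<close> would lie under that cup of \<open>v\<close> and be closed earlier.
\<close>

lemma closers_inject_step:
  assumes "closers v = closers w" and a: "a \<in> closers v"
    and IH: "\<And>r. r < a \<Longrightarrow> r \<in> closers v \<Longrightarrow> partner v r = partner w r"
  shows "\<not> partner v a < partner w a"
proof
  assume lt: "partner v a < partner w a"
  let ?b = "partner w a"
  have b: "?b < a" using assms(1) a by (auto simp: closers_def)
  note N = is_link_stateD[OF partner_link_state[of v], of "partner v a" ?b]
  have vb: "partner v ?b < a" "partner v ?b \<noteq> ?b" using N(2,3) lt b by auto
  have "?b \<notin> closers v" using assms(1) b by (auto simp: closers_def)
  then have "?b < partner v ?b" using vb by (auto simp: closers_def)
  then have "partner v ?b \<in> closers v" by (simp add: closers_def)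
  then have "partner w (partner v ?b) = ?b" using IH[OF vb(1)] by simp
  then have "partner v ?b = a" by (metis partner_partner)
  then show False using vb by simp
qed

lemma closers_inject:
  assumes "closers v = closers w"
  shows "v = w"
proof -
  have *: "partner v a = partner w a" if "a \<in> closers v" for a
    using that
  proof (induction a rule: less_induct)
    case (less a)
    then show ?case
      using closers_inject_step[OF assms, of a] closers_inject_step[OF assms[symmetric], of a] assms
      by (metis linorder_neqE_nat)
  qed
  have **: "partner v x = partner w x" if "partner v x \<noteq> x" "closers v = closers w"
    "\<And>a. a \<in> closers v \<Longrightarrow> partner v a = partner w a" for x v w
  proof (cases "x \<in> closers v")
    case False
    then have "partner v x \<in> closers v" using that(1) by (auto simp: closers_def)
    then show ?thesis using that(3) by (metis partner_partner)
  qed (use that in auto)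
  show ?thesis
  proof (rule link_state_eqI)
    fix x
    show "partner v x = partner w x"
      using **[of v x w] **[of w x v] * assms by metis
  qed
qed

lemma amp_nonzeroD:
  assumes "amp q A N D w \<noteq> 0" "a \<in> {A..<N}"
  shows "a \<in> D \<longleftrightarrow> partner w a \<noteq> a \<and> partner w a \<notin> D"
proof -
  have "amp_at q w D a \<noteq> 0" using amp_zeroI assms by blast
  then show ?thesis by (auto simp: amp_at_def split: if_splits)
qed

lemma partner_eq_iff: "partner w a = partner w b \<longleftrightarrow> a = b"
  by (metis partner_partner)

text \<open>
  If a configuration occurs in the expansion of \<open>w\<close>, moving every down spin to the right end of its cup
  gives exactly the right ends of \<open>w\<close>. Hence \<open>closers w\<close> is the configuration of largest sum in \<open>w\<close>,
  which makes the expansion triangular.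
\<close>

lemma amp_bij:
  assumes c: "is_cut A w" "is_cut N w" and D: "D \<subseteq> {A..<N}" and nz: "amp q A N D w \<noteq> 0"
  shows "bij_betw (\<lambda>a. max a (partner w a)) D (closers w \<inter> {A..<N})"
proof (rule bij_betwI')
  note z = amp_nonzeroD[OF nz] and pw = partner_window[OF c]
  fix a b assume ab: "a \<in> D" "b \<in> D"
  have "partner w a \<notin> D" "partner w b \<notin> D" using z ab D by blast+
  then show "(max a (partner w a) = max b (partner w b)) = (a = b)"
    using ab by (auto simp: max_def partner_eq_iff split: if_splits)
next
  note z = amp_nonzeroD[OF nz] and pw = partner_window[OF c]
  fix a assume a: "a \<in> D"
  then have "partner w a \<noteq> a" "a \<in> {A..<N}" using z D by blast+
  then show "max a (partner w a) \<in> closers w \<inter> {A..<N}"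
    using pw[of a] by (auto simp: max_def closers_def)
next
  note z = amp_nonzeroD[OF nz] and pw = partner_window[OF c]
  fix b assume b: "b \<in> closers w \<inter> {A..<N}"
  show "\<exists>a\<in>D. b = max a (partner w a)"
  proof (cases "b \<in> D")
    case True
    then show ?thesis using b by (intro bexI[of _ b]) (auto simp: closers_def max_def)
  next
    case False
    then have "partner w b \<in> D" using z[of b] b by (auto simp: closers_def)
    then show ?thesis using b by (intro bexI[of _ "partner w b"]) (auto simp: closers_def max_def)
  qed
qed

lemma amp_closers_bound:
  assumes c: "is_cut A w" "is_cut N w" and D: "D \<subseteq> {A..<N}" and nz: "amp q A N D w \<noteq> 0"
  shows "card D = card (closers w \<inter> {A..<N})" "\<Sum>D \<le> \<Sum>(closers w \<inter> {A..<N})"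
    "\<Sum>D = \<Sum>(closers w \<inter> {A..<N}) \<Longrightarrow> D = closers w \<inter> {A..<N}"
proof -
  let ?m = "\<lambda>a. max a (partner w a)"
  note bij = amp_bij[OF assms]
  have fin: "finite D" using D finite_subset by blast
  show "card D = card (closers w \<inter> {A..<N})" using bij by (rule bij_betw_same_card)
  have s: "(\<Sum>a\<in>D. ?m a) = \<Sum>(closers w \<inter> {A..<N})"
    using sum.reindex_bij_betw[OF bij, of "\<lambda>a. a"] by simp
  then show "\<Sum>D \<le> \<Sum>(closers w \<inter> {A..<N})"
    by (metis max.cobounded1 sum_mono)
  assume "\<Sum>D = \<Sum>(closers w \<inter> {A..<N})"
  then have "(\<Sum>a\<in>D. a) = (\<Sum>a\<in>D. ?m a)" using s by simp
  then have "a = ?m a" if "a \<in> D" for a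
    using sum_mono_inv[of "\<lambda>a. a" D ?m a] that fin by simp
  then have "?m ` D = D" by (simp cong: image_cong)
  then show "D = closers w \<inter> {A..<N}" using bij by (simp add: bij_betw_def)
qed

lemma amp_closers_self:
  assumes c: "is_cut A w" "is_cut N w"
  shows "amp q A N (closers w \<inter> {A..<N}) w = 1"
  unfolding amp_def
proof (rule prod.neutral, rule ballI)
  fix a assume "a \<in> {A..<N}"
  then show "amp_at q w (closers w \<inter> {A..<N}) a = 1"
    using partner_window[OF c, of a] by (auto simp: amp_at_def closers_def)
qed

lemma amp_triangular:
  assumes "is_cut A v" "is_cut N v" "is_cut A w" "is_cut N w"
    and out: "\<And>a. a \<notin> {A..<N} \<Longrightarrow> partner v a = partner w a"
    and nz: "amp q A N (closers v \<inter> {A..<N}) w \<noteq> 0" and ne: "v \<noteq> w"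
  shows "\<Sum>(closers v \<inter> {A..<N}) < \<Sum>(closers w \<inter> {A..<N})"
proof -
  note b = amp_closers_bound[OF assms(3,4) _ nz]
  have "closers v \<inter> {A..<N} \<noteq> closers w \<inter> {A..<N}"
  proof
    assume eq: "closers v \<inter> {A..<N} = closers w \<inter> {A..<N}"
    have "a \<in> closers v \<longleftrightarrow> a \<in> closers w" for a
    proof (cases "a \<in> {A..<N}")
      case True
      then show ?thesis using eq by blast
    qed (simp add: out closers_def)
    then show False using ne closers_inject by blast
  qed
  then show ?thesis using b(2)[OF Int_lower2] b(3)[OF Int_lower2] le_neq_implies_less by blast
qed

text \<open>
  Injectivity of the expansion: the right ends of the state of largest sum in the support of \<open>x\<close> occur in no
  other state of the support.
\<close>

lemma amp_nonzero_exists: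
  assumes V: "\<And>v. v \<in> V \<Longrightarrow> is_cut A v \<and> is_cut N v"
    and out: "\<And>v w a. v \<in> V \<Longrightarrow> w \<in> V \<Longrightarrow> a \<notin> {A..<N} \<Longrightarrow> partner v a = partner w a"
    and x: "x \<in> span_on V" "x \<noteq> 0"
  shows "\<exists>v \<in> V. lin_val (amp q A N (closers v \<inter> {A..<N})) x \<noteq> 0"
proof -
  let ?K = "Poly_Mapping.keys x" and ?s = "\<lambda>v. \<Sum>(closers v \<inter> {A..<N})"
  have K: "?K \<subseteq> V" "?K \<noteq> {}" "finite ?K" using x by (auto simp: span_on_def)
  obtain v where v: "v \<in> ?K" "\<And>w. w \<in> ?K \<Longrightarrow> ?s w \<le> ?s v"
  proof -
    have "Max (?s ` ?K) \<in> ?s ` ?K" using K by (intro Max_in) auto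
    then obtain v where "v \<in> ?K" "?s v = Max (?s ` ?K)" by auto
    moreover have "?s w \<le> Max (?s ` ?K)" if "w \<in> ?K" for w using K(3) that by (intro Max_ge) auto
    ultimately show thesis using that by metis
  qed
  have "amp q A N (closers v \<inter> {A..<N}) w = 0" if "w \<in> ?K" "w \<noteq> v" for w
  proof (rule ccontr)
    assume nz: "amp q A N (closers v \<inter> {A..<N}) w \<noteq> 0"
    have in_V: "v \<in> V" "w \<in> V" using v(1) that(1) K(1) by auto
    have "?s v < ?s w"
      by (rule amp_triangular[OF _ _ _ _ _ nz]) (use V in_V out that(2) in blast)+
    then show False using v(2)[OF that(1)] by simp
  qed
  then have "lin_val (amp q A N (closers v \<inter> {A..<N})) x
      = (\<Sum>w\<in>{v}. Poly_Mapping.lookup x w * amp q A N (closers v \<inter> {A..<N}) w)"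
    unfolding lin_val_def using v(1) by (intro sum.mono_neutral_right) auto
  also have "\<dots> = Poly_Mapping.lookup x v"
    using amp_closers_self[of A v N q] V v(1) K(1) by auto
  finally show ?thesis using v(1) K(1) by (intro bexI[of _ v]) (auto simp: in_keys_iff)
qed

lemma card_closers:
  assumes c: "is_cut A w" "is_cut N w" "A \<le> N"
  shows "2 * card (closers w \<inter> {A..<N}) + card {a \<in> {A..<N}. partner w a = a} = N - A"
proof -
  let ?C = "closers w \<inter> {A..<N}" and ?S = "{a \<in> {A..<N}. partner w a = a}"
  let ?O = "{a \<in> {A..<N}. a < partner w a}"
  note pw = partner_window[OF c(1,2)]
  have "partner w a \<in> ?O" if "a \<in> ?C" for a using pw[of a] that by (simp add: closers_def)
  moreover have "partner w a \<in> ?C" if "a \<in> ?O" for a using pw[of a] that by (simp add: closers_def)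
  ultimately have "bij_betw (partner w) ?C ?O"
    by (intro bij_betw_byWitness[where f' = "partner w"]) (simp_all add: image_subset_iff)
  then have "card ?C = card ?O" by (rule bij_betw_same_card)
  moreover have "{A..<N} = (?C \<union> ?O) \<union> ?S" by (auto simp: closers_def)
  then have "N - A = card ((?C \<union> ?O) \<union> ?S)" by (metis card_atLeastLessThan)
  then have "N - A = card ?C + card ?O + card ?S"
    by (subst (asm) card_Un_disjoint; (subst (asm) card_Un_disjoint)?) (auto simp: closers_def)
  ultimately show ?thesis by simp
qed

lemma std_cups:
  assumes "v \<in> states r N k" "a < 2 * k"
  shows "partner v a = (if even a then Suc a else a - 1)"
proof -
  have s: "partner v (2 * j) = Suc (2 * j)" if "j < k" for j
    using assms that by (auto simp: states_def)
  show ?thesis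
  proof (cases "even a")
    case True
    then obtain j where "a = 2 * j" by (elim evenE)
    then show ?thesis using s[of j] assms by simp
  next
    case False
    then obtain j where j: "a = 2 * j + 1" by (elim oddE)
    then have "partner v (partner v (2 * j)) = partner v a" using s[of j] assms by simp
    then show ?thesis using j by simp
  qed
qed

lemma cut_std:
  assumes "v \<in> states r N k"
  shows "is_cut (2 * k) v"
  unfolding is_cut_def
proof (intro allI impI)
  fix a assume a: "a < 2 * k"
  have "even a \<Longrightarrow> Suc a < 2 * k" using a by (auto elim!: evenE)
  then show "partner v a < 2 * k" using std_cups[OF assms a] a by auto
qed

lemma states_window:
  assumes "v \<in> states r N k" "2 * k \<le> N"
  shows "2 * card (closers v \<inter> {2 * k..<N}) + strings_below N r = N - 2 * k"
proof -
  have v: "is_cut N v" "is_cut (2 * k) v" "strings_below N v = strings_below N r"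
    using assms cut_std by (auto simp: states_def)
  have "partner v a \<noteq> a" if "a < 2 * k" for a
    using std_cups[OF assms(1) that] by (auto elim!: oddE)
  then have "{a \<in> {2 * k..<N}. partner v a = a} = {a. a < N \<and> partner v a = a}"
    by auto (metis not_less)
  then show ?thesis using card_closers[OF v(2,1) assms(2)] v(3) by (simp add: strings_below_def)
qed

lemma states_out:
  assumes "v \<in> states r N k" "w \<in> states r N k" "a \<notin> {2 * k..<N}"
  shows "partner v a = partner w a"
proof (cases "a < 2 * k")
  case True
  then show ?thesis using std_cups[OF assms(1)] std_cups[OF assms(2)] by simp
next
  case False
  then show ?thesis using assms by (auto simp: states_def)
qed

section \<open>Vectors annihilated by all generators of a window\<close>

lemma sum_insert_set: "finite D \<Longrightarrow> a \<notin> D \<Longrightarrow> \<Sum>(insert a D) = a + \<Sum>D" for D :: "nat set"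
  by simp

text \<open>
  Unless \<open>D\<close> is an initial segment, one of its points can be moved down by one. This drives the
  induction in the next lemma.
\<close>

lemma gap_below:
  fixes D :: "nat set"
  assumes D: "D \<subseteq> {A..<N}" "D \<noteq> {A..<A + card D}"
  shows "\<exists>i \<ge> A. Suc i \<in> D \<and> i \<notin> D"
proof (rule ccontr)
  assume "\<not> ?thesis"
  then have down: "i \<in> D" if "A \<le> i" "Suc i \<in> D" for i using that by blast
  have fin: "finite D" using D(1) finite_subset by blast
  have ne: "D \<noteq> {}" using D(2) by auto
  let ?M = "Max D"
  have M: "?M \<in> D" "\<And>a. a \<in> D \<Longrightarrow> a \<le> ?M" using fin ne by auto
  have "a \<in> D" if "A \<le> a" "a \<le> ?M" for a
    using that(2,1)
  proof (induction a rule: inc_induct)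
    case base
    then show ?case using M by simp
  next
    case (step a)
    then show ?case using down[of a] by simp
  qed
  then have eq: "D = {A..<Suc ?M}" using M(2) D(1) by (auto simp: less_Suc_eq_le)
  have "A \<le> ?M" using M(1) D(1) by auto
  moreover have "card D = Suc ?M - A" using eq by (metis card_atLeastLessThan)
  ultimately have "A + card D = Suc ?M" by simp
  then show False using D(2) eq by simp
qed

text \<open>
  A singular vector has coefficients that change by the factor \<open>Q\<close> when a down spin moves up by one, so they are
  determined by a single one of them. The relation is stated without division.
\<close>

lemma geometric_of_swaps:
  fixes \<psi> :: "nat set \<Rightarrow> complex"
  assumes step: "\<And>i D. A \<le> i \<Longrightarrow> Suc i < N \<Longrightarrow> D \<subseteq> {A..<N} \<Longrightarrow> i \<notin> D \<Longrightarrow> Suc i \<notin> D \<Longrightarrow>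
      \<psi> (insert (Suc i) D) = Q * \<psi> (insert i D)"
    and D: "D \<subseteq> {A..<N}"
  shows "\<psi> D * Q ^ \<Sum>{A..<A + card D} = Q ^ \<Sum>D * \<psi> {A..<A + card D}"
  using D
proof (induction "\<Sum>D" arbitrary: D rule: less_induct)
  case less
  show ?case
  proof (cases "D = {A..<A + card D}")
    case True
    then show ?thesis by simp
  next
    case False
    then obtain i where i: "i \<ge> A" "Suc i \<in> D" "i \<notin> D" using gap_below[OF less.prems] by blast
    let ?D = "D - {Suc i}"
    have fin: "finite D" using less.prems finite_subset by blast
    have e: "D = insert (Suc i) ?D" using i by blast
    have D': "?D \<subseteq> {A..<N}" "insert i ?D \<subseteq> {A..<N}" "Suc i < N" using i less.prems by auto
    have s: "\<Sum>D = Suc (\<Sum>(insert i ?D))"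
      using i fin sum_insert_set[of ?D "Suc i"] sum_insert_set[of ?D i] e by simp
    have "card (insert i ?D) = Suc (card ?D)" using i fin by (intro card_insert_disjoint) auto
    also have "\<dots> = card D" using i fin by (intro card_Suc_Diff1)
    finally have c: "card (insert i ?D) = card D" .
    have st: "\<psi> D = Q * \<psi> (insert i ?D)"
      using step[of i ?D] i D' by (simp add: insert_absorb)
    have "\<psi> (insert i ?D) * Q ^ \<Sum>{A..<A + card D} = Q ^ \<Sum>(insert i ?D) * \<psi> {A..<A + card D}"
      using less.hyps[of "insert i ?D"] s D'(2) by (simp only: c)
    then show ?thesis unfolding st s by (simp add: mult.assoc)
  qed
qed

text \<open>
  Exchanging the points \<open>i\<close> and \<open>i + 1\<close> permutes the sets of given size and reverses the sign of \<open>g\<close>.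
\<close>

lemma sum_zero_of_swap:
  fixes g :: "nat set \<Rightarrow> complex"
  assumes i: "i \<in> W" "Suc i \<in> W"
    and swap: "\<And>D. i \<notin> D \<Longrightarrow> Suc i \<notin> D \<Longrightarrow> D \<subseteq> W \<Longrightarrow> g (insert (Suc i) D) = - g (insert i D)"
    and zero: "\<And>D. D \<subseteq> W \<Longrightarrow> (i \<in> D \<longleftrightarrow> Suc i \<in> D) \<Longrightarrow> g D = 0"
    and fin: "finite W"
  shows "sum g {D. D \<subseteq> W \<and> card D = m} = 0"
proof -
  let ?F = "{D. D \<subseteq> W \<and> card D = m}"
  define S where "S D = (if i \<in> D \<and> Suc i \<notin> D then insert (Suc i) (D - {i})
    else if Suc i \<in> D \<and> i \<notin> D then insert i (D - {Suc i}) else D)" for D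
  have SS: "S (S D) = D" for D
    by (auto simp: S_def)
  have cS: "card (S D) = card D" if "D \<subseteq> W" for D
  proof -
    have fD: "finite D" using that fin finite_subset by blast
    have c: "card (insert b (D - {a})) = card D" if "a \<in> D" "b \<notin> D" for a b
    proof -
      have "card (insert b (D - {a})) = Suc (card (D - {a}))"
        using that fD by (intro card_insert_disjoint) auto
      also have "\<dots> = card D" using that fD by (intro card_Suc_Diff1)
      finally show ?thesis .
    qed
    show ?thesis by (simp add: S_def c)
  qed
  have SF: "S D \<in> ?F" if "D \<in> ?F" for D
    using that cS[of D] i by (auto simp: S_def)
  have gS: "g (S D) = - g D" if "D \<in> ?F" for D
  proof -
    consider (a) "i \<in> D" "Suc i \<notin> D" | (b) "Suc i \<in> D" "i \<notin> D" | (c) "i \<in> D \<longleftrightarrow> Suc i \<in> D" by blast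
    then show ?thesis
    proof cases
      case a
      then show ?thesis using swap[of "D - {i}"] that by (auto simp: S_def insert_absorb)
    next
      case b
      then have "g D = - g (insert i (D - {Suc i}))"
        using swap[of "D - {Suc i}"] that by (auto simp: insert_absorb)
      then show ?thesis using b by (simp add: S_def)
    next
      case c
      then have "S D = D" by (auto simp: S_def)
      then show ?thesis using zero[of D] c that by simp
    qed
  qed
  have "sum g ?F = (\<Sum>D\<in>?F. g (S D))"
    by (rule sum.reindex_bij_witness[of _ S S]) (use SS SF in auto)
  also have "\<dots> = - sum g ?F" using gS by (simp add: sum_negf[symmetric])
  finally show ?thesis by (simp add: eq_neg_iff_add_eq_0)
qed

text \<open>
A shortest cup under a given one joins neighbours.
\<close>

lemma adjacent_cup:
  assumes "B \<le> a" "a < partner w a" "partner w a < N"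
  shows "\<exists>i \<ge> B. Suc i < N \<and> partner w i = Suc i"
  using assms
proof (induction "partner w a - a" arbitrary: a rule: less_induct)
  case less
  show ?case
  proof (cases "partner w a = Suc a")
    case True
    then show ?thesis using less.prems by (intro exI[of _ a]) simp
  next
    case False
    then have lt: "Suc a < partner w a" using less.prems by simp
    note N = is_link_stateD[OF partner_link_state[of w] _ lt, simplified]
    have "Suc a < partner w (Suc a)" using N(1,3) by linarith
    then show ?thesis
      using less.hyps[of "Suc a"] N(2) less.prems lt by simp
  qed
qed

lemma amp_cup:
  assumes c: "is_cut A w" "is_cut N w" and i: "A \<le> i" "Suc i < N" and D: "i \<notin> D" "Suc i \<notin> D"
    and q: "q \<noteq> 0" and cup: "partner w i = Suc i"
  shows "amp q A N (insert i D) w = q * amp q A N (insert (Suc i) D) w"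
  using amp_cap_basis[OF c i D q refl] by (simp add: e_basis_cup[OF cup] distrib_right)

text \<open>
  The elementary symmetric polynomial \<open>e\<^sub>m(1, x, \<dots>, x\<^bsup>L-1\<^esup>)\<close>.
\<close>

definition elem_sum :: "complex \<Rightarrow> nat \<Rightarrow> nat \<Rightarrow> complex" where
  "elem_sum x m L = (\<Sum>D \<in> {D. D \<subseteq> {..<L} \<and> card D = m}. x ^ \<Sum>D)"

lemma elem_sum_shift:
  "(\<Sum>D \<in> {D. D \<subseteq> {B..<B + L} \<and> card D = m}. x ^ \<Sum>D) = x ^ (B * m) * elem_sum x m L"
proof -
  let ?F = "{D. D \<subseteq> {..<L} \<and> card D = m}" and ?s = "\<lambda>D. (+) B ` D"
  have fin: "finite D" if "D \<in> ?F" for D using that finite_subset by auto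
  have "(\<Sum>D \<in> {D. D \<subseteq> {B..<B + L} \<and> card D = m}. x ^ \<Sum>D) = (\<Sum>D\<in>?F. x ^ \<Sum>(?s D))"
  proof (rule sum.reindex_bij_witness[of _ ?s "\<lambda>D. (\<lambda>a. a - B) ` D"])
    fix D assume D: "D \<in> {D. D \<subseteq> {B..<B + L} \<and> card D = m}"
    have "inj_on (\<lambda>a. a - B) D" using D by (auto simp: inj_on_def) (metis atLeastLessThan_iff eq_diff_iff subsetD)
    then have "card ((\<lambda>a. a - B) ` D) = m" using D by (simp add: card_image)
    moreover have "(\<lambda>a. a - B) ` D \<subseteq> {..<L}" using D by (auto simp: image_subset_iff subset_iff)
    ultimately show "(\<lambda>a. a - B) ` D \<in> ?F" by simp
    have "?s ((\<lambda>a. a - B) ` D) = (\<lambda>a. a) ` D"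
      unfolding image_image by (rule image_cong) (use D in auto)
    then show "?s ((\<lambda>a. a - B) ` D) = D" by simp
    then show "x ^ \<Sum>(?s ((\<lambda>a. a - B) ` D)) = x ^ \<Sum>D" by simp
  next
    fix D assume D: "D \<in> ?F"
    show "(\<lambda>a. a - B) ` ?s D = D" by (simp add: image_image)
    show "?s D \<in> {D. D \<subseteq> {B..<B + L} \<and> card D = m}"
      using D by (auto simp: card_image)
  qed
  also have "\<dots> = (\<Sum>D\<in>?F. x ^ (B * m) * x ^ \<Sum>D)"
  proof (rule sum.cong[OF refl])
    fix D assume D: "D \<in> ?F"
    have "\<Sum>(?s D) = (\<Sum>a\<in>D. B + a)" by (subst sum.reindex) auto
    also have "\<dots> = B * m + \<Sum>D" using D by (simp add: sum.distrib mult.commute)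
    finally show "x ^ \<Sum>(?s D) = x ^ (B * m) * x ^ \<Sum>D" by (simp add: power_add)
  qed
  finally show ?thesis by (simp add: elem_sum_def sum_distrib_left)
qed

text \<open>
  Fix the first \<open>j - m\<close> spins of the free part to be down. A state with \<open>j\<close> cups there has at most \<open>j - m\<close>
  cups touching these points, so some cup lies completely beyond them, and hence also one joining
  neighbours. The weights \<open>(- q) ^ \<Sum>D\<close> make the two orientations of this cup cancel.
\<close>

lemma amp_functional_zero:
  assumes v: "v \<in> states r N k" "2 * k \<le> N" and j: "2 * j + strings_below N r = N - 2 * k"
    and m: "1 \<le> m" "m \<le> j" and q: "q \<noteq> 0" and B: "B = 2 * k + (j - m)"
  shows "(\<Sum>D \<in> {D. D \<subseteq> {B..<N} \<and> card D = m}. (- q) ^ \<Sum>D * amp q (2 * k) N ({2 * k..<B} \<union> D) v) = 0"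
proof -
  let ?C = "closers v \<inter> {2 * k..<N}"
  have c: "is_cut (2 * k) v" "is_cut N v" using v cut_std by (auto simp: states_def)
  have cC: "card ?C = j" using states_window[OF v] j by simp
  have "\<exists>c \<in> ?C. B \<le> partner v c"
  proof (rule ccontr)
    assume "\<not> ?thesis"
    then have "partner v a \<in> {2 * k..<B}" if "a \<in> ?C" for a
      using partner_window[OF c, of a] that by (auto simp: not_le)
    then have "partner v ` ?C \<subseteq> {2 * k..<B}" by blast
    then have "card (partner v ` ?C) \<le> B - 2 * k"
      using card_mono[OF finite_atLeastLessThan] by (metis card_atLeastLessThan)
    moreover have "card (partner v ` ?C) = card ?C"
      by (rule card_image) (auto simp: inj_on_def partner_eq_iff)
    ultimately show False using cC m B by simp
  qed
  then obtain b where b: "b < N" "partner v b < b" "B \<le> partner v b" by (auto simp: closers_def)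
  obtain i where i: "B \<le> i" "Suc i < N" "partner v i = Suc i"
    using adjacent_cup[of B "partner v b" v N] b by auto
  have ik: "2 * k \<le> i" using i B by simp
  show ?thesis
  proof (rule sum_zero_of_swap[of i])
    fix D assume D: "i \<notin> D" "Suc i \<notin> D" "D \<subseteq> {B..<N}"
    let ?E = "{2 * k..<B} \<union> D"
    have "finite D" using D(3) finite_subset by blast
    have "amp q (2 * k) N (insert i ?E) v = q * amp q (2 * k) N (insert (Suc i) ?E) v"
      by (rule amp_cup[OF c ik i(2) _ _ q i(3)]) (use D i in auto)
    then show "(- q) ^ \<Sum>(insert (Suc i) D) * amp q (2 * k) N ({2 * k..<B} \<union> insert (Suc i) D) v
      = - ((- q) ^ \<Sum>(insert i D) * amp q (2 * k) N ({2 * k..<B} \<union> insert i D) v)"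
      using D \<open>finite D\<close> by simp
  next
    fix D assume D: "D \<subseteq> {B..<N}" "i \<in> D \<longleftrightarrow> Suc i \<in> D"
    let ?E = "{2 * k..<B} \<union> D"
    have "amp q (2 * k) N ?E v = 0"
    proof (rule ccontr)
      assume "amp q (2 * k) N ?E v \<noteq> 0"
      from amp_nonzeroD[OF this, of i] show False using i ik D(2) by auto
    qed
    then show "(- q) ^ \<Sum>D * amp q (2 * k) N ?E v = 0" by simp
  qed (use i in auto)
qed

text \<open>
  The coefficients \<open>\<psi>\<close> of a singular vector are a constant multiple of the very weights used in
  \<open>amp_functional_zero\<close>. That functional therefore sums squares \<open>(q\<^sup>2) ^ \<Sum>D\<close> and takes the value
  \<open>elem_sum\<close> times the constant, up to a power of \<open>q\<close>. As it also vanishes, the constant is \<open>0\<close>.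
\<close>

lemma no_singular_vector:
  assumes x: "x \<in> span_on (states r N k)" and k: "2 * k \<le> N"
    and j: "2 * j + strings_below N r = N - 2 * k"
    and m: "1 \<le> m" "m \<le> j" "elem_sum (q\<^sup>2) m (strings_below N r + j + m) \<noteq> 0"
    and q: "q \<noteq> 0" "\<delta> = q + inverse q"
    and sing: "\<And>i. 2 * k \<le> i \<Longrightarrow> Suc i < N \<Longrightarrow> e_op \<delta> i x = 0"
  shows "x = 0"
proof (rule ccontr)
  assume x0: "x \<noteq> 0"
  let ?A = "2 * k"
  define \<psi> where "\<psi> D = lin_val (amp q ?A N D) x" for D
  have cuts: "is_cut ?A v \<and> is_cut N v" if "v \<in> states r N k" for v
    using that cut_std by (auto simp: states_def)
  have step: "\<psi> (insert (Suc i) D) = - q * \<psi> (insert i D)"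
    if "?A \<le> i" "Suc i < N" "i \<notin> D" "Suc i \<notin> D" for i D
  proof -
    have "0 = lin_val (amp q ?A N (insert (Suc i) D)) (e_op \<delta> i x)" using sing that by simp
    also have "\<dots> = lin_val (\<lambda>v. lin_val (amp q ?A N (insert (Suc i) D)) (e_basis \<delta> i v)) x"
      by (simp add: e_op_def lin_val_lin_ext)
    also have "\<dots> = lin_val (\<lambda>v. inverse q * amp q ?A N (insert (Suc i) D) v + amp q ?A N (insert i D) v) x"
      by (rule lin_val_cong[OF x], rule amp_cap_basis) (use that q cuts in auto)
    also have "\<dots> = inverse q * \<psi> (insert (Suc i) D) + \<psi> (insert i D)"
      by (simp add: lin_val_fun_lin \<psi>_def)
    finally have "q * (inverse q * \<psi> (insert (Suc i) D) + \<psi> (insert i D)) = 0" by simp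
    then have "\<psi> (insert (Suc i) D) + q * \<psi> (insert i D) = 0"
      using q(1) by (simp add: distrib_left flip: mult.assoc)
    then show ?thesis by (simp add: eq_neg_iff_add_eq_0)
  qed
  \<comment> \<open>The reference configuration: all coefficients are multiples of the one at \<open>F\<close>.\<close>
  define F where "F = {?A..<?A + j}"
  have geo: "\<psi> D * (- q) ^ \<Sum>F = (- q) ^ \<Sum>D * \<psi> F" if "D \<subseteq> {?A..<N}" "card D = j" for D
    using geometric_of_swaps[of ?A N \<psi> "- q", OF step that(1)] that(2) by (simp add: F_def)
  have "\<exists>v \<in> states r N k. lin_val (amp q ?A N (closers v \<inter> {?A..<N})) x \<noteq> 0"
    by (rule amp_nonzero_exists[OF cuts _ x x0]; (rule states_out)?)
  then obtain v where v: "v \<in> states r N k" "\<psi> (closers v \<inter> {?A..<N}) \<noteq> 0"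
    by (auto simp: \<psi>_def)
  have "card (closers v \<inter> {?A..<N}) = j" using states_window[OF v(1) k] j by simp
  then have "\<psi> F \<noteq> 0" using geo[of "closers v \<inter> {?A..<N}"] v(2) q(1) by auto
  define B L where "B = ?A + (j - m)" and "L = strings_below N r + j + m"
  have BL: "B + L = N" using j m k by (simp add: B_def L_def)
  let ?F = "{D. D \<subseteq> {B..<N} \<and> card D = m}" and ?E = "\<lambda>D. {?A..<B} \<union> D"
  have "0 = lin_val (\<lambda>v. \<Sum>D\<in>?F. (- q) ^ \<Sum>D * amp q ?A N (?E D) v) x"
    using lin_val_cong[OF x, of "\<lambda>v. \<Sum>D\<in>?F. (- q) ^ \<Sum>D * amp q ?A N (?E D) v" "\<lambda>v. 0"]
      amp_functional_zero[OF _ k j m(1,2) q(1) B_def] by (simp add: lin_val_def)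
  also have "\<dots> = (\<Sum>D\<in>?F. (- q) ^ \<Sum>D * \<psi> (?E D))"
    by (simp add: lin_val_fun_sum \<psi>_def)
  finally have "0 = (\<Sum>D\<in>?F. (- q) ^ \<Sum>D * \<psi> (?E D)) * (- q) ^ \<Sum>F" by simp
  also have "\<dots> = (\<Sum>D\<in>?F. (- q) ^ \<Sum>D * ((- q) ^ \<Sum>(?E D) * \<psi> F))"
    unfolding sum_distrib_right
  proof (rule sum.cong[OF refl])
    fix D assume D: "D \<in> ?F"
    then have fin: "finite D" using finite_subset by blast
    have "card (?E D) = card {?A..<B} + card D"
      by (rule card_Un_disjoint) (use fin D in auto)
    then have "card (?E D) = j" using D m by (simp add: B_def)
    moreover have "?E D \<subseteq> {?A..<N}" using D BL by (auto simp: B_def)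
    ultimately show "(- q) ^ \<Sum>D * \<psi> (?E D) * (- q) ^ \<Sum>F = (- q) ^ \<Sum>D * ((- q) ^ \<Sum>(?E D) * \<psi> F)"
      using geo by (simp add: mult.assoc)
  qed
  also have "\<dots> = (\<Sum>D\<in>?F. (- q) ^ \<Sum>{?A..<B} * \<psi> F * (q\<^sup>2) ^ \<Sum>D)"
  proof (rule sum.cong[OF refl])
    fix D assume D: "D \<in> ?F"
    then have fin: "finite D" using finite_subset by blast
    have "\<Sum>(?E D) = \<Sum>{?A..<B} + \<Sum>D"
      by (rule sum.union_disjoint) (use fin D in auto)
    moreover have "(q\<^sup>2) ^ n = (- q) ^ n * (- q) ^ n" for n
      by (simp add: power2_eq_square flip: power_mult_distrib)
    ultimately show "(- q) ^ \<Sum>D * ((- q) ^ \<Sum>(?E D) * \<psi> F)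
        = (- q) ^ \<Sum>{?A..<B} * \<psi> F * (q\<^sup>2) ^ \<Sum>D"
      by (simp add: power_add)
  qed
  also have "\<dots> = (- q) ^ \<Sum>{?A..<B} * \<psi> F * ((q\<^sup>2) ^ (B * m) * elem_sum (q\<^sup>2) m L)"
    unfolding sum_distrib_left[symmetric] using elem_sum_shift[of "q\<^sup>2" B L m] BL by simp
  finally show False using \<open>\<psi> F \<noteq> 0\<close> m(3) q(1) by (simp add: L_def)
qed

section \<open>Reduction to a single link state\<close>

lemma states_eqI:
  assumes v: "v \<in> states r N k" "w \<in> states r N k"
    and C: "closers v \<inter> {2 * k..<N} = closers w \<inter> {2 * k..<N}"
  shows "v = w"
proof (rule closers_inject, rule Set.set_eqI)
  fix a
  show "a \<in> closers v \<longleftrightarrow> a \<in> closers w"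
  proof (cases "a \<in> {2 * k..<N}")
    case True
    then show ?thesis using C by blast
  qed (simp add: states_out[OF v] closers_def)
qed

text \<open>
  The reduction of vectors ends here: the free part consists of strings only, or of one cup.
\<close>

lemma states_unique:
  assumes v: "v \<in> states r N k" "w \<in> states r N k" and k: "2 * k \<le> N"
    and j: "2 * j + strings_below N r = N - 2 * k" "j = 0 \<or> j = 1 \<and> strings_below N r = 0"
  shows "v = w"
proof (rule states_eqI[OF v])
  have C: "closers u \<inter> {2 * k..<N} = (if j = 0 then {} else {Suc (2 * k)})" if u: "u \<in> states r N k" for u
  proof -
    let ?C = "closers u \<inter> {2 * k..<N}"
    have c: "card ?C = j" using states_window[OF u k] j(1) by simp
    show ?thesis
    proof (cases "j = 0")
      case False
      then have j1: "j = 1" "N = 2 * k + 2" using j k by auto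
      have "2 * k \<notin> closers u"
        using partner_window[of "2 * k" u N "2 * k"] cut_std[OF u] u j1 by (auto simp: states_def closers_def)
      then have "?C \<subseteq> {Suc (2 * k)}" using j1 by (auto simp: le_less Suc_le_eq)
      then show ?thesis using c j1 card_seteq[of "{Suc (2 * k)}" ?C] by simp
    qed (use c in simp)
  qed
  show "closers v \<inter> {2 * k..<N} = closers w \<inter> {2 * k..<N}"
    using C v by simp
qed

lemma states_adjacent:
  assumes v: "v \<in> states r N k" and k: "2 * k \<le> N" and s: "strings_below N r < N - 2 * k"
  shows "\<exists>i \<ge> 2 * k. Suc i < N \<and> partner v i = Suc i"
proof -
  have "closers v \<inter> {2 * k..<N} \<noteq> {}" using states_window[OF v k] s by auto
  then obtain b where "b \<in> {2 * k..<N}" "b \<in> closers v" by blast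
  then have b: "b \<in> {2 * k..<N}" "partner v b < b" by (simp_all add: closers_def)
  have "2 * k \<le> partner v b"
    using partner_window[of "2 * k" v N b] cut_std[OF v] v b(1) by (auto simp: states_def)
  then show ?thesis using adjacent_cup[of "2 * k" "partner v b" v N] b by auto
qed

text \<open>
  Splitting off cups until none is free turns every state into the same standard one, reversibly.
\<close>

lemma to_standard:
  assumes "v \<in> states r N k" "2 * k \<le> N" "2 * j + strings_below N r = N - 2 * k"
  shows "\<exists>s \<in> states r N (k + j). \<forall>U. stable \<delta> N U \<longrightarrow>
    Poly_Mapping.single v 1 \<in> U \<longleftrightarrow> Poly_Mapping.single s 1 \<in> U"
  using assms
proof (induction j arbitrary: k v)
  case 0
  then show ?case by auto
next
  case (Suc j)
  obtain i where i: "i \<ge> 2 * k" "Suc i < N" "partner v i = Suc i"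
    using states_adjacent[OF Suc.prems(1,2)] Suc.prems(3) by auto
  have "Poly_Mapping.single v 1 \<in> span_on {v \<in> states r N k. partner v i = Suc i}"
    using Suc.prems i by (intro span_on_single) auto
  from move_cup_left[OF this i(1,2), of \<delta>] obtain v' where
    v': "Poly_Mapping.single v' 1 \<in> span_on (states r N (Suc k))"
    "\<forall>U. stable \<delta> N U \<longrightarrow> Poly_Mapping.single v 1 \<in> U \<longleftrightarrow> Poly_Mapping.single v' 1 \<in> U"
    by blast
  have "v' \<in> states r N (Suc k)" using v'(1) by (simp add: span_on_def)
  from Suc.IH[OF this] Suc.prems v'(2) show ?case by auto
qed

lemma states_connected:
  assumes v: "v \<in> states r N 0" and w: "w \<in> states r N 0"
    and U: "stable \<delta> N U" "Poly_Mapping.single v 1 \<in> U"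
  shows "Poly_Mapping.single w 1 \<in> U"
proof -
  define j where "j = card (closers v \<inter> {2 * 0..<N})"
  have j: "2 * j + strings_below N r = N - 2 * 0" using states_window[OF v] by (simp add: j_def)
  obtain s where s: "s \<in> states r N (0 + j)" "Poly_Mapping.single s 1 \<in> U"
    using to_standard[OF v _ j, of \<delta>] U by auto
  obtain s' where s': "s' \<in> states r N (0 + j)"
    "Poly_Mapping.single w 1 \<in> U \<longleftrightarrow> Poly_Mapping.single s' 1 \<in> U"
    using to_standard[OF w _ j, of \<delta>] U by auto
  have "s = s'" by (rule states_unique[OF s(1) s'(1), of 0]) (use j in auto)
  then show ?thesis using s s' by simp
qed

text \<open>
  The hypothesis of \<open>no_singular_vector\<close> for a free part with \<open>\<sigma>\<close> strings and \<open>j\<close> cups.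
\<close>

definition no_singular :: "complex \<Rightarrow> nat \<Rightarrow> nat \<Rightarrow> bool" where
  "no_singular x \<sigma> j \<longleftrightarrow> (\<exists>m. 1 \<le> m \<and> m \<le> j \<and> elem_sum x m (\<sigma> + j + m) \<noteq> 0)"

text \<open>
  The exception is necessary: for \<open>\<delta> = 0\<close> a single cup is itself a singular vector, but a free part
  consisting of one cup has only one state, so nothing remains to be reduced.
\<close>

definition simple_window :: "complex \<Rightarrow> nat \<Rightarrow> bool" where
  "simple_window x \<sigma> \<longleftrightarrow> (\<forall>j \<ge> 1. no_singular x \<sigma> j \<or> \<sigma> = 0 \<and> j = 1)"

lemma basis_state_of_unique:
  assumes x: "x \<in> span_on (states r N k)" "x \<noteq> 0" and k: "2 * k \<le> N"
    and j: "2 * j + strings_below N r = N - 2 * k" "j = 0 \<or> j = 1 \<and> strings_below N r = 0"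
    and U: "stable \<delta> N U" "x \<in> U"
  shows "\<exists>s \<in> states r N 0. Poly_Mapping.single s 1 \<in> U"
proof -
  obtain s where s: "s \<in> Poly_Mapping.keys x" using x(2) by (metis all_not_in_conv keys_eq_empty)
  have sS: "s \<in> states r N k" using s x(1) by (auto simp: span_on_def)
  have "states r N k \<subseteq> {s}" using states_unique[OF _ sS k j] by blast
  then have "x \<in> span_on {s}" using x(1) span_on_mono by blast
  then have xs: "x = Poly_Mapping.single s (Poly_Mapping.lookup x s)" by (rule span_on_singleton)
  have "cscale (inverse (Poly_Mapping.lookup x s)) x \<in> U"
    using U by (auto simp: stable_def cvec.subspace_scale)
  also have "cscale (inverse (Poly_Mapping.lookup x s)) x = Poly_Mapping.single s 1"
    using s by (subst (2) xs) (simp add: in_keys_iff)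
  finally show ?thesis using sS states_mono[of 0 k] by blast
qed

text \<open>
  By \<open>no_singular_vector\<close> some generator of the free part does not annihilate the vector. The cup that it
  creates is moved to the left, and the free part becomes shorter by two points.
\<close>

lemma reach_basis_state:
  assumes x: "x \<in> span_on (states r N k)" "x \<noteq> 0" and k: "2 * k \<le> N"
    and j: "2 * j + strings_below N r = N - 2 * k"
    and simple: "simple_window (q\<^sup>2) (strings_below N r)"
    and q: "q \<noteq> 0" "\<delta> = q + inverse q"
    and U: "stable \<delta> N U" "x \<in> U"
  shows "\<exists>s \<in> states r N 0. Poly_Mapping.single s 1 \<in> U"
  using x k j U(2)
proof (induction j arbitrary: k x)
  case (0 k x)
  then show ?case using basis_state_of_unique[of x r N k 0] U(1) by blast
next
  case (Suc j k x)
  show ?case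
  proof (cases "strings_below N r = 0 \<and> j = 0")
    case True
    then show ?thesis using basis_state_of_unique[of x r N k 1 \<delta> U] Suc.prems U(1) by simp
  next
    case False
    then have "no_singular (q\<^sup>2) (strings_below N r) (Suc j)"
      using simple by (auto simp: simple_window_def)
    then obtain m where m: "1 \<le> m" "m \<le> Suc j" "elem_sum (q\<^sup>2) m (strings_below N r + Suc j + m) \<noteq> 0"
      by (auto simp: no_singular_def)
    obtain i where i: "2 * k \<le> i" "Suc i < N" "e_op \<delta> i x \<noteq> 0"
      using no_singular_vector[OF Suc.prems(1,3,4) m q] Suc.prems(2) by blast
    from move_cup_left[OF e_op_states[OF Suc.prems(1) i(1,2)] i(1,2), of \<delta> \<delta>] obtain y where
      y: "y \<in> span_on (states r N (Suc k))"
      "\<And>U. stable \<delta> N U \<Longrightarrow> e_op \<delta> i x \<in> U \<longleftrightarrow> y \<in> U" by blast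
    have "y \<noteq> 0" using y(2)[OF stable_zero] i(3) by auto
    moreover have "y \<in> U" using y(2)[OF U(1)] U(1) Suc.prems i by (auto simp: stable_def)
    ultimately show ?thesis using Suc.IH[OF y(1)] Suc.prems by simp
  qed
qed

section \<open>Irreducibility\<close>

lemma single_one_nonzero [simp]: "Poly_Mapping.single w (1::complex) \<noteq> 0"
  by (metis lookup_single_eq lookup_zero zero_neq_one)

lemma single_in_generated: "Poly_Mapping.single w 1 \<in> generated_rep \<delta> w"
  by (auto simp: generated_rep_def)

lemma generated_rep_minimal: "subrep \<delta> U \<Longrightarrow> Poly_Mapping.single w 1 \<in> U \<Longrightarrow> generated_rep \<delta> w \<subseteq> U"
  by (auto simp: generated_rep_def)

text \<open>
  The vectors with the stated property form a subrepresentation, because a generator \<open>e\<^sub>i\<close> lies inside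
  every window with \<open>N \<ge> i + 2\<close>.
\<close>

lemma generated_rep_local:
  assumes "x \<in> generated_rep \<delta> w"
  shows "\<exists>N0. \<forall>N \<ge> N0. is_cut N w \<longrightarrow> x \<in> span_on (states w N 0)"
proof -
  define T where "T = {x. \<exists>N0. \<forall>N \<ge> N0. is_cut N w \<longrightarrow> x \<in> span_on (states w N 0)}"
  have "cvec.subspace T"
  proof (rule cvec.subspaceI)
    show "0 \<in> T" by (auto simp: T_def span_on_def)
  next
    fix x y assume "x \<in> T" "y \<in> T"
    then obtain N1 N2 where "\<forall>N \<ge> N1. is_cut N w \<longrightarrow> x \<in> span_on (states w N 0)"
      "\<forall>N \<ge> N2. is_cut N w \<longrightarrow> y \<in> span_on (states w N 0)" by (auto simp: T_def)
    then have "\<forall>N \<ge> max N1 N2. is_cut N w \<longrightarrow> x + y \<in> span_on (states w N 0)"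
      using subspace_span_on by (auto intro!: cvec.subspace_add)
    then show "x + y \<in> T" unfolding T_def by blast
  next
    fix c x assume "x \<in> T"
    then show "cscale c x \<in> T" unfolding T_def using subspace_span_on cvec.subspace_scale by blast
  qed
  moreover have "e_op \<delta> i x \<in> T" if x: "x \<in> T" for i x
  proof -
    obtain N1 where N1: "\<forall>N \<ge> N1. is_cut N w \<longrightarrow> x \<in> span_on (states w N 0)"
      using x unfolding T_def by blast
    have "\<forall>N \<ge> max N1 (i + 2). is_cut N w \<longrightarrow> e_op \<delta> i x \<in> span_on (states w N 0)"
      using N1 by (auto intro!: e_op_states')
    then show ?thesis unfolding T_def by blast
  qed
  ultimately have "subrep \<delta> T" by (simp add: subrep_iff)
  moreover have "Poly_Mapping.single w 1 \<in> T"
    using states_self by (auto simp: T_def intro!: span_on_single)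
  ultimately show ?thesis using generated_rep_minimal assms unfolding T_def by blast
qed

lemma subrep_generated_by_state:
  assumes "subrep \<delta> U" "is_cut N w" "s \<in> states w N 0" "Poly_Mapping.single s 1 \<in> U"
  shows "generated_rep \<delta> w \<subseteq> U"
  using generated_rep_minimal states_connected[OF assms(3) states_self[OF assms(2)] subrep_stable assms(4)]
    assms(1) by blast

text \<open>
  A nonzero vector of a subrepresentation lives in some window whose number of strings allows the reduction to a
  single link state; that state then generates everything.
\<close>

lemma irreducible_generated_rep:
  assumes q: "q \<noteq> 0" "\<delta> = q + inverse q"
    and cuts: "\<And>M. \<exists>N \<ge> M. is_cut N w \<and> simple_window (q\<^sup>2) (strings_below N w)"
  shows "irreducible_rep \<delta> (generated_rep \<delta> w)"
  unfolding irreducible_rep_def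
proof (intro conjI allI impI)
  show "subrep \<delta> (generated_rep \<delta> w)" by (rule subrep_generated_rep)
  show "generated_rep \<delta> w \<noteq> {0}" using single_in_generated[of w \<delta>] by auto
  fix U assume U: "subrep \<delta> U \<and> U \<subseteq> generated_rep \<delta> w"
  show "U = {0} \<or> U = generated_rep \<delta> w"
  proof (cases "U = {0}")
    case False
    moreover have "0 \<in> U" using U subrep_subspace cvec.subspace_0 by blast
    ultimately obtain x where x: "x \<in> U" "x \<noteq> 0" by blast
    obtain N0 where N0: "\<forall>N \<ge> N0. is_cut N w \<longrightarrow> x \<in> span_on (states w N 0)"
      using generated_rep_local x(1) U by blast
    obtain N where N: "N \<ge> N0" "is_cut N w" "simple_window (q\<^sup>2) (strings_below N w)" using cuts by blast
    have xN: "x \<in> span_on (states w N 0)" using N N0 by blast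
    have "\<exists>j. 2 * j + strings_below N w = N - 2 * 0"
      using states_window[OF states_self[OF N(2)]] by auto
    then obtain j where j: "2 * j + strings_below N w = N - 2 * 0" by blast
    have "stable \<delta> N U" using U subrep_stable by blast
    then obtain s where "s \<in> states w N 0" "Poly_Mapping.single s 1 \<in> U"
      using reach_basis_state[OF xN x(2) _ j N(3) q _ x(1)] by auto
    then show ?thesis using subrep_generated_by_state N(2) U by blast
  qed simp
qed

section \<open>Indecomposability\<close>

text \<open>
  The element \<open>e\<^sub>2\<^sub>k e\<^sub>2\<^sub>k\<^sub>+\<^sub>1\<close> produces a cup at \<open>2 * k\<close> but fixes the states that have one already. Using
  \<open>e\<^sub>2\<^sub>k\<close> alone would instead multiply those by \<open>\<delta>\<close>, which may be \<open>0\<close>.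
\<close>

primrec fold_std :: "complex \<Rightarrow> nat \<Rightarrow> (link_state \<Rightarrow>\<^sub>0 complex) \<Rightarrow> (link_state \<Rightarrow>\<^sub>0 complex)" where
  "fold_std \<delta> 0 x = x"
| "fold_std \<delta> (Suc k) x = e_op \<delta> (2 * k) (e_op \<delta> (Suc (2 * k)) (fold_std \<delta> k x))"

lemma fold_std_add: "fold_std \<delta> k (x + y) = fold_std \<delta> k x + fold_std \<delta> k y"
  by (induction k) (simp_all add: e_op_add)

lemma fold_std_stable: "stable \<delta> N U \<Longrightarrow> 2 * k < N \<or> k = 0 \<Longrightarrow> x \<in> U \<Longrightarrow> fold_std \<delta> k x \<in> U"
  by (induction k) (auto simp: stable_def)

lemma fold_std_states:
  assumes "x \<in> span_on (states r N 0)" "2 * k < N \<or> k = 0"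
  shows "fold_std \<delta> k x \<in> span_on (states r N k)"
  using assms(2)
proof (induction k)
  case (Suc k)
  then have "fold_std \<delta> k x \<in> span_on (states r N k)" by auto
  then show ?case
    using e_op_states[OF e_op_states', of "fold_std \<delta> k x" r N k "Suc (2 * k)" "2 * k"] Suc.prems
    by (simp add: states_Suc)
qed (use assms(1) in simp)

lemma fold_std_fixed: "x \<in> span_on (states r N k) \<Longrightarrow> fold_std \<delta> k x = x"
proof (induction k)
  case (Suc k)
  have "x \<in> span_on (states r N k)" using Suc.prems span_on_mono[OF states_mono[of k "Suc k"]] by auto
  moreover have "x \<in> span_on {v. partner v (2 * k) = Suc (2 * k)}"
    using Suc.prems by (auto simp: span_on_def states_def)
  ultimately show ?case using Suc.IH e_op_back by simp
qed simp

text \<open>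
  The summands of \<open>w\<close> lie in a common window, and the moves inside that window carry the decomposition of
  \<open>w\<close> to one of a standard state \<open>s0\<close>. Applying \<open>fold_std\<close> turns both summands into multiples of \<open>s0\<close>.
\<close>

lemma indecomposable_generated_rep:
  assumes cuts: "\<And>M. \<exists>N \<ge> M. is_cut N w"
  shows "indecomposable_rep \<delta> (generated_rep \<delta> w)"
  unfolding indecomposable_rep_def
proof (intro conjI notI)
  show "subrep \<delta> (generated_rep \<delta> w)" by (rule subrep_generated_rep)
  show "generated_rep \<delta> w = {0} \<Longrightarrow> False" using single_in_generated[of w \<delta>] by auto
  let ?X = "generated_rep \<delta> w"
  assume "\<exists>U V. subrep \<delta> U \<and> subrep \<delta> V \<and> U \<noteq> {0} \<and> V \<noteq> {0} \<and> U \<inter> V = {0} \<and> ?X = {u + v |u v. u \<in> U \<and> v \<in> V}"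
  then obtain U V where UV: "subrep \<delta> U" "subrep \<delta> V" "U \<noteq> {0}" "V \<noteq> {0}" "U \<inter> V = {0}"
    and X: "?X = {u + v |u v. u \<in> U \<and> v \<in> V}" by blast
  have zero: "0 \<in> U" "0 \<in> V" using UV(5) by auto
  have sub: "U \<subseteq> ?X" "V \<subseteq> ?X"
    unfolding X using zero by (force intro: add_0_left[symmetric] add_0_right[symmetric])+
  obtain a b where ab: "a \<in> U" "b \<in> V" "Poly_Mapping.single w 1 = a + b"
    using single_in_generated[of w \<delta>] unfolding X by blast
  obtain Na Nb where Nab: "\<forall>N \<ge> Na. is_cut N w \<longrightarrow> a \<in> span_on (states w N 0)"
    "\<forall>N \<ge> Nb. is_cut N w \<longrightarrow> b \<in> span_on (states w N 0)"
    using generated_rep_local sub ab(1,2) by (meson subsetD)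
  obtain N where N: "N \<ge> Na + Nb + 1" "is_cut N w" using cuts by blast
  let ?S = "span_on (states w N 0)"
  define T where "T = {u + v |u v. u \<in> U \<inter> ?S \<and> v \<in> V \<inter> ?S}"
  have "stable \<delta> N T"
    unfolding stable_def
  proof (intro conjI allI impI)
    show "cvec.subspace T"
      unfolding T_def
      by (intro cvec.subspace_sums cvec.subspace_inter subspace_span_on UV(1,2)[THEN subrep_subspace])
    fix i x assume i: "Suc i < N" and "x \<in> T"
    then obtain u v where "u \<in> U \<inter> ?S" "v \<in> V \<inter> ?S" "x = u + v" by (auto simp: T_def)
    then have "e_op \<delta> i u \<in> U \<inter> ?S" "e_op \<delta> i v \<in> V \<inter> ?S" "e_op \<delta> i x = e_op \<delta> i u + e_op \<delta> i v"
      using i UV(1,2)[THEN subrep_e_op] by (auto simp: e_op_add intro!: e_op_states')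
    then show "e_op \<delta> i x \<in> T" unfolding T_def by blast
  qed
  moreover have "Poly_Mapping.single w 1 \<in> T"
  proof -
    have "a \<in> U \<inter> ?S" "b \<in> V \<inter> ?S" using ab Nab N by auto
    then show ?thesis unfolding T_def ab(3) by blast
  qed
  moreover have w: "w \<in> states w N 0" using N states_self by simp
  ultimately have T: "Poly_Mapping.single s 1 \<in> T" if "s \<in> states w N 0" for s
    using states_connected that by blast
  define n where "n = card (closers w \<inter> {2 * 0..<N})"
  have n: "2 * n + strings_below N w = N" using states_window[OF w] by (simp add: n_def)
  obtain s0 where s0: "s0 \<in> states w N (0 + n)" using to_standard[OF w, of n] n by auto
  \<comment> \<open>Without strings the last factor of \<open>fold_std\<close> would leave the window; it is left out,
    since a free part with one cup has only one state.\<close>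
  define k where "k = (if strings_below N w = 0 then n - 1 else n)"
  have k: "2 * k < N" "k \<le> n" using n N(1) by (auto simp: k_def)
  have s: "s0 \<in> states w N k" using s0 states_mono[OF k(2)] by auto
  have uniq: "states w N k \<subseteq> {s0}"
    using states_unique[OF _ s, of _ "n - k"] n k by (auto simp: k_def split: if_splits)
  obtain u v where uv: "u \<in> U \<inter> ?S" "v \<in> V \<inter> ?S" "Poly_Mapping.single s0 1 = u + v"
    using T[of s0] s states_mono[of 0 k] unfolding T_def by blast
  have f: "fold_std \<delta> k x \<in> span_on {s0}" if "x \<in> ?S" for x
    using fold_std_states[OF that, of k \<delta>] k uniq span_on_mono by blast
  have contra: False if W: "subrep \<delta> W" "x \<in> W \<inter> ?S" "fold_std \<delta> k x \<noteq> 0"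
    and Y: "subrep \<delta> Y" "Y \<noteq> {0}" "W \<inter> Y = {0}" "Y \<subseteq> ?X" for W x Y
  proof -
    let ?c = "Poly_Mapping.lookup (fold_std \<delta> k x) s0"
    have e: "fold_std \<delta> k x = Poly_Mapping.single s0 ?c"
      by (rule span_on_singleton) (use f W(2) in blast)
    have c: "?c \<noteq> 0"
    proof
      assume "?c = 0"
      then have "fold_std \<delta> k x = 0" by (subst e) simp
      then show False using W(3) by simp
    qed
    have "fold_std \<delta> k x \<in> W"
      using fold_std_stable[OF subrep_stable[OF W(1)], of k N x] W(2) k(1) by blast
    then have "cscale (inverse ?c) (fold_std \<delta> k x) \<in> W"
      by (rule cvec.subspace_scale[OF subrep_subspace[OF W(1)]])
    moreover have "cscale (inverse ?c) (fold_std \<delta> k x) = Poly_Mapping.single s0 1"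
      using c by (subst (2) e) simp
    ultimately have "Poly_Mapping.single s0 1 \<in> W" by simp
    then have "?X \<subseteq> W"
      using subrep_generated_by_state[OF W(1) N(2)] s states_mono[of 0 k] by blast
    then show False using Y by blast
  qed
  have "fold_std \<delta> k u + fold_std \<delta> k v = fold_std \<delta> k (Poly_Mapping.single s0 1)"
    by (simp add: uv(3) fold_std_add)
  also have "\<dots> = Poly_Mapping.single s0 1"
    by (rule fold_std_fixed[OF span_on_single[OF s]])
  finally have "fold_std \<delta> k u \<noteq> 0 \<or> fold_std \<delta> k v \<noteq> 0"
    by auto
  then show False
  proof
    assume "fold_std \<delta> k u \<noteq> 0"
    then show False using contra[OF UV(1) uv(1) _ UV(2,4,5) sub(2)] by simp
  next
    assume "fold_std \<delta> k v \<noteq> 0"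
    then show False using contra[OF UV(2) uv(2) _ UV(1,3) _ sub(1)] UV(5) by (simp add: Int_commute)
  qed
qed

section \<open>Windows without singular vectors\<close>

text \<open>
  Elementary symmetric polynomials are the coefficients of \<open>\<Prod>j. 1 + x\<^sup>j Z\<close>.
\<close>

lemma coeff_prod_linear:
  fixes x :: complex
  assumes "finite W"
  shows "coeff (\<Prod>j\<in>W. [:1, x ^ j:]) m = (\<Sum>D \<in> {D. D \<subseteq> W \<and> card D = m}. x ^ \<Sum>D)"
proof -
  have "(\<Prod>j\<in>W. [:1, x ^ j:]) = (\<Prod>j\<in>W. monom (x ^ j) 1 + 1)"
    by (intro prod.cong refl poly_eqI) (simp add: coeff_pCons one_pCons split: nat.splits)
  also have "\<dots> = (\<Sum>D\<in>Pow W. (\<Prod>j\<in>D. monom (x ^ j) 1))"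
    by (subst prod_add[OF assms]) simp
  also have "\<dots> = (\<Sum>D\<in>Pow W. monom (x ^ \<Sum>D) (card D))"
  proof (intro sum.cong refl)
    fix D assume "D \<in> Pow W"
    then have "finite D" using assms finite_subset by blast
    then show "(\<Prod>j\<in>D. monom (x ^ j) 1) = monom (x ^ \<Sum>D) (card D)"
      by (induction D rule: finite_induct) (simp_all add: mult_monom power_add)
  qed
  also have "coeff \<dots> m = (\<Sum>D\<in>Pow W. if card D = m then x ^ \<Sum>D else 0)"
    by (simp add: coeff_sum)
  also have "\<dots> = (\<Sum>D \<in> {D \<in> Pow W. card D = m}. x ^ \<Sum>D)"
    using assms by (subst sum.inter_filter) auto
  also have "{D \<in> Pow W. card D = m} = {D. D \<subseteq> W \<and> card D = m}" by auto
  finally show ?thesis .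
qed

lemma coeff_prod_elem_sum: "coeff (\<Prod>j<L. [:1, x ^ j:]) m = elem_sum x m L"
  by (simp add: coeff_prod_linear elem_sum_def)

lemma elem_sum_0 [simp]: "elem_sum x 0 L = 1"
proof -
  have "{D. D \<subseteq> {..<L} \<and> card D = 0} = {{}}"
    by (auto simp: card_eq_0_iff dest: finite_subset)
  then show ?thesis by (simp add: elem_sum_def)
qed

lemma elem_sum_1: "elem_sum x 1 L = (\<Sum>j<L. x ^ j)"
proof -
  have "{D. D \<subseteq> {..<L} \<and> card D = 1} = (\<lambda>j. {j}) ` {..<L}"
    by (auto simp: card_1_singleton_iff)
  then show ?thesis by (simp add: elem_sum_def sum.reindex)
qed

lemma elem_sum_self: "elem_sum x L L = x ^ \<Sum>{..<L}"
proof -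
  have "{D. D \<subseteq> {..<L} \<and> card D = L} = {{..<L}}"
    by (rule Set.set_eqI, rule iffI) (simp_all add: card_subset_eq)
  then show ?thesis by (simp add: elem_sum_def)
qed

lemma elem_sum_gt:
  assumes "L < m"
  shows "elem_sum x m L = 0"
proof -
  have "\<not> (D \<subseteq> {..<L} \<and> card D = m)" for D
    using card_mono[of "{..<L}" D] assms by (metis card_lessThan finite_lessThan not_less)
  then have "{D. D \<subseteq> {..<L} \<and> card D = m} = {}" by blast
  then show ?thesis unfolding elem_sum_def by (simp only: sum.empty)
qed

text \<open>
  Since \<open>x ^ l = 1\<close>, replacing \<open>1, x, \<dots>, x\<^bsup>l-1\<^esup>\<close> by \<open>x, x\<^sup>2, \<dots>, x\<^sup>l\<close> only permutes the variables, but it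
  multiplies \<open>elem_sum x m l\<close> by \<open>x ^ m\<close>.
\<close>

lemma elem_sum_period:
  assumes x: "x ^ l = 1" "x ^ m \<noteq> 1"
  shows "elem_sum x m l = 0"
proof -
  let ?g = "\<lambda>j. [:1, x ^ j:]"
  have "(\<Prod>j<l. ?g j) * ?g l = ?g 0 * (\<Prod>j<l. ?g (Suc j))"
    using prod.lessThan_Suc[of ?g l] prod.lessThan_Suc_shift[of ?g l] by simp
  moreover have "?g l = ?g 0" "?g 0 \<noteq> 0" using x by simp_all
  ultimately have "(\<Prod>j<l. ?g j) = (\<Prod>j<l. ?g (Suc j))" by (metis mult.commute mult_left_cancel)
  also have "\<dots> = (\<Prod>j = 1..<1 + l. ?g j)"
    by (rule prod.reindex_bij_witness[of _ "\<lambda>j. j - 1" Suc]) auto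
  finally have "elem_sum x m l = x ^ (1 * m) * elem_sum x m l"
    using elem_sum_shift[of x 1 l m] coeff_prod_linear[of "{1..<1 + l}" x m]
      coeff_prod_elem_sum[of x l m] by simp
  then have "(1 - x ^ m) * elem_sum x m l = 0" by (simp add: algebra_simps)
  then show ?thesis using x by simp
qed

lemma prod_period:
  assumes "x ^ l = (1::complex)"
  shows "(\<Prod>j<B * l + c. [:1, x ^ j:]) = (\<Prod>j<l. [:1, x ^ j:]) ^ B * (\<Prod>j<c. [:1, x ^ j:])"
proof (induction B)
  case (Suc B)
  have split: "(\<Prod>j<l + n. g j) = (\<Prod>j<l. g j) * (\<Prod>j<n. g (l + j))" for n and g :: "nat \<Rightarrow> complex poly"
    by (induction n) (simp_all add: mult.assoc)
  have "(\<Prod>j<Suc B * l + c. [:1, x ^ j:]) = (\<Prod>j<l + (B * l + c). [:1, x ^ j:])" by (simp add: add.assoc)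
  also have "\<dots> = (\<Prod>j<l. [:1, x ^ j:]) * (\<Prod>j<B * l + c. [:1, x ^ j:])"
    unfolding split by (simp add: power_add assms)
  finally show ?case using Suc by simp
qed simp

lemma coeff_mult_sparse:
  fixes p r :: "complex poly"
  assumes "0 < l" "\<And>i. 0 < i \<Longrightarrow> i < l \<Longrightarrow> coeff p i = 0"
  shows "coeff (p * r) l = coeff p 0 * coeff r l + coeff p l * coeff r 0"
proof -
  have "coeff (p * r) l = (\<Sum>i\<in>{0, l}. coeff p i * coeff r (l - i))"
    unfolding coeff_mult using assms by (intro sum.mono_neutral_right) auto
  then show ?thesis using assms(1) by simp
qed

text \<open>
  By \<open>elem_sum_period\<close> the product over a full period is \<open>1 + c Z\<^sup>l\<close> with \<open>c \<noteq> 0\<close>. The \<open>B\<close> full periods thus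
  contribute \<open>1 + B c Z\<^sup>l + \<dots>\<close>, and the incomplete one has degree \<open>l - 1\<close> and constant term \<open>1\<close>.
\<close>

lemma elem_sum_nonzero:
  assumes x: "x ^ l = 1" "\<And>i. 0 < i \<Longrightarrow> i < l \<Longrightarrow> x ^ i \<noteq> 1" and l: "0 < l" and B: "0 < B"
  shows "elem_sum x l (B * l + (l - 1)) \<noteq> 0"
proof -
  let ?P = "\<lambda>n. \<Prod>j<n. [:1, x ^ j:]"
  have P: "coeff (?P l) 0 = 1" "\<And>i. 0 < i \<Longrightarrow> i < l \<Longrightarrow> coeff (?P l) i = 0"
    "coeff (?P l) l = x ^ \<Sum>{..<l}"
    using elem_sum_period[OF x(1) x(2)] by (simp_all add: coeff_prod_elem_sum elem_sum_self)
  have "coeff (?P l ^ B) 0 = 1 \<and> (\<forall>i. 0 < i \<longrightarrow> i < l \<longrightarrow> coeff (?P l ^ B) i = 0) \<and>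
      coeff (?P l ^ B) l = of_nat B * x ^ \<Sum>{..<l}" for B
  proof (induction B)
    case 0
    then show ?case using l by (simp add: coeff_1)
  next
    case (Suc B)
    have "coeff (?P l * ?P l ^ B) i = 0" if "0 < i" "i < l" for i
      using coeff_mult_sparse[of i "?P l" "?P l ^ B"] that P(2) Suc by simp
    moreover have "coeff (?P l * ?P l ^ B) l = of_nat (Suc B) * x ^ \<Sum>{..<l}"
      using coeff_mult_sparse[OF l P(2), of "?P l ^ B"] P Suc by (simp add: algebra_simps)
    moreover have "coeff (?P l * ?P l ^ B) 0 = 1" using P(1) Suc by (simp add: coeff_mult_0)
    ultimately show ?case by simp
  qed
  note PB = this[of B]
  have "elem_sum x l (B * l + (l - 1)) = coeff (?P l ^ B * ?P (l - 1)) l"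
    by (simp add: prod_period[OF x(1)] flip: coeff_prod_elem_sum)
  also have "\<dots> = of_nat B * x ^ \<Sum>{..<l}"
    using coeff_mult_sparse[OF l, of "?P l ^ B" "?P (l - 1)"] PB l
    by (simp add: coeff_prod_elem_sum elem_sum_gt)
  finally show ?thesis
  proof -
    assume e: "elem_sum x l (B * l + (l - 1)) = of_nat B * x ^ \<Sum>{..<l}"
    have "x \<noteq> 0" using x(1) l by (metis power_0_left zero_neq_one not_gr0)
    then show ?thesis using e B by simp
  qed
qed

lemma no_singular_1:
  assumes "x = 1 \<or> x ^ (\<sigma> + j + 1) \<noteq> 1" "1 \<le> j"
  shows "no_singular x \<sigma> j"
proof -
  have "(\<Sum>i<\<sigma> + j + 1. x ^ i) \<noteq> 0"
  proof (cases "x = 1")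
    case True
    then show ?thesis by (simp add: of_nat_Suc[symmetric] del: of_nat_Suc of_nat_add)
  next
    case False
    have "(x - 1) * (\<Sum>i<\<sigma> + j + 1. x ^ i) = x ^ (\<sigma> + j + 1) - 1"
      by (rule power_diff_1_eq[symmetric])
    then show ?thesis using False assms by auto
  qed
  then show ?thesis unfolding no_singular_def using assms(2) elem_sum_1 by (intro exI[of _ 1]) auto
qed

lemma simple_window_generic:
  assumes "x = 1 \<or> (\<forall>i>0. x ^ i \<noteq> 1)"
  shows "simple_window x \<sigma>"
  unfolding simple_window_def
proof (intro allI impI)
  fix j :: nat assume "1 \<le> j"
  moreover have "x = 1 \<or> x ^ (\<sigma> + j + 1) \<noteq> 1" using assms by (metis add_gr_0 zero_less_one)
  ultimately show "no_singular x \<sigma> j \<or> \<sigma> = 0 \<and> j = 1" using no_singular_1 by blast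
qed

text \<open>
  For \<open>l\<close> not dividing \<open>\<sigma> + j + 1\<close> the choice \<open>m = 1\<close> works, and otherwise \<open>m = l\<close> as soon as \<open>l \<le> j\<close>. If
  \<open>l\<close> divides both \<open>\<sigma> + 1\<close> and \<open>\<sigma> + j + 1\<close>, it divides \<open>j\<close>, and then \<open>l \<le> j\<close>; for \<open>\<sigma> = 0\<close> and
  \<open>l = 2\<close>, only \<open>j = 1\<close> violates \<open>l \<le> j\<close>.
\<close>

lemma simple_window_root_of_unity:
  assumes x: "\<And>i. x ^ i = 1 \<longleftrightarrow> l dvd i" and l: "0 < l"
    and \<sigma>: "l dvd Suc \<sigma> \<or> \<sigma> = 0 \<and> l = 2"
  shows "simple_window x \<sigma>"
  unfolding simple_window_def
proof (intro allI impI)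
  fix j :: nat assume j: "1 \<le> j"
  show "no_singular x \<sigma> j \<or> \<sigma> = 0 \<and> j = 1"
  proof (cases "l dvd \<sigma> + j + 1")
    case False
    then show ?thesis using no_singular_1 j x by blast
  next
    case True
    show ?thesis
    proof (cases "l \<le> j")
      case le: True
      obtain B where B: "\<sigma> + j + 1 = l * B" using True by (elim dvdE)
      then have "0 < B" by (cases B) auto
      have "\<not> l dvd i" if "0 < i" "i < l" for i using that by (auto dest: dvd_imp_le)
      then have "elem_sum x l (B * l + (l - 1)) \<noteq> 0"
        using x l \<open>0 < B\<close> by (intro elem_sum_nonzero) auto
      moreover have "B * l + (l - 1) = \<sigma> + j + l" using B l by (simp add: mult.commute)
      ultimately show ?thesis using le l by (auto simp: no_singular_def intro!: exI[of _ l])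
    next
      case False
      have "\<not> l dvd Suc \<sigma>"
      proof
        assume "l dvd Suc \<sigma>"
        then have "l dvd j" using True by (metis Suc_eq_plus1 add.assoc add.commute dvd_add_right_iff)
        then show False using False j by (auto dest: dvd_imp_le)
      qed
      then have "\<sigma> = 0" "l = 2" using \<sigma> by auto
      then show ?thesis using False j by auto
    qed
  qed
qed

section \<open>Cuts of a link state\<close>

text \<open>
  Take the largest point reached by a cup or string starting at most at \<open>M\<close>. A cup crossing this point
  from below would have to start beyond \<open>M\<close>, inside the cup that ends there.
\<close>

lemma cut_exists: "\<exists>N \<ge> M. is_cut N w"
proof -
  define S where "S = {..M} \<union> partner w ` {..M}"
  define m where "m = Max S"
  have fin: "finite S" "S \<noteq> {}" by (auto simp: S_def)
  have ub: "a \<le> m" if "a \<in> S" for a unfolding m_def by (rule Max_ge[OF fin(1) that])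
  have mS: "m \<in> S" unfolding m_def by (rule Max_in[OF fin])
  have "is_cut (Suc (m)) w"
    unfolding is_cut_def
  proof (intro allI impI)
    fix a assume "a < Suc (m)"
    then have a: "a \<le> m" by simp
    show "partner w a < Suc (m)"
    proof (cases "a \<le> M")
      case True
      then have "partner w a \<in> S" by (simp add: S_def)
      from ub[OF this] show ?thesis by simp
    next
      case False
      then obtain b where b: "b \<le> M" "partner w b = m" using mS a by (auto simp: S_def)
      show ?thesis
      proof (cases "a = partner w b")
        case True
        then have "partner w a = b" by simp
        then have "partner w a \<in> S" using b(1) by (simp add: S_def)
        from ub[OF this] show ?thesis by simp
      next
        case False
        then have "b < a" "a < partner w b" using b a \<open>\<not> a \<le> M\<close> by linarith+
        from is_link_stateD(2)[OF partner_link_state this] show ?thesis using b by simp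
      qed
    qed
  qed
  moreover have "M \<in> S" by (simp add: S_def)
  from ub[OF this] have "M \<le> Suc (m)" by simp
  ultimately show ?thesis by blast
qed

lemma strings_below_eventually:
  assumes "finite (string_points w)"
  shows "\<exists>M. \<forall>N \<ge> M. strings_below N w = card (string_points w) \<and> (\<forall>a \<in> string_points w. a < N)"
proof -
  obtain M where M: "string_points w \<subseteq> {..<M}" using assms finite_nat_iff_bounded by blast
  have "strings_below N w = card (string_points w)" if "M \<le> N" for N
    unfolding strings_below_def string_points_def using M that
    by (intro arg_cong[where f = card]) (auto simp: string_points_def)
  then show ?thesis using M by (intro exI[of _ M]) auto
qed

text \<open>
No cup passes over a string, so every string point is a cut.
\<close>

lemma cut_at_string:
  assumes "infinite (string_points w)"
  shows "\<exists>N. m \<le> N \<and> is_cut N w \<and> strings_below N w = m"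
proof -
  let ?S = "string_points w" and ?e = "enumerate (string_points w)"
  let ?N = "?e m"
  have N: "?N \<in> ?S" using enumerate_in_set[OF assms] .
  have "is_cut ?N w"
    unfolding is_cut_def
  proof (intro allI impI)
    fix a assume "a < ?N"
    moreover have "\<not> (a < ?N \<and> ?N < partner w a)"
      using is_link_stateD(3)[OF partner_link_state[of w], of a ?N] N by (auto simp: string_points_def)
    moreover have "partner w a \<noteq> ?N" using N \<open>a < ?N\<close> by (auto simp: string_points_def) (metis less_irrefl partner_partner)
    ultimately show "partner w a < ?N" by simp
  qed
  moreover have "{a. a < ?N \<and> partner w a = a} = ?e ` {..<m}"
  proof (intro Set.set_eqI iffI)
    fix a assume "a \<in> {a. a < ?N \<and> partner w a = a}"
    then have a: "a \<in> ?S" "a < ?N" by (auto simp: string_points_def)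
    obtain i where i: "a = ?e i" using enumerate_Ex[OF assms a(1)] by metis
    then show "a \<in> ?e ` {..<m}" using a(2) enumerate_mono_iff[OF assms] by auto
  next
    fix a assume "a \<in> ?e ` {..<m}"
    then show "a \<in> {a. a < ?N \<and> partner w a = a}"
      using enumerate_in_set[OF assms] enumerate_mono[OF _ assms] by (auto simp: string_points_def)
  qed
  moreover have "card (?e ` {..<m}) = m"
    by (subst card_image) (use enumerate_mono_iff[OF assms] in \<open>auto simp: inj_on_def, metis linorder_neqE_nat less_irrefl\<close>)
  moreover have "m \<le> ?N" using le_enumerate[OF assms] .
  ultimately show ?thesis by (auto simp: strings_below_def)
qed

section \<open>Grafting a finite link state onto the strings\<close>

lemma inj_on_of_strict_mono:
  fixes t :: "nat \<Rightarrow> nat"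
  assumes "\<And>a b. a \<in> A \<Longrightarrow> b \<in> A \<Longrightarrow> a < b \<Longrightarrow> t a < t b"
  shows "inj_on t A"
  by (rule inj_onI) (metis assms linorder_neqE_nat less_irrefl)

definition with_strings :: "nat \<Rightarrow> link_state set" where
  "with_strings K = {d. finite (string_points d) \<and> card (string_points d) = K}"

definition string_rank :: "link_state \<Rightarrow> nat \<Rightarrow> nat" where
  "string_rank d a = card {b \<in> string_points d. b < a}"

definition string_at :: "link_state \<Rightarrow> nat \<Rightarrow> nat" where
  "string_at d i = (THE a. a \<in> string_points d \<and> string_rank d a = i)"

lemma string_rank_less:
  assumes "a \<in> string_points d" "a < b"
  shows "string_rank d a < string_rank d b"
  unfolding string_rank_def by (rule psubset_card_mono) (use assms in auto)

lemma string_rank_less_iff: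
  "a \<in> string_points d \<Longrightarrow> b \<in> string_points d \<Longrightarrow> string_rank d a < string_rank d b \<longleftrightarrow> a < b"
  by (metis string_rank_less less_asym linorder_neqE_nat)

lemma string_rank_eq_iff:
  "a \<in> string_points d \<Longrightarrow> b \<in> string_points d \<Longrightarrow> string_rank d a = string_rank d b \<longleftrightarrow> a = b"
  by (metis string_rank_less less_irrefl linorder_neqE_nat)

lemma string_rank_image:
  assumes "d \<in> with_strings K"
  shows "string_rank d ` string_points d = {..<K}"
proof (rule card_subset_eq)
  have S: "finite (string_points d)" "card (string_points d) = K" using assms by (auto simp: with_strings_def)
  have "string_rank d a < K" if "a \<in> string_points d" for a
    unfolding string_rank_def S(2)[symmetric] by (rule psubset_card_mono[OF S(1)]) (use that in auto)
  then show "string_rank d ` string_points d \<subseteq> {..<K}" by auto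
  show "card (string_rank d ` string_points d) = card {..<K}"
    using S by (subst card_image) (auto simp: inj_on_def string_rank_eq_iff)
qed simp

lemma string_rank_bound: "d \<in> with_strings K \<Longrightarrow> a \<in> string_points d \<Longrightarrow> string_rank d a < K"
  using string_rank_image by blast

lemma string_at_rank: "a \<in> string_points d \<Longrightarrow> string_at d (string_rank d a) = a"
  unfolding string_at_def by (rule the_equality) (auto simp: string_rank_eq_iff)

lemma string_at_in:
  assumes "d \<in> with_strings K" "i < K"
  shows "string_at d i \<in> string_points d" "string_rank d (string_at d i) = i"
proof -
  obtain a where "a \<in> string_points d" "i = string_rank d a"
    using string_rank_image[OF assms(1)] assms(2) by blast
  then show "string_at d i \<in> string_points d" "string_rank d (string_at d i) = i"
    using string_at_rank by auto
qed

text \<open>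
  Ranks depend only on the order of the strings, so they are not changed by a move that keeps this order.
\<close>

lemma string_rank_transfer:
  assumes S': "string_points d' = t ` string_points d"
    and t: "\<And>a b. a \<in> string_points d \<Longrightarrow> b \<in> string_points d \<Longrightarrow> a < b \<Longrightarrow> t a < t b"
    and a: "a \<in> string_points d"
  shows "string_rank d' (t a) = string_rank d a"
proof -
  have iff: "t b < t c \<longleftrightarrow> b < c" if "b \<in> string_points d" "c \<in> string_points d" for b c
    using t that by (metis less_asym linorder_neqE_nat)
  have "{b \<in> string_points d'. b < t a} = t ` {b \<in> string_points d. b < a}"
    using a iff by (auto simp: S')
  moreover have "inj_on t {b \<in> string_points d. b < a}"
    using t by (intro inj_on_of_strict_mono) auto
  ultimately show ?thesis by (simp add: string_rank_def card_image)
qed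

text \<open>
  The strings of \<open>d\<close>, numbered from the left, are reconnected among each other as the points of \<open>y\<close> are.
  In diagrams: \<open>d\<close> is a diagram with through-lines on which \<open>y\<close> is placed.
\<close>

definition graft :: "link_state \<Rightarrow> link_state \<Rightarrow> link_state" where
  "graft d y = Abs_link_state (\<lambda>a. if a \<in> string_points d
     then string_at d (partner y (string_rank d a)) else partner d a)"

lemma partner_not_string: "partner d a \<in> string_points d \<longleftrightarrow> a \<in> string_points d"
  by (auto simp: string_points_def)

lemma graft_rank:
  assumes d: "d \<in> with_strings K" and y: "is_cut K y" and a: "a \<in> string_points d"
  shows "string_at d (partner y (string_rank d a)) \<in> string_points d"
    "string_rank d (string_at d (partner y (string_rank d a))) = partner y (string_rank d a)"
  using string_at_in[OF d, of "partner y (string_rank d a)"] y string_rank_bound[OF d a]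
  by (auto simp: is_cut_def)

lemma partner_graft:
  assumes d: "d \<in> with_strings K" and y: "is_cut K y"
  shows "partner (graft d y) a = (if a \<in> string_points d
     then string_at d (partner y (string_rank d a)) else partner d a)"
proof -
  let ?S = "string_points d"
  let ?g = "\<lambda>a. if a \<in> ?S then string_at d (partner y (string_rank d a)) else partner d a"
  note gr = graft_rank[OF d y]
  have nest: "partner y i < partner y k \<and> partner y i \<noteq> i" if "k < i" "i < partner y k" for i k
    using is_link_stateD[OF partner_link_state that] by auto
  have "is_link_state ?g"
  proof (rule is_link_stateI)
    fix a show "?g (?g a) = a"
      using gr[of a] string_at_rank[of a d] partner_not_string[of d a] by auto
  next
    fix a b assume ab: "a < b" "b < ?g a"
    show "?g b < ?g a \<and> ?g b \<noteq> b"
    proof (cases "a \<in> ?S")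
      case False
      then have "partner d b < partner d a" "partner d b \<noteq> b"
        using is_link_stateD[OF partner_link_state[of d], of a b] ab by auto
      then show ?thesis using False by (auto simp: string_points_def)
    next
      case a: True
      note ga = gr[OF a]
      show ?thesis
      proof (cases "b \<in> ?S")
        case b: True
        note gb = gr[OF b]
        have "string_rank d a < string_rank d b" using string_rank_less[OF a ab(1)] .
        moreover have "string_rank d b < partner y (string_rank d a)"
          using string_rank_less[OF b, of "string_at d (partner y (string_rank d a))"] ab(2) a ga(2) by simp
        ultimately have yb: "partner y (string_rank d b) < partner y (string_rank d a)"
          "partner y (string_rank d b) \<noteq> string_rank d b" using nest by blast+
        have "string_at d (partner y (string_rank d b)) < string_at d (partner y (string_rank d a))"
          using string_rank_less_iff[OF gb(1) ga(1)] yb(1) by (simp only: ga(2) gb(2))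
        moreover have "string_at d (partner y (string_rank d b)) \<noteq> b" using yb(2) gb(2) by metis
        ultimately show ?thesis using a b by simp
      next
        case b: False
        have "partner d b \<noteq> b" using b by (auto simp: string_points_def)
        moreover have "partner d b < ?g a"
        proof (rule ccontr)
          assume "\<not> partner d b < ?g a"
          moreover have "partner d b \<noteq> ?g a" using b a ga partner_not_string[of d b] by auto
          ultimately have "?g a < partner d b" by simp
          moreover have "partner d (?g a) = ?g a" using ga a by (simp add: string_points_def)
          ultimately show False using is_link_stateD(3)[OF partner_link_state[of d] ab(2)] by simp
        qed
        ultimately show ?thesis using b by simp
      qed
    qed
  qed
  then show ?thesis by (simp add: graft_def Abs_link_state_inverse)
qed

text \<open>
  If both \<open>i\<close> and \<open>i + 1\<close> are strings of \<open>d\<close>, they are neighbours in \<open>y\<close> as well, and \<open>e\<^sub>i\<close> acts on \<open>y\<close>.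
\<close>

lemma graft_rejoin_strings:
  assumes d: "d \<in> with_strings K" and y: "is_cut K y" and i: "i \<in> string_points d" "Suc i \<in> string_points d"
  shows "e_basis \<delta> i (graft d y) = lin_ext (\<lambda>y. Poly_Mapping.single (graft d y) 1) (e_basis \<delta> (string_rank d i) y)"
proof -
  let ?S = "string_points d" and ?j = "string_rank d i"
  note gr = graft_rank[OF d y] and pg = partner_graft[OF d y]
  have "{b \<in> ?S. b < Suc i} = insert i {b \<in> ?S. b < i}" using i by auto
  then have j: "string_rank d (Suc i) = Suc ?j" by (simp add: string_rank_def)
  have jK: "Suc ?j < K" using string_rank_bound[OF d i(2)] j by simp
  have eq: "partner (graft d y) a = b \<longleftrightarrow> partner y (string_rank d a) = string_rank d b"
    if "a \<in> ?S" "b \<in> ?S" for a b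
    using that gr[of a] string_rank_eq_iff by (auto simp: pg)
  have bs: "both_strings i (graft d y) \<longleftrightarrow> both_strings ?j y"
    using eq[OF i(1) i(1)] eq[OF i(2) i(2)] by (simp add: both_strings_def j)
  have cu: "partner (graft d y) i = Suc i \<longleftrightarrow> partner y ?j = Suc ?j"
    using eq[OF i] by (simp add: j)
  consider "both_strings ?j y" | "partner y ?j = Suc ?j" | "\<not> both_strings ?j y" "partner y ?j \<noteq> Suc ?j" by blast
  then show ?thesis
  proof cases
    case 1
    then show ?thesis using bs by (simp add: e_basis_both_strings)
  next
    case 2
    then show ?thesis using cu by (simp add: e_basis_cup)
  next
    case 3
    note n = 3 and n' = 3[folded bs cu]
    have y': "is_cut K (rejoin ?j y)"
      using rejoin_states[OF states_self[OF y] _ jK n] by (simp add: states_def)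
    have "rejoin i (graft d y) = graft d (rejoin ?j y)"
    proof (rule link_state_eqI)
      fix x
      show "partner (rejoin i (graft d y)) x = partner (graft d (rejoin ?j y)) x"
      proof (cases "x \<in> ?S")
        case False
        then have "partner d x \<notin> ?S" by (simp add: partner_not_string)
        then have "partner d x \<noteq> i" "partner d x \<noteq> Suc i" "x \<noteq> i" "x \<noteq> Suc i" using i False by auto
        then show ?thesis using False
          by (simp add: partner_graft[OF d y'] partner_rejoin[OF n'] pg rj_def)
      next
        case x: True
        have r: "x = i \<longleftrightarrow> string_rank d x = ?j" "x = Suc i \<longleftrightarrow> string_rank d x = Suc ?j"
          using string_rank_eq_iff x i j by metis+
        have at: "string_at d ?j = i" "string_at d (Suc ?j) = Suc i" "string_at d (string_rank d x) = x"
          using string_at_rank[OF i(1)] string_at_rank[OF i(2)] string_at_rank[OF x] j by simp_all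
        have pS: "partner (graft d y) a = string_at d (partner y (string_rank d a))" if "a \<in> ?S" for a
          using that by (simp add: pg)
        have cond: "partner (graft d y) x = i \<longleftrightarrow> partner y (string_rank d x) = ?j"
          "partner (graft d y) x = Suc i \<longleftrightarrow> partner y (string_rank d x) = Suc ?j"
          "partner (graft d y) i = i \<longleftrightarrow> partner y ?j = ?j"
          "partner (graft d y) (Suc i) = Suc i \<longleftrightarrow> partner y (Suc ?j) = Suc ?j"
          using eq[OF x i(1)] eq[OF x i(2)] eq[OF i(1) i(1)] eq[OF i(2) i(2)] by (simp_all only: j)
        have pi: "partner (graft d y) i = string_at d (partner y ?j)"
          "partner (graft d y) (Suc i) = string_at d (partner y (Suc ?j))"
          using pS[OF i(1)] pS[OF i(2)] by (simp_all only: j)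
        have "partner (rejoin i (graft d y)) x = rj i (Suc i) (partner (graft d y)) x"
          by (simp add: partner_rejoin[OF n'])
        also have "\<dots> = string_at d (rj ?j (Suc ?j) (partner y) (string_rank d x))"
          unfolding rj_def cond r by (simp only: if_distrib[of "string_at d"] at pi pS[OF x])
        also have "\<dots> = partner (graft d (rejoin ?j y)) x"
          using x by (simp add: partner_graft[OF d y'] partner_rejoin[OF n])
        finally show ?thesis .
      qed
    qed
    then show ?thesis using n n' by (simp add: e_basis_rejoin)
  qed
qed

text \<open>
  If one of \<open>i\<close>, \<open>i + 1\<close> is a string, \<open>e\<^sub>i\<close> moves it to the other end \<open>b\<close> of the adjoining cup. No string lies in
  between, so the order of the strings is kept. The last clause, for an arbitrary involution \<open>g\<close> of
  the strings in place of the identity, says that reconnecting the strings commutes with the move.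
\<close>

lemma string_points_rejoin_string:
  assumes n: "\<not> both_strings i d" "partner d i \<noteq> Suc i"
    and su: "s = i \<and> u = Suc i \<or> s = Suc i \<and> u = i"
    and p: "partner d s = s" "partner d u = b" "partner d b = u" "b \<noteq> i" "b \<noteq> Suc i"
    and gap: "\<And>c. c \<in> string_points d \<Longrightarrow> c \<noteq> s \<Longrightarrow> c < s \<longleftrightarrow> c < b"
    and t: "t = (\<lambda>a. if a = s then b else a)"
  shows "string_points (rejoin i d) = t ` string_points d"
    "\<And>a c. a \<in> string_points d \<Longrightarrow> c \<in> string_points d \<Longrightarrow> a < c \<Longrightarrow> t a < t c"
    "i \<notin> string_points (rejoin i d)" "Suc i \<notin> string_points (rejoin i d)"
    "\<forall>g. (\<forall>x \<in> string_points d. g x \<in> string_points d \<and> g (g x) = x) \<longrightarrow>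
      (\<forall>x. x \<notin> string_points d \<longrightarrow> g x = partner d x) \<longrightarrow>
      (\<forall>x \<in> string_points d. rj i (Suc i) g (t x) = t (g x)) \<and>
      (\<forall>x. x \<notin> string_points (rejoin i d) \<longrightarrow> rj i (Suc i) g x = rj i (Suc i) (partner d) x)"
proof -
  let ?S = "string_points d" and ?S' = "string_points (rejoin i d)"
  have S: "x \<in> ?S \<longleftrightarrow> partner d x = x" for x by (simp add: string_points_def)
  have S': "x \<in> ?S' \<longleftrightarrow> rj i (Suc i) (partner d) x = x" for x
    by (simp add: string_points_def partner_rejoin[OF n])
  have ne: "s \<noteq> u" "b \<noteq> s" "b \<noteq> u" using su p by auto
  have iS: "s \<in> ?S" "u \<notin> ?S" "b \<notin> ?S" using p ne by (simp_all add: S)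
  have px: "partner d x = s \<longleftrightarrow> x = s" "partner d x = u \<longleftrightarrow> x = b" for x
    using p by (metis partner_partner)+
  have rj: "rj i (Suc i) g x = (if x = s then u else if x = u then s
      else if g x = s then (if g u = u then x else g u)
      else if g x = u then (if g s = s then x else g s) else g x)" for g x
    using su
  proof (elim disjE conjE)
    assume "s = Suc i" "u = i"
    then show ?thesis by (cases "x = i"; cases "g x = i") (simp_all add: rj_def)
  qed (simp add: rj_def)
  show SS: "?S' = t ` ?S"
  proof (rule Set.set_eqI)
    fix x
    have "x \<in> t ` ?S \<longleftrightarrow> x = b \<or> x \<in> ?S \<and> x \<noteq> s" using iS by (auto simp: t)
    then show "x \<in> ?S' \<longleftrightarrow> x \<in> t ` ?S"
      using p ne px[of x] unfolding S' by (auto simp: rj S)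
  qed
  show "t a < t c" if ac: "a \<in> ?S" "c \<in> ?S" "a < c" for a c
  proof -
    have "c \<noteq> b" using ac(2) iS by auto
    then show ?thesis using ac gap[OF ac(1)] gap[OF ac(2)] by (cases "a = s"; cases "c = s") (auto simp: t)
  qed
  show iS': "i \<notin> ?S'" "Suc i \<notin> ?S'" unfolding S' by (simp_all add: rj_def)
  show "\<forall>g. (\<forall>x \<in> ?S. g x \<in> ?S \<and> g (g x) = x) \<longrightarrow> (\<forall>x. x \<notin> ?S \<longrightarrow> g x = partner d x) \<longrightarrow>
      (\<forall>x \<in> ?S. rj i (Suc i) g (t x) = t (g x)) \<and>
      (\<forall>x. x \<notin> ?S' \<longrightarrow> rj i (Suc i) g x = rj i (Suc i) (partner d) x)"
  proof (intro allI impI)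
    fix g assume "\<forall>x \<in> ?S. g x \<in> ?S \<and> g (g x) = x" "\<forall>x. x \<notin> ?S \<longrightarrow> g x = partner d x"
    then have g: "\<And>x. x \<in> ?S \<Longrightarrow> g x \<in> ?S \<and> g (g x) = x" "\<And>x. x \<notin> ?S \<Longrightarrow> g x = partner d x"
      by blast+
    have g': "g u = b" "g b = u" using g(2) iS p by simp_all
    have "rj i (Suc i) g (t x) = t (g x)" if x: "x \<in> ?S" for x
    proof (cases "x = s")
      case True
      then show ?thesis using g' ne by (auto simp: rj t)
    next
      case False
      have "x \<noteq> u" "g x \<noteq> u" using x g(1)[OF x] iS by auto
      then show ?thesis using False g' ne by (auto simp: rj t)
    qed
    moreover have "rj i (Suc i) g x = rj i (Suc i) (partner d) x" if x: "x \<notin> ?S'" for x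
    proof (cases "x = s \<or> x = u")
      case False
      have "x \<notin> ?S" "x \<noteq> b" using x False iS unfolding SS by (auto simp: t)
      then show ?thesis using False g(2) px[of x] by (simp add: rj)
    qed (auto simp: rj)
    ultimately show "(\<forall>x \<in> ?S. rj i (Suc i) g (t x) = t (g x)) \<and>
      (\<forall>x. x \<notin> ?S' \<longrightarrow> rj i (Suc i) g x = rj i (Suc i) (partner d) x)" by blast
  qed
qed

lemma string_points_rejoin:
  assumes n: "\<not> both_strings i d" "partner d i \<noteq> Suc i"
  obtains t where "string_points (rejoin i d) = t ` string_points d"
    "\<And>a b. a \<in> string_points d \<Longrightarrow> b \<in> string_points d \<Longrightarrow> a < b \<Longrightarrow> t a < t b"
    "i \<notin> string_points (rejoin i d)" "Suc i \<notin> string_points (rejoin i d)"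
    "\<forall>g. (\<forall>x \<in> string_points d. g x \<in> string_points d \<and> g (g x) = x) \<longrightarrow>
      (\<forall>x. x \<notin> string_points d \<longrightarrow> g x = partner d x) \<longrightarrow>
      (\<forall>x \<in> string_points d. rj i (Suc i) g (t x) = t (g x)) \<and>
      (\<forall>x. x \<notin> string_points (rejoin i d) \<longrightarrow> rj i (Suc i) g x = rj i (Suc i) (partner d) x)"
proof -
  let ?S = "string_points d" and ?S' = "string_points (rejoin i d)"
  note pr = partner_rejoin[OF n]
  have S: "x \<in> ?S \<longleftrightarrow> partner d x = x" for x by (simp add: string_points_def)
  have S': "x \<in> ?S' \<longleftrightarrow> rj i (Suc i) (partner d) x = x" for x by (simp add: string_points_def pr)
  have e: "partner d x = z \<longleftrightarrow> partner d z = x" for x z using partner_partner by metis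
  show thesis
  proof (cases rule: reconnect_cases[OF partner_partner n(1)[unfolded both_strings_def] n(2)])
    case (1 b)
    have "\<not> (b < i \<and> i < partner d b)" using is_link_stateD(3)[OF partner_link_state[of d], of b i] 1 by auto
    then have b: "Suc i < b" using 1 by auto
    have gap: "c < i \<longleftrightarrow> c < b" if c: "c \<in> string_points d" "c \<noteq> i" for c
    proof -
      have "c \<noteq> Suc i" using c 1 by (auto simp: S)
      moreover have "\<not> (Suc i < c \<and> c < b)"
        using is_link_stateD(3)[OF partner_link_state[of d], of "Suc i" c] 1(2) c by (auto simp: S)
      ultimately show ?thesis using b c by linarith
    qed
    show thesis
      by (rule that[OF string_points_rejoin_string[OF n _ 1(1-5) gap refl]]) auto
  next
    case (2 b)
    have "\<not> (i < Suc i \<and> Suc i < partner d i)"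
      using is_link_stateD(3)[OF partner_link_state[of d], of i "Suc i"] 2 by auto
    then have b: "b < i" using 2 by auto
    have gap: "c < Suc i \<longleftrightarrow> c < b" if c: "c \<in> string_points d" "c \<noteq> Suc i" for c
    proof -
      have "c \<noteq> i" "c \<noteq> b" using c 2 by (auto simp: S)
      moreover have "\<not> (b < c \<and> c < i)"
        using is_link_stateD(3)[OF partner_link_state[of d], of b c] 2(3) c by (auto simp: S)
      ultimately show ?thesis using b c by linarith
    qed
    show thesis
      by (rule that[OF string_points_rejoin_string[OF n _ 2(1-5) gap refl]]) auto
  next
    case (3 a b)
    have px: "partner d x = i \<longleftrightarrow> x = a" "partner d x = Suc i \<longleftrightarrow> x = b" for x
      using 3 e[of x i] e[of x "Suc i"] by auto
    have iS: "i \<notin> ?S" "Suc i \<notin> ?S" "a \<notin> ?S" "b \<notin> ?S" using 3 by (simp_all add: S)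
    show thesis
    proof (rule that[of id])
      show SS: "?S' = id ` ?S"
      proof (rule Set.set_eqI)
        fix x show "x \<in> ?S' \<longleftrightarrow> x \<in> id ` ?S"
          using 3(1-9) px[of x] unfolding S' by (auto simp: rj_def S)
      qed
      show "id c < id c'" if "c < c'" for c c' :: nat using that by simp
      show "i \<notin> ?S'" "Suc i \<notin> ?S'" unfolding S' by (simp_all add: rj_def)
      show "\<forall>g. (\<forall>x \<in> ?S. g x \<in> ?S \<and> g (g x) = x) \<longrightarrow> (\<forall>x. x \<notin> ?S \<longrightarrow> g x = partner d x) \<longrightarrow>
        (\<forall>x \<in> ?S. rj i (Suc i) g (id x) = id (g x)) \<and>
        (\<forall>x. x \<notin> ?S' \<longrightarrow> rj i (Suc i) g x = rj i (Suc i) (partner d) x)"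
      proof (intro allI impI)
      fix g assume "\<forall>x \<in> ?S. g x \<in> ?S \<and> g (g x) = x" "\<forall>x. x \<notin> ?S \<longrightarrow> g x = partner d x"
      then have g: "\<And>x. x \<in> ?S \<Longrightarrow> g x \<in> ?S \<and> g (g x) = x" "\<And>x. x \<notin> ?S \<Longrightarrow> g x = partner d x"
        by blast+
      have g': "g i = a" "g (Suc i) = b" using g(2) iS 3 by simp_all
      have "rj i (Suc i) g (id x) = id (g x)" if x: "x \<in> ?S" for x
      proof -
        have "x \<noteq> i" "x \<noteq> Suc i" "g x \<noteq> i" "g x \<noteq> Suc i" using x g(1)[OF x] iS by auto
        then show ?thesis by (simp add: rj_def)
      qed
      moreover have "rj i (Suc i) g x = rj i (Suc i) (partner d) x" if x: "x \<notin> ?S'" for x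
        using x g(2)[of x] g' 3(1,3) by (simp add: SS rj_def)
      ultimately show "(\<forall>x \<in> ?S. rj i (Suc i) g (id x) = id (g x)) \<and>
        (\<forall>x. x \<notin> ?S' \<longrightarrow> rj i (Suc i) g x = rj i (Suc i) (partner d) x)" by blast
      qed
    qed
  qed
qed

lemma rejoin_with_strings:
  assumes "d \<in> with_strings K" "\<not> both_strings i d" "partner d i \<noteq> Suc i"
  shows "rejoin i d \<in> with_strings K"
proof (rule string_points_rejoin[OF assms(2,3)])
  fix t assume t: "string_points (rejoin i d) = t ` string_points d"
    "\<And>a b. a \<in> string_points d \<Longrightarrow> b \<in> string_points d \<Longrightarrow> a < b \<Longrightarrow> t a < t b"
  have "inj_on t (string_points d)" using t(2) by (rule inj_on_of_strict_mono)
  then show ?thesis using assms(1) by (simp add: with_strings_def t(1) card_image)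
qed

text \<open>
  In all other cases than two strings, and apart from a loop, \<open>e\<^sub>i\<close> acts on \<open>d\<close> and leaves \<open>y\<close> alone.
\<close>

lemma graft_rejoin_host:
  assumes d: "d \<in> with_strings K" and y: "is_cut K y"
    and n: "\<not> both_strings i d" "partner d i \<noteq> Suc i"
  shows "e_basis \<delta> i (graft d y) = Poly_Mapping.single (graft (rejoin i d) y) 1"
proof -
  let ?S = "string_points d" and ?S' = "string_points (rejoin i d)"
  note gr = graft_rank[OF d y] and pg = partner_graft[OF d y]
  obtain t where t: "?S' = t ` ?S" "\<And>a b. a \<in> ?S \<Longrightarrow> b \<in> ?S \<Longrightarrow> a < b \<Longrightarrow> t a < t b"
    "i \<notin> ?S'" "Suc i \<notin> ?S'"
    and tg: "\<forall>g. (\<forall>x \<in> ?S. g x \<in> ?S \<and> g (g x) = x) \<longrightarrow> (\<forall>x. x \<notin> ?S \<longrightarrow> g x = partner d x) \<longrightarrow>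
      (\<forall>x \<in> ?S. rj i (Suc i) g (t x) = t (g x)) \<and>
      (\<forall>x. x \<notin> ?S' \<longrightarrow> rj i (Suc i) g x = rj i (Suc i) (partner d) x)"
    by (rule string_points_rejoin[OF n]) (rule that)
  note d' = rejoin_with_strings[OF d n]
  have gS: "partner (graft d y) a \<in> ?S" if "a \<in> ?S" for a using gr[OF that] that by (simp add: pg)
  have "a \<in> ?S" if "partner (graft d y) a = a" for a
    using that by (cases "a \<in> ?S") (auto simp: pg string_points_def)
  then have n1: "\<not> both_strings i (graft d y)"
    using n(1) by (auto simp: both_strings_def string_points_def)
  have n2: "partner (graft d y) i \<noteq> Suc i"
  proof
    assume a: "partner (graft d y) i = Suc i"
    show False
    proof (cases "i \<in> ?S")
      case True
      then have "Suc i \<in> ?S" using gS[OF True] a by simp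
      then show False using True n(1) by (simp add: both_strings_def string_points_def)
    qed (use a n(2) in \<open>simp add: pg\<close>)
  qed
  have G1: "\<forall>x \<in> ?S. partner (graft d y) x \<in> ?S \<and> partner (graft d y) (partner (graft d y) x) = x"
    using gS by (simp only: partner_partner) blast
  have G2: "\<forall>x. x \<notin> ?S \<longrightarrow> partner (graft d y) x = partner d x" by (simp add: pg)
  have tG: "(\<forall>x \<in> ?S. rj i (Suc i) (partner (graft d y)) (t x) = t (partner (graft d y) x)) \<and>
      (\<forall>x. x \<notin> ?S' \<longrightarrow> rj i (Suc i) (partner (graft d y)) x = rj i (Suc i) (partner d) x)"
    using tg[THEN spec, of "partner (graft d y)"] G1 G2 by blast
  have "rejoin i (graft d y) = graft (rejoin i d) y"
  proof (rule link_state_eqI)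
    fix x
    show "partner (rejoin i (graft d y)) x = partner (graft (rejoin i d) y) x"
    proof (cases "x \<in> ?S'")
      case True
      then obtain a where a: "a \<in> ?S" "x = t a" using t(1) by blast
      let ?b = "partner (graft d y) a"
      have b: "?b \<in> ?S" "string_rank d ?b = partner y (string_rank d a)"
        using gr[OF a(1)] a(1) by (simp_all add: pg)
      have "string_rank (rejoin i d) (t ?b) = partner y (string_rank (rejoin i d) x)"
        using string_rank_transfer[OF t(1,2)] a b by simp
      moreover have "t ?b \<in> ?S'" using b t(1) by blast
      ultimately have "partner (graft (rejoin i d) y) x = t ?b"
        using True string_at_rank by (metis partner_graft[OF d' y])
      moreover have "partner (rejoin i (graft d y)) x = t ?b"
        using tG a by (simp add: partner_rejoin[OF n1 n2])
      ultimately show ?thesis by simp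
    next
      case False
      then show ?thesis using tG
        by (simp add: partner_graft[OF d' y] partner_rejoin[OF n1 n2] partner_rejoin[OF n])
    qed
  qed
  then show "e_basis \<delta> i (graft d y) = Poly_Mapping.single (graft (rejoin i d) y) 1"
    by (simp add: e_basis_rejoin[OF n1 n2])
qed

section \<open>Proper subrepresentations from singular vectors\<close>

definition graft_map :: "(link_state \<Rightarrow>\<^sub>0 complex) \<Rightarrow> (link_state \<Rightarrow>\<^sub>0 complex) \<Rightarrow> (link_state \<Rightarrow>\<^sub>0 complex)" where
  "graft_map x0 = lin_ext (\<lambda>d. lin_ext (\<lambda>y. Poly_Mapping.single (graft d y) 1) x0)"

lemma subrep_with_strings: "subrep \<delta> (span_on (with_strings K))"
  unfolding subrep_iff
proof (intro conjI allI ballI)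
  show "cvec.subspace (span_on (with_strings K))" by (rule subspace_span_on)
  fix i x assume x: "x \<in> span_on (with_strings K)"
  have "e_basis \<delta> i d \<in> span_on (with_strings K)" if d: "d \<in> with_strings K" for d
  proof -
    consider "both_strings i d" | "partner d i = Suc i" | "\<not> both_strings i d" "partner d i \<noteq> Suc i" by blast
    then show ?thesis
      by cases (use d rejoin_with_strings[OF d] in
        \<open>simp_all add: e_basis_both_strings e_basis_cup e_basis_rejoin span_on_def\<close>)
  qed
  then show "e_op \<delta> i x \<in> span_on (with_strings K)"
    unfolding e_op_def by (intro lin_ext_in_subspace[OF subspace_span_on x])
qed

lemma lin_ext_fun_cscale: "lin_ext (\<lambda>v. cscale c (f v)) x = cscale c (lin_ext f x)"
  by (simp add: lin_ext_def cvec.scale_sum_right mult.commute)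

text \<open>
  Two strings of \<open>d\<close> are annihilated by \<open>e\<^sub>i\<close>, whereas after grafting \<open>e\<^sub>i\<close> acts on \<open>x0\<close>. This is the
  one place where \<open>x0\<close> must be singular.
\<close>

lemma graft_map_e_op:
  assumes z: "z \<in> span_on (with_strings K)" and x0: "x0 \<in> span_on {y. is_cut K y}"
    and sing: "\<And>j. Suc j < K \<Longrightarrow> e_op \<delta> j x0 = 0"
  shows "e_op \<delta> i (graft_map x0 z) = graft_map x0 (e_op \<delta> i z)"
proof -
  let ?g = "\<lambda>d y. Poly_Mapping.single (graft d y) (1 :: complex)"
  have "e_op \<delta> i (lin_ext (?g d) x0) = graft_map x0 (e_basis \<delta> i d)" if d: "d \<in> with_strings K" for d
  proof -
    have l: "e_op \<delta> i (lin_ext (?g d) x0) = lin_ext (\<lambda>y. e_basis \<delta> i (graft d y)) x0"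
      by (simp add: e_op_def lin_ext_lin_ext)
    consider "both_strings i d" | "partner d i = Suc i" | "\<not> both_strings i d" "partner d i \<noteq> Suc i" by blast
    then show ?thesis
    proof cases
      case 1
      then have s: "i \<in> string_points d" "Suc i \<in> string_points d"
        by (simp_all add: both_strings_def string_points_def)
      let ?j = "string_rank d i"
      have j: "Suc ?j < K"
        using string_rank_less[OF s(1), of "Suc i"] string_rank_bound[OF d s(2)] by simp
      have "lin_ext (\<lambda>y. e_basis \<delta> i (graft d y)) x0 = lin_ext (\<lambda>y. lin_ext (?g d) (e_basis \<delta> ?j y)) x0"
        by (rule lin_ext_cong[OF x0]) (use graft_rejoin_strings[OF d _ s] in simp)
      also have "\<dots> = lin_ext (?g d) (e_op \<delta> ?j x0)" by (simp add: e_op_def lin_ext_lin_ext)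
      finally show ?thesis using sing[OF j] 1 by (simp add: l e_basis_both_strings graft_map_def)
    next
      case 2
      have "i \<notin> string_points d" using 2 by (simp add: string_points_def)
      then have "e_basis \<delta> i (graft d y) = cscale \<delta> (?g d y)" if "is_cut K y" for y
        using 2 partner_graft[OF d that, of i] by (simp add: e_basis_cup)
      then have "lin_ext (\<lambda>y. e_basis \<delta> i (graft d y)) x0 = lin_ext (\<lambda>y. cscale \<delta> (?g d y)) x0"
        by (intro lin_ext_cong[OF x0]) simp
      then show ?thesis using 2 by (simp add: l e_basis_cup graft_map_def lin_ext_fun_cscale del: cscale_single)
    next
      case 3
      have "lin_ext (\<lambda>y. e_basis \<delta> i (graft d y)) x0 = lin_ext (?g (rejoin i d)) x0"
        by (intro lin_ext_cong[OF x0]) (use graft_rejoin_host[OF d _ 3] in simp)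
      then show ?thesis using 3 by (simp add: l e_basis_rejoin graft_map_def)
    qed
  qed
  then have "lin_ext (\<lambda>d. e_op \<delta> i (lin_ext (?g d) x0)) z = lin_ext (\<lambda>d. graft_map x0 (e_basis \<delta> i d)) z"
    by (intro lin_ext_cong[OF z])
  then show ?thesis by (simp add: graft_map_def e_op_def lin_ext_lin_ext)
qed

definition finite_states :: "nat \<Rightarrow> nat \<Rightarrow> link_state set" where
  "finite_states K \<sigma> = {y. is_cut K y \<and> (\<forall>a\<ge>K. partner y a = a) \<and> strings_below K y = \<sigma>}"

lemma graft_inj:
  assumes d: "d \<in> with_strings K"
  shows "inj_on (graft d) (finite_states K \<sigma>)"
proof (rule inj_onI)
  fix y y' assume y: "y \<in> finite_states K \<sigma>" "y' \<in> finite_states K \<sigma>" and eq: "graft d y = graft d y'"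
  have c: "is_cut K y" "is_cut K y'" using y by (auto simp: finite_states_def)
  show "y = y'"
  proof (rule link_state_eqI)
    fix k
    show "partner y k = partner y' k"
    proof (cases "k < K")
      case True
      note at = string_at_in[OF d True]
      have "partner (graft d y) (string_at d k) = partner (graft d y') (string_at d k)" by (simp add: eq)
      then have "string_at d (partner y k) = string_at d (partner y' k)"
        using at by (simp add: partner_graft[OF d c(1)] partner_graft[OF d c(2)])
      then show ?thesis
        using string_at_in(2)[OF d, of "partner y k"] string_at_in(2)[OF d, of "partner y' k"] c True
        by (metis is_cut_def)
    qed (use y in \<open>auto simp: finite_states_def\<close>)
  qed
qed

lemma lin_ext_inj_nonzero:
  assumes "inj_on f V" "x \<in> span_on V" "x \<noteq> 0"
  shows "lin_ext (\<lambda>v. Poly_Mapping.single (f v) 1) x \<noteq> 0"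
proof
  assume 0: "lin_ext (\<lambda>v. Poly_Mapping.single (f v) 1) x = 0"
  obtain v where v: "v \<in> Poly_Mapping.keys x" using assms(3) by (metis all_not_in_conv keys_eq_empty)
  have "0 = Poly_Mapping.lookup (lin_ext (\<lambda>v. Poly_Mapping.single (f v) 1) x) (f v)" by (simp add: 0)
  also have "\<dots> = (\<Sum>u\<in>Poly_Mapping.keys x. if u = v then Poly_Mapping.lookup x u else 0)"
    unfolding lin_ext_def lookup_sum
    by (rule sum.cong) (use assms v in \<open>auto simp: lookup_single when_def span_on_def inj_on_def\<close>)
  also have "\<dots> = Poly_Mapping.lookup x v" using v by simp
  finally show False using v by (simp add: in_keys_iff)
qed

text \<open>
  Provides a state close to \<open>w\<close> with more strings, onto which a singular vector can be grafted.
\<close>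

lemma exists_blank_state:
  assumes w: "is_cut N w" and m: "2 * m \<le> N"
  shows "\<exists>d. \<forall>a. partner d a =
    (if a < 2 * m then (if even a then Suc a else a - 1) else if a < N then a else partner w a)"
proof -
  let ?p = "\<lambda>a. if a < 2 * m then (if even a then Suc a else a - 1) else if a < N then a else partner w a"
  have ev: "even a \<Longrightarrow> a < 2 * m \<Longrightarrow> Suc a < 2 * m" for a by (auto elim!: evenE)
  have "is_link_state ?p"
  proof (rule is_link_stateI)
    fix a show "?p (?p a) = a"
      using ev[of a] cut_ge[OF w, of a] m by (auto simp: not_less elim!: oddE)
  next
    fix a b assume ab: "a < b" "b < ?p a"
    have "N \<le> a"
    proof (rule ccontr)
      assume "\<not> N \<le> a"
      then have "?p a \<le> Suc a" by auto
      then show False using ab by simp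
    qed
    then have "b < partner w a" "N \<le> b" using ab m by auto
    then show "?p b < ?p a \<and> ?p b \<noteq> b"
      using is_link_stateD[OF partner_link_state ab(1)] \<open>N \<le> a\<close> m by auto
  qed
  then have "partner (Abs_link_state ?p) = ?p" by (simp add: Abs_link_state_inverse)
  from fun_cong[OF this] show ?thesis by blast
qed

lemma graft_states:
  assumes w: "w \<in> with_strings \<sigma>" and N: "is_cut N w" "\<And>a. a \<in> string_points w \<Longrightarrow> a < N"
    and d: "d \<in> with_strings K" "\<And>a. a \<in> string_points d \<Longrightarrow> a < N" "is_cut N d"
      "\<And>a. N \<le> a \<Longrightarrow> partner d a = partner w a"
    and y: "y \<in> finite_states K \<sigma>"
  shows "graft d y \<in> states w N 0"
proof -
  have c: "is_cut K y" "strings_below K y = \<sigma>" using y by (auto simp: finite_states_def)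
  note pg = partner_graft[OF d(1) c(1)] and gr = graft_rank[OF d(1) c(1)]
  have "is_cut N (graft d y)"
    using d(2,3) gr(1) by (auto simp: is_cut_def pg)
  moreover have "partner (graft d y) a = partner w a" if "N \<le> a" for a
    using d(2)[of a] d(4)[OF that] that by (auto simp: pg)
  moreover have "strings_below N (graft d y) = strings_below N w"
  proof -
    let ?A = "{a. a < N \<and> partner (graft d y) a = a}" and ?B = "{k. k < K \<and> partner y k = k}"
    have A: "a \<in> ?A \<longleftrightarrow> a \<in> string_points d \<and> partner y (string_rank d a) = string_rank d a" for a
    proof (cases "a \<in> string_points d")
      case True
      then have "string_at d (partner y (string_rank d a)) = a \<longleftrightarrow> partner y (string_rank d a) = string_rank d a"
        using gr(2)[OF True] string_at_rank[OF True] by metis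
      then show ?thesis using True d(2) by (simp add: pg)
    next
      case False
      then show ?thesis by (simp add: pg) (simp add: string_points_def)
    qed
    have "bij_betw (string_rank d) ?A ?B"
      unfolding bij_betw_def
    proof (intro conjI Set.set_eqI iffI)
      show "inj_on (string_rank d) ?A" using A string_rank_eq_iff by (auto simp: inj_on_def)
      fix k assume "k \<in> string_rank d ` ?A"
      then show "k \<in> ?B" using A string_rank_bound[OF d(1)] by auto
    next
      fix k assume k: "k \<in> ?B"
      then have "string_at d k \<in> ?A" "k = string_rank d (string_at d k)"
        using string_at_in[OF d(1), of k] A by auto
      then show "k \<in> string_rank d ` ?A" by blast
    qed
    then have "strings_below N (graft d y) = \<sigma>"
      using c(2) by (simp add: strings_below_def bij_betw_same_card)
    moreover have "strings_below N w = \<sigma>"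
    proof -
      have "{a. a < N \<and> partner w a = a} = string_points w" using N(2) by (auto simp: string_points_def)
      then show ?thesis using w by (simp add: strings_below_def with_strings_def)
    qed
    ultimately show ?thesis by simp
  qed
  ultimately show ?thesis by (simp add: states_def)
qed

text \<open>
  Let \<open>d0\<close> have \<open>K\<close> strings and agree with \<open>w\<close> far out. The image \<open>G\<close> of \<open>\<X>(d0)\<close> under grafting is a
  nonzero subrepresentation of \<open>\<X>(w)\<close>. If it contained \<open>w\<close>, it would contain a standard state of
  a window, say the image of \<open>z'\<close>. But \<open>fold_std\<close> fixes the standard state, and it annihilates \<open>z'\<close>: a state with
  \<open>K\<close> strings in this window has no room for so many cups.
\<close>

lemma not_irreducible_generated_rep:
  assumes w: "w \<in> with_strings \<sigma>" and n: "1 \<le> n" "\<sigma> = 0 \<Longrightarrow> 2 \<le> n" and K: "K = \<sigma> + 2 * n"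
    and x0: "x0 \<in> span_on (finite_states K \<sigma>)" "x0 \<noteq> 0"
    and sing: "\<And>j. Suc j < K \<Longrightarrow> e_op \<delta> j x0 = 0"
  shows "\<not> irreducible_rep \<delta> (generated_rep \<delta> w)"
proof -
  have fin: "finite (string_points w)" "card (string_points w) = \<sigma>" using w by (auto simp: with_strings_def)
  obtain M where M: "\<And>N. M \<le> N \<Longrightarrow> strings_below N w = \<sigma>" "\<And>N a. M \<le> N \<Longrightarrow> a \<in> string_points w \<Longrightarrow> a < N"
    using strings_below_eventually[OF fin(1)] fin(2) by metis
  obtain N1 where N1: "N1 \<ge> M + K" "is_cut N1 w" using cut_exists by blast
  have sN1: "strings_below N1 w = \<sigma>" using M N1 by simp
  \<comment> \<open>Of the cups of \<open>w\<close> below \<open>N1\<close>, \<open>n\<close> are opened up into \<open>2 * n\<close> further strings, and \<open>m\<close> are kept.\<close>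
  define m where "m = card (closers w \<inter> {2 * 0..<N1}) - n"
  have "2 * card (closers w \<inter> {2 * 0..<N1}) + \<sigma> = N1"
    using states_window[OF states_self[OF N1(2)]] sN1 by simp
  then have m: "2 * m + K = N1" using N1 K by (simp add: m_def)
  obtain d0 where d0: "\<And>a. partner d0 a =
    (if a < 2 * m then (if even a then Suc a else a - 1) else if a < N1 then a else partner w a)"
    using exists_blank_state[OF N1(2), of m] m by auto
  have "a \<in> string_points d0 \<longleftrightarrow> a \<in> {2 * m..<N1}" for a
    using M(2)[of N1 a] N1(1) by (auto simp: string_points_def d0 elim!: oddE)
  then have S0: "string_points d0 = {2 * m..<N1}" by blast
  have d0K: "d0 \<in> with_strings K" using m by (auto simp: with_strings_def S0)
  have cut0: "is_cut N d0" if N: "N1 \<le> N" "is_cut N w" for N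
    unfolding is_cut_def
  proof (intro allI impI)
    fix a assume "a < N"
    moreover have "Suc a < N1" if "a < 2 * m" "even a" using that m K n by auto
    ultimately show "partner d0 a < N" using N by (auto simp: d0 is_cut_def)
  qed
  let ?X = "generated_rep \<delta> d0" and ?W = "generated_rep \<delta> w"
  have XK: "?X \<subseteq> span_on (with_strings K)"
    by (rule generated_rep_minimal[OF subrep_with_strings span_on_single[OF d0K]])
  have xc: "x0 \<in> span_on {y. is_cut K y}" using x0(1) by (auto simp: span_on_def finite_states_def)
  note equi = graft_map_e_op[OF _ xc sing]
  define G where "G = graft_map x0 ` ?X"
  have add: "graft_map x0 (u + v) = graft_map x0 u + graft_map x0 v" for u v
    by (simp add: graft_map_def lin_ext_add)
  have scale: "graft_map x0 (cscale c u) = cscale c (graft_map x0 u)" for c u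
    by (simp add: graft_map_def lin_ext_cscale)
  have image_stable: "stable \<delta> N (graft_map x0 ` U)" if "stable \<delta> N U" "U \<subseteq> span_on (with_strings K)" for N U
  proof -
    have U: "cvec.subspace U" using that by (simp add: stable_def)
    have "cvec.subspace (graft_map x0 ` U)"
    proof (rule cvec.subspaceI)
      have "graft_map x0 0 = 0" by (simp add: graft_map_def)
      then show "0 \<in> graft_map x0 ` U" using cvec.subspace_0[OF U] by (metis imageI)
      fix a b c assume "a \<in> graft_map x0 ` U" "b \<in> graft_map x0 ` U"
      then show "a + b \<in> graft_map x0 ` U" "cscale c a \<in> graft_map x0 ` U"
        using cvec.subspace_add[OF U] cvec.subspace_scale[OF U]
        by (auto simp: add[symmetric] scale[symmetric])
    qed
    moreover have "e_op \<delta> i x \<in> graft_map x0 ` U" if "Suc i < N" "x \<in> graft_map x0 ` U" for i x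
      using that equi \<open>U \<subseteq> _\<close> \<open>stable \<delta> N U\<close> by (auto simp: stable_def)
    ultimately show ?thesis by (simp add: stable_def)
  qed
  have "stable \<delta> N G" for N
    unfolding G_def by (rule image_stable[OF subrep_stable[OF subrep_generated_rep] XK])
  then have subG: "subrep \<delta> G"
    unfolding subrep_iff stable_def by (meson lessI)
  have states0: "d \<in> with_strings K" "\<And>a. a \<in> string_points d \<Longrightarrow> a < N" "is_cut N d"
      "\<And>a. N \<le> a \<Longrightarrow> partner d a = partner w a"
    if d: "d \<in> states d0 N 0" and N: "N1 \<le> N" "is_cut N w" for d N
  proof -
    have out: "partner d a = partner w a" if "N \<le> a" for a
      using d N that m by (auto simp: states_def d0)
    then show "\<And>a. N \<le> a \<Longrightarrow> partner d a = partner w a" .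
    show S: "a < N" if "a \<in> string_points d" for a
    proof (rule ccontr)
      assume "\<not> a < N"
      then have "a \<in> string_points w" using out[of a] that by (simp add: string_points_def)
      then show False using M(2)[of N a] N N1 \<open>\<not> a < N\<close> by simp
    qed
    show "is_cut N d" using d by (simp add: states_def)
    have "string_points d = {a. a < N \<and> partner d a = a}" using S by (auto simp: string_points_def)
    then have "card (string_points d) = strings_below N d" "finite (string_points d)" by (simp_all add: strings_below_def)
    moreover have "string_points d0 = {a. a < N \<and> partner d0 a = a}" using N S0 by (auto simp: string_points_def)
    then have "strings_below N d0 = K" using d0K by (simp add: strings_below_def with_strings_def)
    ultimately show "d \<in> with_strings K" using d by (simp add: with_strings_def states_def)
  qed
  have GW: "G \<subseteq> ?W"
  proof
    fix x assume "x \<in> G"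
    then obtain z where z: "z \<in> ?X" "x = graft_map x0 z" by (auto simp: G_def)
    obtain N0 where N0: "\<forall>N \<ge> N0. is_cut N d0 \<longrightarrow> z \<in> span_on (states d0 N 0)"
      using generated_rep_local[OF z(1)] by blast
    obtain N where N: "N \<ge> N0 + N1" "is_cut N w" using cut_exists by blast
    have "z \<in> span_on (states d0 N 0)" using N N0 cut0[of N] by auto
    moreover have "lin_ext (\<lambda>y. Poly_Mapping.single (graft d y) 1) x0 \<in> ?W" if d: "d \<in> states d0 N 0" for d
    proof (rule lin_ext_in_subspace[OF subrep_subspace[OF subrep_generated_rep] x0(1)])
      fix y assume y: "y \<in> finite_states K \<sigma>"
      have "graft d y \<in> states w N 0"
        using graft_states[OF w N(2) _ states0[OF d]] M(2)[of N] N N1 y by auto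
      then show "Poly_Mapping.single (graft d y) 1 \<in> ?W"
        using states_connected[OF states_self[OF N(2)] _ subrep_stable[OF subrep_generated_rep] single_in_generated] by blast
    qed
    ultimately show "x \<in> ?W"
      unfolding z(2) graft_map_def by (rule lin_ext_in_subspace[OF subrep_subspace[OF subrep_generated_rep]])
  qed
  have "graft_map x0 (Poly_Mapping.single d0 1) \<noteq> 0"
    using lin_ext_inj_nonzero[OF graft_inj[OF d0K] x0] by (simp add: graft_map_def)
  then have G0: "G \<noteq> {0}" using single_in_generated[of d0 \<delta>] by (auto simp: G_def)
  have "Poly_Mapping.single w 1 \<notin> G"
  proof
    assume "Poly_Mapping.single w 1 \<in> G"
    then obtain z where z: "z \<in> ?X" "Poly_Mapping.single w 1 = graft_map x0 z" by (auto simp: G_def)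
    obtain N0 where N0: "\<forall>N \<ge> N0. is_cut N d0 \<longrightarrow> z \<in> span_on (states d0 N 0)"
      using generated_rep_local[OF z(1)] by blast
    obtain N where N: "N \<ge> N0 + N1" "is_cut N w" using cut_exists by blast
    have N': "N1 \<le> N" "strings_below N w = \<sigma>" using N N1 M by auto
    let ?S = "span_on (states d0 N 0)"
    have "states d0 N 0 \<subseteq> with_strings K" using states0(1)[OF _ N'(1) N(2)] by blast
    then have SK: "?S \<subseteq> span_on (with_strings K)" by (rule span_on_mono)
    have "stable \<delta> N ?S"
      using subspace_span_on e_op_states'[of _ d0 N 0] by (auto simp: stable_def)
    then have T: "stable \<delta> N (graft_map x0 ` ?S)" by (rule image_stable[OF _ SK])
    have "z \<in> ?S" using N N0 cut0[of N] by simp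
    then have wT: "Poly_Mapping.single w 1 \<in> graft_map x0 ` ?S" unfolding z(2) by (rule imageI)
    define j where "j = card (closers w \<inter> {2 * 0..<N})"
    have j: "2 * j + \<sigma> = N" using states_window[OF states_self[OF N(2)]] N'(2) by (simp add: j_def)
    obtain s where s: "s \<in> states w N (0 + j)" "Poly_Mapping.single s 1 \<in> graft_map x0 ` ?S"
      using to_standard[OF states_self[OF N(2)], of j \<delta>] T wT j N'(2) by auto
    define k where "k = (if \<sigma> = 0 then j - 1 else j)"
    have k: "k \<le> j" "2 * k < N" "2 * k + K > N"
      using j K n m N'(1) by (auto simp: k_def)
    obtain z' where z': "z' \<in> ?S" "Poly_Mapping.single s 1 = graft_map x0 z'" using s(2) by blast
    have "fold_std \<delta> i (graft_map x0 z') = graft_map x0 (fold_std \<delta> i z')" for i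
    proof (induction i)
      case (Suc i)
      have i: "fold_std \<delta> i z' \<in> span_on (with_strings K)"
        using z'(1) SK subrep_with_strings[of \<delta> K] by (induction i) (auto intro: subrep_e_op)
      show ?case by (simp add: Suc equi i equi[OF subrep_e_op[OF subrep_with_strings i]])
    qed simp
    then have "fold_std \<delta> k (Poly_Mapping.single s 1) = graft_map x0 (fold_std \<delta> k z')" by (simp add: z'(2))
    moreover have "fold_std \<delta> k (Poly_Mapping.single s 1) = Poly_Mapping.single s 1"
      by (rule fold_std_fixed[OF span_on_single]) (use s(1) states_mono[OF k(1)] in auto)
    moreover have "states d0 N k = {}"
    proof -
      have "strings_below N d0 = K"
      proof -
        have "{a. a < N \<and> partner d0 a = a} = string_points d0" using N'(1) S0 by (auto simp: string_points_def)
        then show ?thesis using d0K by (simp add: strings_below_def with_strings_def)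
      qed
      then show ?thesis using states_window[of _ d0 N k] k(2,3) by fastforce
    qed
    then have "fold_std \<delta> k z' = 0"
      using fold_std_states[OF z'(1), of k \<delta>] k(2) by (simp add: span_on_empty)
    ultimately show False by (simp add: graft_map_def)
  qed
  then have "G \<noteq> ?W" using single_in_generated by blast
  then show ?thesis using subG GW G0 by (auto simp: irreducible_rep_def)
qed

section \<open>Raising and lowering operators on subsets\<close>

text \<open>
  The generator \<open>E\<close> of quantum \<open>sl\<^sub>2\<close> acting on the spin chain with \<open>N\<close> sites. The coefficients are rescaled by
  \<open>(-q)\<^bsup>-\<Sum>D\<^esup>\<close>, which turns all weights into natural powers of \<open>x = q\<^sup>2\<close> and the vector to be
  realised into the constant \<open>1\<close>.
\<close>

definition raise_op :: "complex \<Rightarrow> nat \<Rightarrow> (nat set \<Rightarrow> complex) \<Rightarrow> nat set \<Rightarrow> complex" where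
  "raise_op x N \<psi> D = (\<Sum>a \<in> {..<N} - D. x ^ card ({..<a} - D) * \<psi> (insert a D))"

text \<open>
The generator \<open>F\<close>, in the same normalisation.
\<close>

definition lower_op :: "complex \<Rightarrow> nat \<Rightarrow> (nat set \<Rightarrow> complex) \<Rightarrow> nat set \<Rightarrow> complex" where
  "lower_op x N \<psi> D = (\<Sum>a \<in> D \<inter> {..<N}. x ^ card (D \<inter> {a<..<N}) * \<psi> (D - {a}))"

lemma raise_op_cong:
  assumes "\<And>E. E \<subseteq> {..<N} \<Longrightarrow> card E = Suc (card D) \<Longrightarrow> \<psi> E = \<phi> E" "D \<subseteq> {..<N}"
  shows "raise_op x N \<psi> D = raise_op x N \<phi> D"
  unfolding raise_op_def
proof (rule sum.cong[OF refl])
  fix a assume a: "a \<in> {..<N} - D"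
  have "finite D" using assms(2) finite_subset by blast
  then show "x ^ card ({..<a} - D) * \<psi> (insert a D) = x ^ card ({..<a} - D) * \<phi> (insert a D)"
    using assms a by simp
qed

lemma lower_op_cong:
  assumes "\<And>E. E \<subseteq> {..<N} \<Longrightarrow> Suc (card E) = card D \<Longrightarrow> \<psi> E = \<phi> E" "D \<subseteq> {..<N}"
  shows "lower_op x N \<psi> D = lower_op x N \<phi> D"
  unfolding lower_op_def
proof (rule sum.cong[OF refl])
  fix a assume a: "a \<in> D \<inter> {..<N}"
  have "finite D" using assms(2) finite_subset by blast
  then have "Suc (card (D - {a})) = card D" using a by (intro card_Suc_Diff1) auto
  then show "x ^ card (D \<inter> {a<..<N}) * \<psi> (D - {a}) = x ^ card (D \<inter> {a<..<N}) * \<phi> (D - {a})"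
    using assms by (metis Diff_subset order_trans)
qed

lemma raise_op_lin: "raise_op x N (\<lambda>E. c * \<psi> E + e * \<phi> E) D = c * raise_op x N \<psi> D + e * raise_op x N \<phi> D"
  by (simp add: raise_op_def sum.distrib sum_distrib_left algebra_simps)

lemma lower_op_lin: "lower_op x N (\<lambda>E. c * \<psi> E + e * \<phi> E) D = c * lower_op x N \<psi> D + e * lower_op x N \<phi> D"
  by (simp add: lower_op_def sum.distrib sum_distrib_left algebra_simps)

lemma raise_op_Suc_up:
  assumes "D \<subseteq> {..<N}"
  shows "raise_op x (Suc N) \<psi> D = raise_op x N \<psi> D + x ^ (N - card D) * \<psi> (insert N D)"
proof -
  have "{..<Suc N} - D = insert N ({..<N} - D)" using assms by auto
  moreover have "card ({..<N} - D) = N - card D"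
    using assms by (subst card_Diff_subset) (auto intro: finite_subset)
  ultimately show ?thesis by (simp add: raise_op_def)
qed

lemma raise_op_Suc_down:
  assumes "D \<subseteq> {..<N}"
  shows "raise_op x (Suc N) \<psi> (insert N D) = raise_op x N (\<lambda>E. \<psi> (insert N E)) D"
proof -
  have "{..<Suc N} - insert N D = {..<N} - D" by auto
  moreover have "{..<a} - insert N D = {..<a} - D" if "a < N" for a using that by auto
  ultimately show ?thesis unfolding raise_op_def by (intro sum.cong) (auto simp: insert_commute)
qed

lemma lower_op_Suc_up:
  assumes "D \<subseteq> {..<N}"
  shows "lower_op x (Suc N) \<psi> D = lower_op x N \<psi> D"
proof -
  have "D \<inter> {..<Suc N} = D \<inter> {..<N}" "D \<inter> {a<..<Suc N} = D \<inter> {a<..<N}" for a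
    using assms by auto
  then show ?thesis by (simp add: lower_op_def)
qed

lemma lower_op_Suc_down:
  assumes "D \<subseteq> {..<N}"
  shows "lower_op x (Suc N) \<psi> (insert N D) = \<psi> D + x * lower_op x N (\<lambda>E. \<psi> (insert N E)) D"
proof -
  have N: "N \<notin> D" using assms by auto
  have "insert N D \<inter> {..<Suc N} = insert N (D \<inter> {..<N})" by auto
  then have "lower_op x (Suc N) \<psi> (insert N D) = x ^ card (insert N D \<inter> {N<..<Suc N}) * \<psi> (insert N D - {N})
      + (\<Sum>a \<in> D \<inter> {..<N}. x ^ card (insert N D \<inter> {a<..<Suc N}) * \<psi> (insert N D - {a}))"
    by (simp add: lower_op_def)
  also have "insert N D \<inter> {N<..<Suc N} = {}" by auto
  also have "insert N D - {N} = D" using N by simp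
  also have "(\<Sum>a \<in> D \<inter> {..<N}. x ^ card (insert N D \<inter> {a<..<Suc N}) * \<psi> (insert N D - {a}))
      = (\<Sum>a \<in> D \<inter> {..<N}. x * (x ^ card (D \<inter> {a<..<N}) * \<psi> (insert N (D - {a}))))"
  proof (rule sum.cong[OF refl])
    fix a assume a: "a \<in> D \<inter> {..<N}"
    have "insert N D \<inter> {a<..<Suc N} = insert N (D \<inter> {a<..<N})" "insert N D - {a} = insert N (D - {a})"
      using a N by auto
    then show "x ^ card (insert N D \<inter> {a<..<Suc N}) * \<psi> (insert N D - {a})
        = x * (x ^ card (D \<inter> {a<..<N}) * \<psi> (insert N (D - {a})))" by simp
  qed
  finally show ?thesis by (simp add: lower_op_def sum_distrib_left)
qed

lemma subset_Suc_cases: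
  fixes D :: "nat set"
  assumes "D \<subseteq> {..<Suc N}"
  obtains (up) "D \<subseteq> {..<N}" | (down) E where "E \<subseteq> {..<N}" "D = insert N E" "card D = Suc (card E)"
proof (cases "N \<in> D")
  case True
  have E: "D - {N} \<subseteq> {..<N}" using assms by (auto simp: less_Suc_eq dest!: subsetD)
  moreover have "D = insert N (D - {N})" using True by auto
  moreover have "card D = Suc (card (D - {N}))"
    using True assms by (metis card_Suc_Diff1 finite_lessThan finite_subset)
  ultimately show ?thesis using down by blast
next
  case False
  have "D \<subseteq> {..<N}"
  proof
    fix a assume a: "a \<in> D"
    then have "a \<noteq> N" "a < Suc N" using False assms by auto
    then show "a \<in> {..<N}" by simp
  qed
  then show ?thesis by (rule up)
qed

text \<open>
  The relation \<open>[E, F] = (K - K\<^sup>-\<^sup>1) / (q - q\<^sup>-\<^sup>1)\<close>, proved by removing the last site.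
\<close>

lemma raise_lower_commutator:
  assumes "D \<subseteq> {..<N}"
  shows "(x - 1) * (raise_op x N (lower_op x N \<psi>) D - lower_op x N (raise_op x N \<psi>) D)
    = (x ^ (N - card D) - x ^ card D) * \<psi> D"
  using assms
proof (induction N arbitrary: D \<psi>)
  case 0
  then show ?case by (simp add: raise_op_def lower_op_def)
next
  case (Suc N)
  let ?R = "raise_op x N" and ?L = "lower_op x N" and ?R' = "raise_op x (Suc N)" and ?L' = "lower_op x (Suc N)"
  let ?m = "\<lambda>E. \<psi> (insert N E)"
  show ?case
  proof (cases rule: subset_Suc_cases[OF Suc.prems])
    case up: 1
    let ?d = "card D"
    have dN: "?d \<le> N" using up card_mono[of "{..<N}" D] by simp
    have RL: "?R' (?L' \<psi>) D = ?R (?L \<psi>) D + x ^ (N - ?d) * (\<psi> D + x * ?L ?m D)"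
    proof -
      have "?R (?L' \<psi>) D = ?R (?L \<psi>) D"
        by (rule raise_op_cong[OF _ up]) (rule lower_op_Suc_up)
      then show ?thesis by (simp add: raise_op_Suc_up[OF up] lower_op_Suc_down[OF up])
    qed
    have LR: "?L' (?R' \<psi>) D = ?L (?R \<psi>) D + x ^ (N - ?d) * x * ?L ?m D"
    proof -
      have "?L (?R' \<psi>) D = ?L (\<lambda>E. 1 * ?R \<psi> E + x ^ (N - ?d) * x * ?m E) D"
      proof (rule lower_op_cong[OF _ up])
        fix E assume E: "E \<subseteq> {..<N}" "Suc (card E) = ?d"
        then have "N - card E = Suc (N - ?d)" using dN by simp
        then show "?R' \<psi> E = 1 * ?R \<psi> E + x ^ (N - ?d) * x * ?m E"
          by (simp add: raise_op_Suc_up[OF E(1)])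
      qed
      then show ?thesis
        using lower_op_lin[of x N 1 "?R \<psi>" "x ^ (N - ?d) * x" ?m D] by (simp add: lower_op_Suc_up[OF up])
    qed
    have "(x - 1) * (?R' (?L' \<psi>) D - ?L' (?R' \<psi>) D)
      = (x - 1) * (?R (?L \<psi>) D - ?L (?R \<psi>) D) + (x - 1) * x ^ (N - ?d) * \<psi> D"
      unfolding RL LR by (simp add: algebra_simps)
    also have "\<dots> = (x ^ (Suc N - ?d) - x ^ ?d) * \<psi> D"
      unfolding Suc.IH[OF up] using dN by (simp add: Suc_diff_le algebra_simps)
    finally show ?thesis .
  next
    case down: (2 E)
    let ?d = "card E"
    have dN: "?d \<le> N" using down(1) card_mono[of "{..<N}" E] by simp
    have RL: "?R' (?L' \<psi>) D = ?R \<psi> E + x * ?R (?L ?m) E"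
    proof -
      have "?R (\<lambda>F. ?L' \<psi> (insert N F)) E = ?R (\<lambda>F. 1 * \<psi> F + x * ?L ?m F) E"
        by (rule raise_op_cong[OF _ down(1)]) (simp add: lower_op_Suc_down)
      then show ?thesis
        using raise_op_lin[of x N 1 \<psi> x "?L ?m" E] by (simp add: down(2) raise_op_Suc_down[OF down(1)])
    qed
    have LR: "?L' (?R' \<psi>) D = ?R \<psi> E + x ^ (N - ?d) * ?m E + x * ?L (?R ?m) E"
    proof -
      have "?L (\<lambda>F. ?R' \<psi> (insert N F)) E = ?L (?R ?m) E"
        by (rule lower_op_cong[OF _ down(1)]) (rule raise_op_Suc_down)
      then show ?thesis
        by (simp add: down(2) lower_op_Suc_down[OF down(1)] raise_op_Suc_up[OF down(1)])
    qed
    have "(x - 1) * (?R' (?L' \<psi>) D - ?L' (?R' \<psi>) D)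
      = x * ((x - 1) * (?R (?L ?m) E - ?L (?R ?m) E)) - (x - 1) * x ^ (N - ?d) * ?m E"
      unfolding RL LR by (simp add: algebra_simps)
    also have "\<dots> = (x ^ (N - ?d) - x ^ Suc ?d) * ?m E"
      unfolding Suc.IH[OF down(1)] by (simp add: algebra_simps)
    finally show ?thesis using down by simp
  qed
qed

lemma raise_op_one:
  assumes "D \<subseteq> {..<N}"
  shows "raise_op x N (\<lambda>_. 1) D = (\<Sum>j<N - card D. x ^ j)"
  using assms
proof (induction N arbitrary: D)
  case 0
  then show ?case by (simp add: raise_op_def)
next
  case (Suc N)
  show ?case
  proof (cases rule: subset_Suc_cases[OF Suc.prems])
    case 1
    have "card D \<le> N" using 1 card_mono[of "{..<N}" D] by simp
    then show ?thesis using Suc.IH[OF 1] by (simp add: raise_op_Suc_up[OF 1] Suc_diff_le)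
  next
    case (2 E)
    then show ?thesis using Suc.IH[OF 2(1)] by (simp add: raise_op_Suc_down)
  qed
qed

text \<open>
  The usual consequence for a vector killed by \<open>E\<close>, with the scalar \<open>[j + 1] [\<lambda> - j]\<close> cleared of denominators.
\<close>

lemma raise_op_iterated_lower:
  assumes ker: "\<And>D. D \<subseteq> {..<N} \<Longrightarrow> Suc (card D) = n \<Longrightarrow> raise_op x N \<psi> D = 0"
    and D: "D \<subseteq> {..<N}" "card D = n + j"
  shows "(x - 1)\<^sup>2 * raise_op x N ((lower_op x N ^^ Suc j) \<psi>) D
    = (x ^ Suc j - 1) * (x ^ (N - (n + j)) - x ^ n) * (lower_op x N ^^ j) \<psi> D"
  using D
proof (induction j arbitrary: D)
  case 0
  have "lower_op x N (raise_op x N \<psi>) D = lower_op x N (\<lambda>_. 0) D"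
    by (rule lower_op_cong[OF _ 0(1)]) (use ker 0 in simp)
  then have "lower_op x N (raise_op x N \<psi>) D = 0" by (simp add: lower_op_def)
  then show ?case using raise_lower_commutator[OF 0(1), of x \<psi>] 0 by (simp add: power2_eq_square mult.assoc)
next
  case (Suc j)
  let ?L = "lower_op x N" and ?R = "raise_op x N"
  let ?\<phi> = "(?L ^^ Suc j) \<psi>"
  define r where "r = N - (n + Suc j)"
  have "n + Suc j \<le> N" using Suc.prems card_mono[of "{..<N}" D] by simp
  then have r: "N = n + Suc j + r" by (simp add: r_def)
  let ?\<gamma> = "(x ^ Suc j - 1) * (x ^ (N - (n + j)) - x ^ n)"
  have "(x - 1)\<^sup>2 * ?L (?R ?\<phi>) D = ?L (\<lambda>E. (x - 1)\<^sup>2 * ?R ?\<phi> E) D"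
    using lower_op_lin[of x N "(x - 1)\<^sup>2" "?R ?\<phi>" 0 "\<lambda>_. 0" D] by simp
  also have "\<dots> = ?L (\<lambda>E. ?\<gamma> * (?L ^^ j) \<psi> E) D"
    by (rule lower_op_cong[OF _ Suc.prems(1)]) (use Suc in simp)
  also have "\<dots> = ?\<gamma> * ?L ((?L ^^ j) \<psi>) D"
    using lower_op_lin[of x N ?\<gamma> "(?L ^^ j) \<psi>" 0 "\<lambda>_. 0" D] by simp
  finally have LR: "(x - 1)\<^sup>2 * ?L (?R ?\<phi>) D = ?\<gamma> * ?\<phi> D" by simp
  have "(x - 1) * (?R (?L ?\<phi>) D - ?L (?R ?\<phi>) D) = (x ^ r - x ^ (n + Suc j)) * ?\<phi> D"
    using raise_lower_commutator[OF Suc.prems(1), of x ?\<phi>] Suc.prems(2) by (simp only: r_def)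
  then have "(x - 1)\<^sup>2 * ?R (?L ?\<phi>) D = ?\<gamma> * ?\<phi> D + (x - 1) * ((x ^ r - x ^ (n + Suc j)) * ?\<phi> D)"
  proof -
    assume h: "(x - 1) * (?R (?L ?\<phi>) D - ?L (?R ?\<phi>) D) = (x ^ r - x ^ (n + Suc j)) * ?\<phi> D"
    have "(x - 1)\<^sup>2 * A = (x - 1)\<^sup>2 * B + (x - 1) * ((x - 1) * (A - B))" for A B
      by (simp add: power2_eq_square algebra_simps)
    from this[of "?R (?L ?\<phi>) D" "?L (?R ?\<phi>) D"] show ?thesis unfolding h LR .
  qed
  also have "\<dots> = (x ^ Suc (Suc j) - 1) * (x ^ r - x ^ n) * ?\<phi> D"
    by (simp add: r algebra_simps power_add)
  finally show ?case by (simp add: r_def)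
qed

text \<open>
  With more down than up spins there is no highest weight vector, unless \<open>x\<close> is a root of unity of small order. Indeed \<open>F\<close> can be applied only
  \<open>N - n\<close> times before no up spin is left, and \<open>raise_op_iterated_lower\<close> leads back from
  \<open>0\<close> step by step, because none of the scalars vanishes.
\<close>

lemma raise_op_injective:
  assumes x: "x \<noteq> 0" "\<And>i. 1 \<le> i \<Longrightarrow> i \<le> n \<Longrightarrow> x ^ i \<noteq> 1" and N: "N < 2 * n"
    and ker: "\<And>D. D \<subseteq> {..<N} \<Longrightarrow> Suc (card D) = n \<Longrightarrow> raise_op x N \<psi> D = 0"
    and D: "D \<subseteq> {..<N}" "card D = n"
  shows "\<psi> D = 0"
proof -
  have nN: "n \<le> N" using D card_mono[of "{..<N}" D] by simp
  have "(lower_op x N ^^ j) \<psi> E = 0" if "E \<subseteq> {..<N}" "card E = n + j" "j \<le> Suc (N - n)" for j E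
    using that(3,1,2)
  proof (induction j arbitrary: E rule: inc_induct)
    case base
    then show ?case using card_mono[of "{..<N}" E] nN by simp
  next
    case (step j)
    have "raise_op x N ((lower_op x N ^^ Suc j) \<psi>) E = raise_op x N (\<lambda>_. 0) E"
      by (rule raise_op_cong[OF _ step.prems(1)]) (use step in simp)
    then have 0: "(x ^ Suc j - 1) * (x ^ (N - (n + j)) - x ^ n) * (lower_op x N ^^ j) \<psi> E = 0"
      using raise_op_iterated_lower[OF ker step.prems] by (simp add: raise_op_def)
    have j: "n + j \<le> N" using step.prems card_mono[of "{..<N}" E] by simp
    have "x ^ Suc j \<noteq> 1" by (rule x(2)) (use j N nN in auto)
    moreover have "x ^ (N - (n + j)) \<noteq> x ^ n"
    proof
      assume e: "x ^ (N - (n + j)) = x ^ n"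
      define i where "i = n - (N - (n + j))"
      have i: "n = N - (n + j) + i" "1 \<le> i" "i \<le> n" using j N nN by (auto simp: i_def)
      have "x ^ (N - (n + j)) * x ^ i = x ^ (N - (n + j)) * 1" using e i(1) by (metis mult_1_right power_add)
      then show False using x(1) x(2)[OF i(2,3)] by simp
    qed
    ultimately show ?case using 0 by simp
  qed
  from this[of D 0] D show ?thesis by simp
qed

text \<open>
The sets that can occur as \<open>closers\<close> of a link state.
\<close>

definition ballot :: "nat set \<Rightarrow> bool" where
  "ballot D \<longleftrightarrow> (\<forall>m. 2 * card (D \<inter> {..<m}) \<le> m)"

text \<open>
  Split off the last site: both parts of \<open>\<psi>\<close> are again in the kernel and vanish on ballot sets.
  The recursion stops when there are too many down spins for a ballot set, where \<open>raise_op_injective\<close> applies.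
\<close>

lemma raise_kernel_ballot:
  assumes x: "x \<noteq> 0" "\<And>i. 1 \<le> i \<Longrightarrow> i \<le> n \<Longrightarrow> x ^ i \<noteq> 1"
    and ker: "\<And>D. D \<subseteq> {..<N} \<Longrightarrow> Suc (card D) = n \<Longrightarrow> raise_op x N \<psi> D = 0"
    and zero: "\<And>D. D \<subseteq> {..<N} \<Longrightarrow> card D = n \<Longrightarrow> ballot D \<Longrightarrow> \<psi> D = 0"
    and D: "D \<subseteq> {..<N}" "card D = n"
  shows "\<psi> D = 0"
  using x ker zero D
proof (induction N arbitrary: n \<psi> D)
  case 0
  then show ?case by (auto simp: ballot_def)
next
  case (Suc N)
  show ?case
  proof (cases "Suc N < 2 * n")
    case True
    then show ?thesis using raise_op_injective[of x n "Suc N" \<psi> D] Suc.prems by blast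
  next
    case nN: False
    have m: "\<psi> (insert N E) = 0" if E: "E \<subseteq> {..<N}" "Suc (card E) = n" for E
    proof (rule Suc.IH[of "card E" "\<lambda>E. \<psi> (insert N E)" E])
      show "x \<noteq> 0" "\<And>i. 1 \<le> i \<Longrightarrow> i \<le> card E \<Longrightarrow> x ^ i \<noteq> 1" using Suc.prems(1,2) E(2) by auto
      fix F assume F: "F \<subseteq> {..<N}"
      have fF: "finite F" "N \<notin> F" using F finite_subset by auto
      have FS: "insert N F \<subseteq> {..<Suc N}" using F by (auto simp: less_Suc_eq dest: subsetD)
      show "raise_op x N (\<lambda>E. \<psi> (insert N E)) F = 0" if "Suc (card F) = card E"
        using Suc.prems(3)[OF FS] fF that E(2) by (simp add: raise_op_Suc_down[OF F])
      show "\<psi> (insert N F) = 0" if "card F = card E" "ballot F"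
      proof (rule Suc.prems(4))
        show "ballot (insert N F)"
          unfolding ballot_def
        proof
          fix m
          show "2 * card (insert N F \<inter> {..<m}) \<le> m"
          proof (cases "N < m")
            case True
            have "card (insert N F \<inter> {..<m}) \<le> card (insert N F)" using fF by (intro card_mono) auto
            also have "\<dots> = n" using fF that E(2) by simp
            finally show ?thesis using True nN by simp
          next
            case False
            then have "insert N F \<inter> {..<m} = F \<inter> {..<m}" by auto
            then show ?thesis using that(2) by (simp add: ballot_def)
          qed
        qed
      qed (use FS fF that E in auto)
    qed (use E in auto)
    show ?thesis
    proof (cases rule: subset_Suc_cases[OF Suc.prems(5)])
      case 1
      show ?thesis
      proof (rule Suc.IH[of n \<psi> D])
        fix F assume F: "F \<subseteq> {..<N}"
        have FS: "F \<subseteq> {..<Suc N}" using F by (auto simp: less_Suc_eq dest: subsetD)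
        show "raise_op x N \<psi> F = 0" if "Suc (card F) = n"
          using Suc.prems(3)[OF FS that] m[OF F that] by (simp add: raise_op_Suc_up[OF F])
        show "\<psi> F = 0" if "card F = n" "ballot F"
          using Suc.prems(4)[OF FS that] .
      qed (use Suc.prems 1 in auto)
    next
      case (2 E)
      then show ?thesis using m[of E] Suc.prems(6) by simp
    qed
  qed
qed

section \<open>Existence of singular vectors\<close>

lemma closers_finite_states:
  assumes "y \<in> finite_states K \<sigma>"
  shows "closers y \<subseteq> {0..<K}" "2 * card (closers y) + \<sigma> = K"
proof -
  show s: "closers y \<subseteq> {0..<K}"
    using assms by (auto simp: finite_states_def closers_def) (metis less_irrefl not_less)
  have "is_cut 0 y" "is_cut K y" using assms by (auto simp: is_cut_def finite_states_def)
  from card_closers[OF this] show "2 * card (closers y) + \<sigma> = K"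
    using assms s by (simp add: finite_states_def strings_below_def Int_absorb2)
qed

lemma finite_finite_states: "finite (finite_states K \<sigma>)"
proof (rule finite_imageD)
  have "closers ` finite_states K \<sigma> \<subseteq> Pow {0..<K}" using closers_finite_states(1) by blast
  then show "finite (closers ` finite_states K \<sigma>)" by (rule finite_subset) simp
  show "inj_on closers (finite_states K \<sigma>)" using closers_inject by (auto simp: inj_on_def)
qed

text \<open>
  The matrix of the coefficients at the sets \<open>closers v\<close> is triangular with ones on the diagonal (\<open>amp_triangular\<close>).
\<close>

lemma triangular_solve:
  assumes Y: "Y \<subseteq> finite_states K \<sigma>"
  shows "\<exists>x \<in> span_on Y. \<forall>v \<in> Y. lin_val (amp q 0 K (closers v)) x = g v"
proof -
  have "finite Y" using Y finite_finite_states finite_subset by blast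
  then show ?thesis using Y
  proof (induction Y arbitrary: g rule: finite_ranking_induct[where f = "\<lambda>v. \<Sum>(closers v)"])
    case empty
    then show ?case by (auto simp: span_on_def)
  next
    case (insert v S)
    show ?case
    proof (cases "v \<in> S")
      case True
      then show ?thesis using insert.IH[of g] insert.prems by (simp add: insert_absorb)
    next
      case False
      have win: "closers u \<inter> {0..<K} = closers u" "is_cut 0 u" "is_cut K u" if "u \<in> insert v S" for u
      proof -
        have u: "u \<in> finite_states K \<sigma>" using that insert.prems by blast
        then show "is_cut 0 u" "is_cut K u" by (auto simp: is_cut_def finite_states_def)
        show "closers u \<inter> {0..<K} = closers u" using closers_finite_states(1)[OF u] by (rule Int_absorb2)
      qed
      obtain x' where x': "x' \<in> span_on S"
        "\<forall>u \<in> S. lin_val (amp q 0 K (closers u)) x' = g u - g v * amp q 0 K (closers u) v"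
        using insert.IH[of "\<lambda>u. g u - g v * amp q 0 K (closers u) v"] insert.prems by auto
      let ?x = "x' + Poly_Mapping.single v (g v)"
      have "amp q 0 K (closers v) u = 0" if u: "u \<in> S" for u
      proof (rule ccontr)
        assume nz: "amp q 0 K (closers v) u \<noteq> 0"
        have out: "partner v a = partner u a" if "a \<notin> {0..<K}" for a
          using that u insert.prems by (auto simp: finite_states_def)
        have "\<Sum>(closers v \<inter> {0..<K}) < \<Sum>(closers u \<inter> {0..<K})"
          by (rule amp_triangular[of 0 v K u q]) (use win out nz u False in auto)
        then show False using insert.hyps(2)[OF u] win u by simp
      qed
      then have "lin_val (amp q 0 K (closers v)) x' = lin_val (\<lambda>_. 0) x'"
        by (intro lin_val_cong[OF x'(1)])
      then have "lin_val (amp q 0 K (closers v)) ?x = g v"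
        using amp_closers_self[of 0 v K q] win by (simp add: lin_val_add) (simp add: lin_val_def)
      moreover have "lin_val (amp q 0 K (closers u)) ?x = g u" if "u \<in> S" for u
        using x'(2) that by (simp add: lin_val_add)
      moreover have "?x \<in> span_on (insert v S)"
        using x'(1) span_on_mono[of S "insert v S"]
        by (intro cvec.subspace_add[OF subspace_span_on] span_on_single) auto
      ultimately show ?thesis by (intro bexI[of _ ?x]) auto
    qed
  qed
qed

text \<open>
  The last closing point is joined to the last string before it, which exists by the ballot condition.
\<close>

lemma ballot_state_exists:
  assumes "D \<subseteq> {..<K}" "ballot D"
  shows "\<exists>y. closers y = D \<and> is_cut K y \<and> (\<forall>a\<ge>K. partner y a = a)"
  using assms
proof (induction K arbitrary: D)
  case 0
  have "is_link_state (\<lambda>a. a)" by (simp add: is_link_state_def)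
  then have "partner (Abs_link_state (\<lambda>a. a)) = (\<lambda>a. a)" by (simp add: Abs_link_state_inverse)
  then show ?case using 0 by (intro exI[of _ "Abs_link_state (\<lambda>a. a)"]) (simp add: closers_def is_cut_def)
next
  case (Suc K)
  show ?case
  proof (cases rule: subset_Suc_cases[OF Suc.prems(1)])
    case 1
    then obtain y where "closers y = D" "is_cut K y" "\<forall>a\<ge>K. partner y a = a" using Suc by blast
    then show ?thesis by (intro exI[of _ y]) (auto simp: is_cut_def less_Suc_eq)
  next
    case (2 E)
    have fin: "finite E" "K \<notin> E" using 2(1) finite_subset by auto
    have "ballot E"
      unfolding ballot_def
    proof
      fix m
      have "card (E \<inter> {..<m}) \<le> card (D \<inter> {..<m})" using 2 fin by (intro card_mono) auto
      moreover have "2 * card (D \<inter> {..<m}) \<le> m" using Suc.prems(2) by (simp add: ballot_def)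
      ultimately show "2 * card (E \<inter> {..<m}) \<le> m" by simp
    qed
    then obtain y where y: "closers y = E" "is_cut K y" "\<forall>a\<ge>K. partner y a = a" using Suc.IH 2(1) by blast
    have "2 * card (D \<inter> {..<Suc K}) \<le> Suc K" using Suc.prems(2) by (simp add: ballot_def)
    also have "D \<inter> {..<Suc K} = D" using Suc.prems(1) by auto
    finally have cE: "2 * card E < K" using 2(3) by simp
    let ?T = "{a \<in> {0..<K}. partner y a = a}"
    have "closers y \<inter> {0..<K} = E" using y(1) 2(1) by auto
    then have "2 * card E + card ?T = K" using card_closers[of 0 y K] y(2) by (simp add: is_cut_def)
    then have "card ?T > 0" using cE by simp
    then have T: "?T \<noteq> {}" "finite ?T" using card_gt_0_iff by blast+
    define a where "a = Max ?T"
    have a: "a < K" "partner y a = a" using Max_in[OF T(2,1)] by (auto simp: a_def)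
    have amax: "b \<le> a" if "b < K" "partner y b = b" for b
      unfolding a_def by (rule Max_ge[OF T(2)]) (use that in simp)
    have pK: "partner y K = K" using y(3) by simp
    let ?p = "(partner y)(a := K, K := a)"
    have ne: "partner y b \<noteq> a" "partner y b \<noteq> K" if "b \<noteq> a" "b \<noteq> K" for b
      using that a(2) pK by (metis partner_partner)+
    have "is_link_state ?p"
    proof (rule is_link_stateI)
      fix b show "?p (?p b) = b" using ne[of b] a by auto
    next
      fix b c assume bc: "b < c" "c < ?p b"
      show "?p c < ?p b \<and> ?p c \<noteq> c"
      proof (cases "b = a")
        case True
        then have c: "a < c" "c < K" using bc a by auto
        then have "partner y c \<noteq> c" using amax by (metis not_less)
        moreover have "partner y c < K" using y(2) c by (simp add: is_cut_def)
        ultimately show ?thesis using c True by simp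
      next
        case False
        then have b: "b \<noteq> K" using bc a by auto
        then have bc': "c < partner y b" using bc False by simp
        note N = is_link_stateD[OF partner_link_state[of y] bc(1) bc']
        have "c \<noteq> a" "c \<noteq> K" using N(3) a pK by auto
        then show ?thesis using N b False by simp
      qed
    qed
    then have p: "partner (Abs_link_state ?p) = ?p" by (simp add: Abs_link_state_inverse)
    have "closers (Abs_link_state ?p) = D"
    proof (rule Set.set_eqI)
      fix b
      have "b \<in> closers y \<longleftrightarrow> partner y b < b" by (simp add: closers_def)
      then show "b \<in> closers (Abs_link_state ?p) \<longleftrightarrow> b \<in> D"
        using a pK y(1) 2(2) by (auto simp: closers_def p)
    qed
    moreover have "is_cut (Suc K) (Abs_link_state ?p)"
      using y(2) a by (auto simp: is_cut_def p less_Suc_eq)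
    ultimately show ?thesis using y(3) a by (intro exI[of _ "Abs_link_state ?p"]) (simp add: p)
  qed
qed

lemma amp_cup_wide:
  assumes c: "is_cut N w" and ab: "partner w a = b" "a < b" "b < N" and D: "a \<notin> D" "b \<notin> D"
  shows "amp q 0 N (insert a D) w = q * amp q 0 N (insert b D) w"
proof -
  have ba: "partner w b = a" using ab by auto
  have T: "{a, b} \<subseteq> {0..<N}" "finite {a, b}" using ab by auto
  have R: "prod (amp_at q w (insert d D)) ({0..<N} - {a, b}) = prod (amp_at q w D) ({0..<N} - {a, b})"
    if "d = a \<or> d = b" for d
    by (intro prod.cong refl amp_at_insert) (use that ab ba in auto)
  have P: "prod f {a, b} = f a * f b" for f :: "nat \<Rightarrow> complex" using ab by simp
  have "amp_at q w (insert a D) a = q" "amp_at q w (insert a D) b = 1"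
    "amp_at q w (insert b D) a = 1" "amp_at q w (insert b D) b = 1"
    using ab ba D by (auto simp: amp_at_def)
  then show ?thesis using R[of a] R[of b]
    by (simp only: amp_split[OF T, of q] P mult_1 mult_1_right simp_thms)
qed

text \<open>
  Strictly between the ends of a cup there are only cups, so half of the spins there are up.
\<close>

lemma card_up_between:
  assumes c: "is_cut N w" and ab: "partner w a = b" "a < b" "b < N" and D: "a \<notin> D" "b \<notin> D"
    and nz: "amp q 0 N (insert b D) w \<noteq> 0"
  shows "2 * card ({..<b} - D) = 2 * card ({..<a} - D) + (b - a) + 1"
proof -
  let ?I = "{a<..<b}"
  have I: "partner w e \<in> ?I" "partner w e \<noteq> e" "e \<in> D \<longleftrightarrow> partner w e \<notin> D" if e: "e \<in> ?I" for e
  proof -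
    have "a < e" "e < partner w a" using e ab by auto
    note L = is_link_stateD[OF partner_link_state this]
    show "partner w e \<in> ?I" "partner w e \<noteq> e" using L ab by auto
    then show "e \<in> D \<longleftrightarrow> partner w e \<notin> D"
      using amp_nonzeroD[OF nz, of e] e ab by auto
  qed
  have bij: "bij_betw (partner w) (?I - D) (?I \<inter> D)"
  proof (rule bij_betw_byWitness[where f' = "partner w"])
    show "partner w ` (?I - D) \<subseteq> ?I \<inter> D" "partner w ` (?I \<inter> D) \<subseteq> ?I - D" using I by blast+
  qed simp_all
  have "card ((?I - D) \<union> (?I \<inter> D)) = card (?I - D) + card (?I \<inter> D)"
    by (rule card_Un_disjoint) auto
  moreover have "(?I - D) \<union> (?I \<inter> D) = ?I" by auto
  ultimately have "card ?I = card (?I - D) + card (?I \<inter> D)" by simp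
  then have h: "2 * card (?I - D) = b - a - 1" using bij_betw_same_card[OF bij] by simp
  have "{..<b} - D = insert a (({..<a} - D) \<union> (?I - D))" using ab D by auto
  moreover have "card (({..<a} - D) \<union> (?I - D)) = card ({..<a} - D) + card (?I - D)"
    by (rule card_Un_disjoint) auto
  ultimately have "card ({..<b} - D) = Suc (card ({..<a} - D) + card (?I - D))" by simp
  then show ?thesis using h ab by simp
qed

text \<open>
  The value at \<open>D\<close> is a sum over the points that may be added to \<open>D\<close>. A configuration obtained in this
  way occurs in \<open>w\<close> only if the new point is an end of a cup with both ends outside \<open>D\<close>, and the terms of
  the two ends of that cup cancel.
\<close>

lemma raise_op_amp:
  assumes c: "is_cut N w" and q: "q \<noteq> 0" and D: "D \<subseteq> {..<N}"
  shows "raise_op (q\<^sup>2) N (\<lambda>E. inverse ((- q) ^ \<Sum>E) * amp q 0 N E w) D = 0"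
proof -
  let ?t = "\<lambda>a. (q\<^sup>2) ^ card ({..<a} - D) * (inverse ((- q) ^ \<Sum>(insert a D)) * amp q 0 N (insert a D) w)"
  have finD: "finite D" using D finite_subset by blast
  have zero: "amp q 0 N (insert e D) w = 0" if "e \<notin> D" "e < N" "a < N" "a \<noteq> e" "partner w a \<noteq> a" "partner w a \<noteq> e" "a \<notin> D" "partner w a \<notin> D" for a e
    using amp_nonzeroD[of q 0 N "insert e D" w a] that by auto
  show ?thesis
  proof (cases "\<exists>a b. a < b \<and> b < N \<and> partner w a = b \<and> a \<notin> D \<and> b \<notin> D")
    case True
    then obtain a b where ab: "partner w a = b" "a < b" "b < N" "a \<notin> D" "b \<notin> D" by blast
    have "raise_op (q\<^sup>2) N (\<lambda>E. inverse ((- q) ^ \<Sum>E) * amp q 0 N E w) D = sum ?t {a, b}"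
      unfolding raise_op_def
      by (rule sum.mono_neutral_right) (use ab zero[of _ a] in auto)
    also have "\<dots> = ?t a + ?t b" using ab by simp
    also have "\<dots> = 0"
    proof (cases "amp q 0 N (insert b D) w = 0")
      case True
      then show ?thesis using amp_cup_wide[OF c ab, of q] by simp
    next
      case False
      have u: "2 * card ({..<b} - D) = 2 * card ({..<a} - D) + (b - a) + 1"
        by (rule card_up_between[OF c ab False])
      define Q where "Q = - q"
      have sq: "(q\<^sup>2) ^ n = Q ^ (2 * n)" for n by (simp add: Q_def power_mult)
      have Q: "Q \<noteq> 0" using q by (simp add: Q_def)
      define R where "R = inverse (Q ^ \<Sum>D) * amp q 0 N (insert b D) w"
      have "Q ^ (2 * card ({..<b} - D)) = Q ^ (2 * card ({..<a} - D)) * Q ^ (b - a) * Q"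
        unfolding u by (simp only: power_add power_one_right)
      moreover have "Q ^ b = Q ^ a * Q ^ (b - a)" using ab by (simp add: power_add[symmetric])
      ultimately have "Q ^ (2 * card ({..<b} - D)) * inverse (Q ^ b)
          = Q ^ (2 * card ({..<a} - D)) * Q * inverse (Q ^ a)"
        using Q by (simp add: field_simps)
      moreover have "?t b = Q ^ (2 * card ({..<b} - D)) * inverse (Q ^ b) * R"
        using finD ab unfolding sq Q_def[symmetric] R_def by (simp add: power_add mult_ac)
      moreover have "?t a = Q ^ (2 * card ({..<a} - D)) * inverse (Q ^ a) * (q * R)"
        using finD ab unfolding sq Q_def[symmetric] R_def amp_cup_wide[OF c ab] by (simp add: power_add mult_ac)
      moreover have "X * Y * (q * R) + X * Q * Y * R = 0" for X Y by (simp add: Q_def)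
      ultimately show ?thesis by (simp only:)
    qed
    finally show ?thesis .
  next
    case False
    have "amp q 0 N (insert a D) w = 0" if a: "a < N" "a \<notin> D" for a
    proof (rule ccontr)
      assume nz: "amp q 0 N (insert a D) w \<noteq> 0"
      from amp_nonzeroD[OF nz, of a] have p: "partner w a \<noteq> a" "partner w a \<notin> D" using a by auto
      have "partner w a < N" using c a by (simp add: is_cut_def)
      then show False using False p a by (metis linorder_neqE_nat partner_partner)
    qed
    then show ?thesis by (simp add: raise_op_def)
  qed
qed

text \<open>
  Choose \<open>x0\<close> such that its expansion has the coefficient \<open>(-q)\<^bsup>\<Sum>D\<^esup>\<close> at all ballot sets. After rescaling, the difference \<open>\<psi>\<close>
  between the constant \<open>1\<close> and the expansion vanishes there and lies in the kernel of \<open>E\<close>: on the constant,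
  \<open>E\<close> gives \<open>1 + x + \<dots> + x\<^bsup>\<sigma>+n\<^esup>\<close>, which is \<open>0\<close>. So the coefficients are as wanted at all
  sets, and they are those of a singular vector.
\<close>

lemma singular_vector_exists:
  assumes q: "q \<noteq> 0" "\<delta> = q + inverse q" and x: "\<And>i. (q\<^sup>2) ^ i = 1 \<longleftrightarrow> l dvd i" and l: "1 < l"
    and n: "1 \<le> n" "n < l" "l dvd \<sigma> + n + 1" and K: "K = \<sigma> + 2 * n"
  shows "\<exists>x0 \<in> span_on (finite_states K \<sigma>). x0 \<noteq> 0 \<and> (\<forall>j. Suc j < K \<longrightarrow> e_op \<delta> j x0 = 0)"
proof -
  let ?x = "q\<^sup>2" and ?Q = "- q" and ?Y = "finite_states K \<sigma>"
  have x1: "?x ^ i \<noteq> 1" if "1 \<le> i" "i \<le> n" for i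
    unfolding x using that n by (auto dest: dvd_imp_le)
  obtain x0 where x0: "x0 \<in> span_on ?Y" "\<And>v. v \<in> ?Y \<Longrightarrow> lin_val (amp q 0 K (closers v)) x0 = ?Q ^ \<Sum>(closers v)"
    using triangular_solve[OF order_refl, of K \<sigma> q "\<lambda>v. ?Q ^ \<Sum>(closers v)"] by blast
  let ?\<Phi> = "\<lambda>D. lin_val (amp q 0 K D) x0"
  define \<psi> where "\<psi> D = 1 * 1 + (- 1) * (inverse (?Q ^ \<Sum>D) * ?\<Phi> D)" for D
  have "\<psi> D = 0" if D: "D \<subseteq> {..<K}" "card D = n" for D
  proof (rule raise_kernel_ballot[of ?x n K \<psi> D])
    show "?x \<noteq> 0" using q by simp
    fix E assume E: "E \<subseteq> {..<K}"
    show "raise_op ?x K \<psi> E = 0" if "Suc (card E) = n"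
    proof -
      have "raise_op ?x K (\<lambda>D. inverse (?Q ^ \<Sum>D) * ?\<Phi> D) E
          = lin_val (\<lambda>v. raise_op ?x K (\<lambda>D. inverse (?Q ^ \<Sum>D) * amp q 0 K D v) E) x0"
        unfolding raise_op_def mult.assoc[symmetric] by (rule lin_val_fun_sum[symmetric])
      also have "\<dots> = lin_val (\<lambda>_. 0) x0"
        by (rule lin_val_cong[OF x0(1)]) (use raise_op_amp[OF _ q(1) E] in \<open>simp add: finite_states_def\<close>)
      finally have 0: "raise_op ?x K (\<lambda>D. inverse (?Q ^ \<Sum>D) * ?\<Phi> D) E = 0" by (simp add: lin_val_def)
      have "(?x - 1) * (\<Sum>j<\<sigma> + n + 1. ?x ^ j) = ?x ^ (\<sigma> + n + 1) - 1"
        by (rule power_diff_1_eq[symmetric])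
      moreover have "?x ^ (\<sigma> + n + 1) = 1" unfolding x by (rule n(3))
      moreover have "?x \<noteq> 1" using x1[of 1] n by simp
      ultimately have "(\<Sum>j<\<sigma> + n + 1. ?x ^ j) = 0" by simp
      moreover have "K - card E = \<sigma> + n + 1" using that K by simp
      ultimately have "raise_op ?x K (\<lambda>_. 1) E = 0" by (simp only: raise_op_one[OF E])
      then show ?thesis unfolding \<psi>_def raise_op_lin 0 by simp
    qed
    show "\<psi> E = 0" if cE: "card E = n" and bE: "ballot E"
    proof -
      obtain y where y: "closers y = E" "is_cut K y" "\<forall>a\<ge>K. partner y a = a"
        using ballot_state_exists[OF E bE] by blast
      have "closers y \<inter> {0..<K} = E" using y(1) E by auto
      then have "2 * n + strings_below K y = K"
        using card_closers[of 0 y K] y(2) cE by (simp add: is_cut_def strings_below_def)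
      then have "y \<in> ?Y" using y K by (simp add: finite_states_def)
      then show ?thesis using x0(2)[of y] y(1) q(1) by (simp add: \<psi>_def)
    qed
  qed (use x1 D in auto)
  then have \<Phi>: "?\<Phi> D = ?Q ^ \<Sum>D" if "D \<subseteq> {..<K}" "card D = n" for D
    using that q(1) by (simp add: \<psi>_def field_simps)
  have "?\<Phi> {..<n} \<noteq> 0" using \<Phi>[of "{..<n}"] K q(1) by simp
  then have nz: "x0 \<noteq> 0" by auto
  obtain r where r: "r \<in> ?Y" using nz x0(1) by (metis all_not_in_conv span_on_empty singletonD)
  have Yr: "?Y = states r K 0" using r by (auto simp: finite_states_def states_def)
  have "e_op \<delta> j x0 = 0" if j: "Suc j < K" for j
  proof (rule ccontr)
    assume ne: "e_op \<delta> j x0 \<noteq> 0"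
    \<comment> \<open>All states in \<open>e_op \<delta> j x0\<close> have the cup \<open>(j, j + 1)\<close>, so the relevant configurations have
      \<open>j + 1\<close> down and \<open>j\<close> up, which is the form that \<open>amp_cap_basis\<close> requires.\<close>
    let ?V = "{u \<in> states r K 0. partner u j = Suc j}"
    have "e_op \<delta> j x0 \<in> span_on ?V" using e_op_states[of x0 r K 0 j \<delta>] x0(1) j by (simp add: Yr)
    moreover have "is_cut 0 v \<and> is_cut K v" if "v \<in> ?V" for v using that by (simp add: states_def is_cut_def)
    moreover have "partner v a = partner u a" if "v \<in> ?V" "u \<in> ?V" "a \<notin> {0..<K}" for v u a
      using that by (simp add: states_def)
    ultimately obtain v where v: "v \<in> ?V" "lin_val (amp q 0 K (closers v \<inter> {0..<K})) (e_op \<delta> j x0) \<noteq> 0"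
      using amp_nonzero_exists[of ?V 0 K "e_op \<delta> j x0" q] ne by blast
    have vY: "v \<in> ?Y" using v(1) Yr by simp
    note cv = closers_finite_states[OF vY]
    have cup: "partner v j = Suc j" using v(1) by simp
    then have cup': "partner v (Suc j) = j" by (metis partner_partner)
    define D where "D = closers v - {Suc j}"
    have finc: "finite (closers v)" using cv(1) finite_subset by blast
    have D: "closers v = insert (Suc j) D" "j \<notin> D" "Suc j \<notin> D" "finite D"
      using cup cup' finc by (auto simp: D_def closers_def)
    have DK: "insert (Suc j) D \<subseteq> {..<K}" "insert j D \<subseteq> {..<K}" using cv(1) D(1) j by auto
    have card: "card (insert (Suc j) D) = n" "card (insert j D) = n" using cv(2) K D by simp_all
    have "lin_val (amp q 0 K (closers v)) (e_op \<delta> j x0)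
        = lin_val (\<lambda>u. lin_val (amp q 0 K (insert (Suc j) D)) (e_basis \<delta> j u)) x0"
      by (simp add: e_op_def lin_val_lin_ext D(1))
    also have "\<dots> = lin_val (\<lambda>u. inverse q * amp q 0 K (insert (Suc j) D) u + amp q 0 K (insert j D) u) x0"
      by (rule lin_val_cong[OF x0(1)], rule amp_cap_basis) (use j D q in \<open>auto simp: finite_states_def is_cut_def\<close>)
    also have "\<dots> = inverse q * ?Q ^ \<Sum>(insert (Suc j) D) + ?Q ^ \<Sum>(insert j D)"
      by (simp only: lin_val_fun_lin \<Phi>[OF DK(1) card(1)] \<Phi>[OF DK(2) card(2)])
    also have "\<dots> = 0" using D q(1) by simp
    finally show False using v(2) cv(1) by (simp add: Int_absorb2)
  qed
  then show ?thesis using x0(1) nz by blast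
qed

section \<open>The classification\<close>

lemma power_order_iff:
  assumes l: "l = (LEAST n. n > 0 \<and> q ^ (2 * n) = (1 :: complex))" and r: "root_of_unity q"
  shows "0 < l" "(q\<^sup>2) ^ i = 1 \<longleftrightarrow> l dvd i"
proof -
  let ?P = "\<lambda>n. n > 0 \<and> q ^ (2 * n) = 1"
  obtain m where "m > 0" "q ^ m = 1" using r by (auto simp: root_of_unity_def)
  then have "?P m" by (simp add: power_mult mult.commute[of 2]) 
  then have P: "?P l" unfolding l by (rule LeastI)
  then show l0: "0 < l" by simp
  have x1: "(q\<^sup>2) ^ l = 1" using P by (simp add: power_mult)
  have "x ^ i = (x ^ l) ^ (i div l) * x ^ (i mod l)" for x :: complex
    by (simp only: power_mult[symmetric] power_add[symmetric] mult_div_mod_eq)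
  from this[of "q\<^sup>2"] have e: "(q\<^sup>2) ^ i = (q\<^sup>2) ^ (i mod l)" by (simp add: x1)
  show "(q\<^sup>2) ^ i = 1 \<longleftrightarrow> l dvd i"
  proof
    assume i: "(q\<^sup>2) ^ i = 1"
    have "i mod l < l" using l0 by simp
    then have "\<not> ?P (i mod l)" unfolding l by (rule not_less_Least)
    then have "i mod l = 0" using i e by (auto simp: power_mult)
    then show "l dvd i" by (simp add: mod_eq_0_iff_dvd)
  next
    assume "l dvd i"
    then show "(q\<^sup>2) ^ i = 1" using e by (simp add: dvd_imp_mod_0)
  qed
qed

theorem theorem3p2:
  fixes q \<delta> :: complex and w :: link_state
  assumes "q \<noteq> 0" and "\<delta> = q + inverse q"
  shows "(generic q \<longrightarrow> irreducible_rep \<delta> (generated_rep \<delta> w)) \<and>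
    (root_of_unity q \<and> \<not> generic q \<longrightarrow>
      (\<forall>l::nat. l = (LEAST n. n > 0 \<and> q ^ (2 * n) = 1) \<longrightarrow>
        (if num_strings w = \<infinity> \<or>
            (\<exists>k::nat. k \<ge> 1 \<and> num_strings w = enat (k * l - 1)) \<or>
            (num_strings w = 0 \<and> l = 2)
         then irreducible_rep \<delta> (generated_rep \<delta> w)
         else indecomposable_rep \<delta> (generated_rep \<delta> w) \<and>
              \<not> irreducible_rep \<delta> (generated_rep \<delta> w))))"
proof (intro conjI impI allI)
  assume g: "generic q"
  have "q\<^sup>2 = 1 \<or> (\<forall>i>0. (q\<^sup>2) ^ i \<noteq> 1)"
  proof (cases "root_of_unity q")
    case True
    then show ?thesis using g by (auto simp: generic_def)
  next
    case False
    have "(q\<^sup>2) ^ i \<noteq> 1" if "i > 0" for i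
    proof
      assume "(q\<^sup>2) ^ i = 1"
      then have "q ^ (2 * i) = 1" by (simp add: power_mult)
      then show False using False that by (metis root_of_unity_def mult_pos_pos zero_less_numeral)
    qed
    then show ?thesis by blast
  qed
  then have "simple_window (q\<^sup>2) \<sigma>" for \<sigma> by (rule simple_window_generic)
  then show "irreducible_rep \<delta> (generated_rep \<delta> w)"
    using irreducible_generated_rep[OF assms] cut_exists by blast
next
  fix l :: nat assume r: "root_of_unity q \<and> \<not> generic q" and l: "l = (LEAST n. n > 0 \<and> q ^ (2 * n) = 1)"
  note ord = power_order_iff[OF l conjunct1[OF r]]
  have "q\<^sup>2 \<noteq> 1" using r by (auto simp: generic_def power2_eq_1_iff)
  then have l1: "1 < l" using ord(2)[of 1] ord(1) by (cases "l = 1") auto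
  show "if num_strings w = \<infinity> \<or> (\<exists>k::nat. k \<ge> 1 \<and> num_strings w = enat (k * l - 1)) \<or> (num_strings w = 0 \<and> l = 2)
         then irreducible_rep \<delta> (generated_rep \<delta> w)
         else indecomposable_rep \<delta> (generated_rep \<delta> w) \<and> \<not> irreducible_rep \<delta> (generated_rep \<delta> w)"
  proof (cases "finite (string_points w)")
    case False
    have "\<exists>N \<ge> M. is_cut N w \<and> simple_window (q\<^sup>2) (strings_below N w)" for M
    proof -
      define c where "c = (M + 1) * l"
      have "(M + 1) * 1 \<le> (M + 1) * l" using l1 by (intro mult_le_mono2) simp
      then have c: "M \<le> c - 1" "Suc (c - 1) = c" by (simp_all add: c_def)
      have "l dvd Suc (c - 1)" unfolding c(2) by (simp add: c_def)
      then have "simple_window (q\<^sup>2) (c - 1)" using simple_window_root_of_unity[OF ord(2,1)] by blast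
      moreover obtain N where "c - 1 \<le> N" "is_cut N w" "strings_below N w = c - 1"
        using cut_at_string[OF False, of "c - 1"] by blast
      ultimately show ?thesis using c(1) by (intro exI[of _ N]) simp
    qed
    then have "irreducible_rep \<delta> (generated_rep \<delta> w)" by (rule irreducible_generated_rep[OF assms])
    then show ?thesis using False by (simp add: num_strings_def)
  next
    case fin: True
    define \<sigma> where "\<sigma> = card (string_points w)"
    have s: "num_strings w = enat \<sigma>" using fin by (simp add: num_strings_def \<sigma>_def)
    have cond: "(num_strings w = \<infinity> \<or> (\<exists>k::nat. k \<ge> 1 \<and> num_strings w = enat (k * l - 1)) \<or> (num_strings w = 0 \<and> l = 2))
        \<longleftrightarrow> l dvd Suc \<sigma> \<or> \<sigma> = 0 \<and> l = 2"
    proof -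
      have "(\<exists>k\<ge>1. \<sigma> = k * l - 1) \<longleftrightarrow> l dvd Suc \<sigma>"
      proof
        assume "\<exists>k\<ge>1. \<sigma> = k * l - 1"
        then obtain k where k: "1 \<le> k" "\<sigma> = k * l - 1" by blast
        then have "0 < k * l" using l1 by simp
        then have "Suc \<sigma> = k * l" using k(2) by linarith
        then show "l dvd Suc \<sigma>" by simp
      next
        assume "l dvd Suc \<sigma>"
        then obtain k where k: "Suc \<sigma> = l * k" by (elim dvdE)
        then have "1 \<le> k" by (cases k) auto
        moreover have "\<sigma> = k * l - 1" using k by (simp add: mult.commute)
        ultimately show "\<exists>k\<ge>1. \<sigma> = k * l - 1" by blast
      qed
      then show ?thesis by (simp add: s zero_enat_def)
    qed
    show ?thesis
    proof (cases "l dvd Suc \<sigma> \<or> \<sigma> = 0 \<and> l = 2")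
      case True
      have "\<exists>N \<ge> M. is_cut N w \<and> simple_window (q\<^sup>2) (strings_below N w)" for M
      proof -
        obtain M' where M': "\<forall>N \<ge> M'. strings_below N w = \<sigma> \<and> (\<forall>a \<in> string_points w. a < N)"
          using strings_below_eventually[OF fin] \<sigma>_def by blast
        obtain N where "N \<ge> M + M'" "is_cut N w" using cut_exists by blast
        moreover have "simple_window (q\<^sup>2) \<sigma>" by (rule simple_window_root_of_unity[OF ord(2,1) True])
        ultimately show ?thesis using M' by (intro exI[of _ N]) auto
      qed
      then have "irreducible_rep \<delta> (generated_rep \<delta> w)" by (rule irreducible_generated_rep[OF assms])
      then show ?thesis using cond True by simp
    next
      case False
      define n where "n = l - Suc \<sigma> mod l"
      have m: "0 < Suc \<sigma> mod l" "Suc \<sigma> mod l < l" using False l1 by (auto simp: mod_greater_zero_iff_not_dvd)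
      have n: "1 \<le> n" "n < l" using m by (auto simp: n_def)
      have "\<sigma> + n + 1 = Suc \<sigma> div l * l + l"
      proof -
        have "n + Suc \<sigma> mod l = l" using m by (simp add: n_def)
        then show ?thesis using div_mult_mod_eq[of "Suc \<sigma>" l] by linarith
      qed
      then have "l dvd \<sigma> + n + 1" by simp
      from singular_vector_exists[OF assms ord(2) l1 n this refl] obtain x0 where
        x0: "x0 \<in> span_on (finite_states (\<sigma> + 2 * n) \<sigma>)" "x0 \<noteq> 0"
          "\<And>j. Suc j < \<sigma> + 2 * n \<Longrightarrow> e_op \<delta> j x0 = 0" by blast
      have wS: "w \<in> with_strings \<sigma>" using fin by (simp add: with_strings_def \<sigma>_def)
      have "2 \<le> n" if "\<sigma> = 0" using that False l1 by (simp add: n_def)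
      then have "\<not> irreducible_rep \<delta> (generated_rep \<delta> w)"
        using not_irreducible_generated_rep[OF wS n(1) _ refl x0] by blast
      moreover have "indecomposable_rep \<delta> (generated_rep \<delta> w)"
        by (rule indecomposable_generated_rep) (rule cut_exists)
      ultimately show ?thesis using cond False by simp
    qed
  qed
qed

end
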